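(* Let $\Omega$ be an open subset of $\mathbb{R}^n$, $n \geq 1$, such that $\partial\Omega$ is $C^2$ near some point $\hat x \in \partial\Omega$, let $\mathcal{U}$ be a non-empty open subset of $\bar\Omega \times \mathbb{R} \times \mathbb{R}^n \times \mathrm{Sym}_n$ and let $F\in C^0(\bar{\mathcal{U}})$ be such that $(F,\mathcal{U})$ satisfies conditions (F1)--(F4) listed in the context. Assume that (i) $\psi_1 \in USC(\Omega \cup\{\hat x\};\mathbb{R} \cup\{-\infty\})$ and $\psi_2 \in LSC(\Omega \cup\{\hat x\};\mathbb{R} \cup \{\infty\})$ are a sub-solution and a super-solution to $F(x,\psi,\nabla\psi,\nabla^2\psi)=1$ in $\Omega$ in the viscosity sense, respectively, and (ii) $\psi_1 < \psi_2$ in $\Omega$, and $\psi_1(\hat x) = \psi_2(\hat x)$. If one of $\psi_1$ and $\psi_2$ belongs to $C^{1,1}(\Omega \cup\{\hat x\})$, then $$\liminf_{s \rightarrow 0^+} \frac{(\psi_2 - \psi_1)(\hat x - s \nu(\hat x))}{s} > 0,$$ where $\nu(\hat x)$ is the outward unit normal to $\partial\Omega$ at $\hat x$.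
   Context: $\mathrm{Sym}_n$ is the space of real symmetric $n\times n$ matrices; $N \geq 0$ means $N$ is non-negative definite. $\mathcal{U}$ is open relative to $\bar\Omega \times \mathbb{R} \times \mathbb{R}^n \times \mathrm{Sym}_n$. For $x\in\bar\Omega$, $\mathcal{U}_x := \{(s,p,M) \in \mathbb{R}\times\mathbb{R}^n\times \mathrm{Sym}_n: (x,s,p,M)\in\mathcal{U}\}$. Write $J_2[\psi] = (\psi,\nabla\psi,\nabla^2\psi)$. $USC(X;S)$ and $LSC(X;S)$ denote the upper, respectively lower, semi-continuous functions on $X$ with values in $S$. Conditions on $(F,\mathcal{U})$: (F1) (ellipticity) for all $(x,s,p,M) \in \mathcal{U}$ and $N \in \mathrm{Sym}_n$ with $N \geq 0$: $(x,s,p,M + N) \in \mathcal{U}$ and $F(x,s,p,M + N) \geq F(x,s,p,M)$. (F2) $F(x,s,p,M) < 1$ for all $x \in \bar\Omega$ and $(s,p,M) \in \partial \mathcal{U}_x$. (F3) (local strict ellipticity) for any compact subset $\mathcal{K}$ of $\mathcal{U}$ there is a constant $\delta(\mathcal{K}) > 0$ such that $F(x,s,p,M + N) - F(x, s, p,M) \geq \delta(\mathcal{K}) |N|$ for all $(x,s,p,M) \in \mathcal{K}$ and $N \in \mathrm{Sym}_n$ with $N \geq 0$. (F4) (local Lipschitz condition in $(s,p,M)$) for every compact subset $\mathcal{K}$ of $\mathcal{U}$ there exists $C(\mathcal{K}) > 0$ such that $|F(x, s, p, M) - F(x, s', p', M')| \leq C(\mathcal{K})(|s - s'| + |p - p'|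 + |M - M'|)$ for all $(x,s,p,M), (x,s',p',M') \in \mathcal{K}$. Viscosity sub-/super-solutions of $F(x,J_2[\psi])=1$ in $\Omega$: - $\psi \in USC(\Omega; \mathbb{R} \cup \{-\infty\})$ is a sub-solution ($F(x,J_2[\psi])\ge 1$ in the viscosity sense) if for any $x_0\in\Omega$ and $\varphi\in C^2(\Omega)$ with $(\psi-\varphi)(x_0)=0$ and $\psi-\varphi\leq 0$ near $x_0$, there holds $(x_0,J_2[\varphi](x_0)) \in \bar{\mathcal{U}}$ and $F(x_0, J_2[\varphi](x_0)) \geq 1$. - $\psi \in LSC(\Omega; \mathbb{R} \cup \{\infty\})$ is a super-solution ($F(x,J_2[\psi])\le 1$ in the viscosity sense) if for any $x_0\in\Omega$ and $\varphi\in C^2(\Omega)$ with $(\psi-\varphi)(x_0)=0$ and $\psi-\varphi\geq 0$ near $x_0$, either $(x_0,J_2[\varphi](x_0)) \notin \bar{\mathcal{U}}$ or $F(x_0, J_2[\varphi](x_0)) \leq 1$.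
   Formalization: In (F2), F < 1 is required on the x-slices of the boundary of U relative to closure(Ω)×R×R^n×Sym_n, which may be larger than the boundary of the slice U_x; with the boundary of U_x alone the claim fails (F = 1 + x²M − xp on x > 0, ψ_1 = 0, ψ_2 = x²). *)

theory Defs
  imports "HOL-Analysis.Analysis"
begin

section \<open>Semicontinuous functions, \<open>C\<^sup>2\<close> and \<open>C\<^bsup>1,1\<^esup>\<close> functions\<close>

definition usc_on :: "'a::topological_space set \<Rightarrow> ('a \<Rightarrow> ereal) \<Rightarrow> bool" where
  "usc_on S f \<longleftrightarrow> (\<forall>x\<in>S. Limsup (at x within S) f \<le> f x)"

definition lsc_on :: "'a::topological_space set \<Rightarrow> ('a \<Rightarrow> ereal) \<Rightarrow> bool" where
  "lsc_on S f \<longleftrightarrow> (\<forall>x\<in>S. f x \<le> Liminf (at x within S) f)"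

definition grad :: "(real^'n \<Rightarrow> real) \<Rightarrow> real^'n \<Rightarrow> real^'n" where
  "grad f x = (\<chi> i. frechet_derivative f (at x) (axis i 1))"

definition hess :: "(real^'n \<Rightarrow> real) \<Rightarrow> real^'n \<Rightarrow> real^'n^'n" where
  "hess f x = jacobian (grad f) (at x)"

text \<open>Only used for open sets \<open>S\<close>; continuity of \<open>f\<close> and \<open>grad f\<close> follows from differentiability.\<close>

definition C2_on :: "(real^'n) set \<Rightarrow> (real^'n \<Rightarrow> real) \<Rightarrow> bool" where
  "C2_on S f \<longleftrightarrow>
     (\<forall>x\<in>S. f differentiable (at x)) \<and>
     (\<forall>x\<in>S. grad f differentiable (at x)) \<and>
     continuous_on S (hess f)"

text \<open>The Lipschitz condition on the gradient is local, as usual for a space \<open>C\<^bsup>1,1\<^esup>(S)\<close> over a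
  set \<open>S\<close> that need not be compact. At a point of \<open>S\<close> that is not interior, the derivative is
  taken within \<open>S\<close>.\<close>

definition C11_on :: "(real^'n) set \<Rightarrow> (real^'n \<Rightarrow> real) \<Rightarrow> bool" where
  "C11_on S f \<longleftrightarrow>
     (\<exists>g. (\<forall>x\<in>S. (f has_derivative (\<lambda>h. g x \<bullet> h)) (at x within S)) \<and>
          (\<forall>x\<in>S. \<exists>r>0. \<exists>L. L-lipschitz_on (S \<inter> ball x r) g))"

definition ereal_C11_on :: "(real^'n) set \<Rightarrow> (real^'n \<Rightarrow> ereal) \<Rightarrow> bool" where
  "ereal_C11_on S \<psi> \<longleftrightarrow> (\<exists>f. C11_on S f \<and> (\<forall>x\<in>S. \<psi> x = ereal (f x)))"


section \<open>Boundaries of class \<open>C\<^sup>2\<close>\<close>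

definition C2_defining_function ::
    "(real^'n) set \<Rightarrow> (real^'n) set \<Rightarrow> (real^'n \<Rightarrow> real) \<Rightarrow> bool" where
  "C2_defining_function \<Omega> W \<rho> \<longleftrightarrow>
     open W \<and> C2_on W \<rho> \<and> (\<forall>y\<in>W. grad \<rho> y \<noteq> 0) \<and>
     \<Omega> \<inter> W = {y\<in>W. \<rho> y < 0} \<and> frontier \<Omega> \<inter> W = {y\<in>W. \<rho> y = 0}"

definition C2_boundary_near :: "(real^'n) set \<Rightarrow> real^'n \<Rightarrow> bool" where
  "C2_boundary_near \<Omega> x \<longleftrightarrow> (\<exists>W \<rho>. x \<in> W \<and> C2_defining_function \<Omega> W \<rho>)"

text \<open>For \<open>x\<close> in the frontier of \<open>\<Omega>\<close>, the vector \<open>\<nu>\<close> does not depend on the choice of the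
  defining function.\<close>

definition outward_unit_normal :: "(real^'n) set \<Rightarrow> real^'n \<Rightarrow> real^'n \<Rightarrow> bool" where
  "outward_unit_normal \<Omega> x \<nu> \<longleftrightarrow>
     (\<exists>W \<rho>. x \<in> W \<and> C2_defining_function \<Omega> W \<rho> \<and> \<nu> = grad \<rho> x /\<^sub>R norm (grad \<rho> x))"


section \<open>Structure conditions on the operator\<close>

type_synonym 'n jet = "(real^'n) \<times> real \<times> (real^'n) \<times> (real^'n^'n)"

definition Sym :: "(real^'n^'n) set" where
  "Sym = {M. transpose M = M}"

definition nonneg_definite :: "real^'n^'n \<Rightarrow> bool" where
  "nonneg_definite N \<longleftrightarrow> (\<forall>v. 0 \<le> v \<bullet> (N *v v))"

definition jet_space :: "(real^'n) set \<Rightarrow> 'n jet set" where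
  "jet_space \<Omega> = closure \<Omega> \<times> UNIV \<times> UNIV \<times> Sym"

definition slice :: "'n jet set \<Rightarrow> real^'n \<Rightarrow> (real \<times> (real^'n) \<times> (real^'n^'n)) set" where
  "slice V x = {(s, p, M). (x, s, p, M) \<in> V}"

definition elliptic :: "('n::finite jet \<Rightarrow> real) \<Rightarrow> 'n jet set \<Rightarrow> bool" where
  "elliptic F U \<longleftrightarrow>
     (\<forall>x s p M N. (x, s, p, M) \<in> U \<and> N \<in> Sym \<and> nonneg_definite N \<longrightarrow>
        (x, s, p, M + N) \<in> U \<and> F (x, s, p, M + N) \<ge> F (x, s, p, M))"

text \<open>The condition \<open>F < 1\<close> is imposed on the slices \<open>(\<partial>U)\<^sub>x\<close> of the boundary of \<open>U\<close> relative to
  the jet space. These contain the boundaries \<open>\<partial>(U\<^sub>x)\<close> of the slices of \<open>U\<close>, and may be strictly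
  larger: for \<open>U = {(x, s, p, M). x \<noteq> z}\<close> with \<open>z \<in> \<partial>\<Omega>\<close> all sets \<open>\<partial>(U\<^sub>x)\<close> are empty, and
  a condition on them alone would not prevent \<open>F\<close> from degenerating at \<open>z\<close>.\<close>

definition boundary_below_one ::
    "(real^'n) set \<Rightarrow> ('n::finite jet \<Rightarrow> real) \<Rightarrow> 'n jet set \<Rightarrow> bool" where
  "boundary_below_one \<Omega> F U \<longleftrightarrow>
     (\<forall>x \<in> closure \<Omega>. \<forall>(s, p, M) \<in> slice (top_of_set (jet_space \<Omega>) frontier_of U) x.
        F (x, s, p, M) < 1)"

definition locally_strictly_elliptic :: "('n::finite jet \<Rightarrow> real) \<Rightarrow> 'n jet set \<Rightarrow> bool" where
  "locally_strictly_elliptic F U \<longleftrightarrow>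
     (\<forall>K. compact K \<and> K \<subseteq> U \<longrightarrow>
        (\<exists>\<delta>>0. \<forall>x s p M N. (x, s, p, M) \<in> K \<and> N \<in> Sym \<and> nonneg_definite N \<longrightarrow>
           F (x, s, p, M + N) - F (x, s, p, M) \<ge> \<delta> * norm N))"

definition locally_lipschitz_in_jet :: "('n::finite jet \<Rightarrow> real) \<Rightarrow> 'n jet set \<Rightarrow> bool" where
  "locally_lipschitz_in_jet F U \<longleftrightarrow>
     (\<forall>K. compact K \<and> K \<subseteq> U \<longrightarrow>
        (\<exists>C>0. \<forall>x s p M s' p' M'. (x, s, p, M) \<in> K \<and> (x, s', p', M') \<in> K \<longrightarrow>
           \<bar>F (x, s, p, M) - F (x, s', p', M')\<bar>
             \<le> C * (\<bar>s - s'\<bar> + norm (p - p') + norm (M - M'))))"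


section \<open>Viscosity sub- and super-solutions of \<open>F(x, J\<^sub>2[\<psi>]) = 1\<close>\<close>

definition jet2 :: "(real^'n \<Rightarrow> real) \<Rightarrow> real^'n \<Rightarrow> 'n jet" where
  "jet2 \<phi> x = (x, \<phi> x, grad \<phi> x, hess \<phi> x)"

definition viscosity_subsolution ::
    "('n::finite jet \<Rightarrow> real) \<Rightarrow> 'n jet set \<Rightarrow> (real^'n) set \<Rightarrow> (real^'n \<Rightarrow> ereal) \<Rightarrow> bool" where
  "viscosity_subsolution F U \<Omega> \<psi> \<longleftrightarrow>
     usc_on \<Omega> \<psi> \<and> (\<forall>x\<in>\<Omega>. \<psi> x \<noteq> \<infinity>) \<and>
     (\<forall>x\<^sub>0\<in>\<Omega>. \<forall>\<phi>. C2_on \<Omega> \<phi> \<and> \<psi> x\<^sub>0 - ereal (\<phi> x\<^sub>0) = 0 \<and>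
          (\<forall>\<^sub>F x in nhds x\<^sub>0. \<psi> x - ereal (\<phi> x) \<le> 0) \<longrightarrow>
        jet2 \<phi> x\<^sub>0 \<in> closure U \<and> F (jet2 \<phi> x\<^sub>0) \<ge> 1)"

definition viscosity_supersolution ::
    "('n::finite jet \<Rightarrow> real) \<Rightarrow> 'n jet set \<Rightarrow> (real^'n) set \<Rightarrow> (real^'n \<Rightarrow> ereal) \<Rightarrow> bool" where
  "viscosity_supersolution F U \<Omega> \<psi> \<longleftrightarrow>
     lsc_on \<Omega> \<psi> \<and> (\<forall>x\<in>\<Omega>. \<psi> x \<noteq> -\<infinity>) \<and>
     (\<forall>x\<^sub>0\<in>\<Omega>. \<forall>\<phi>. C2_on \<Omega> \<phi> \<and> \<psi> x\<^sub>0 - ereal (\<phi> x\<^sub>0) = 0 \<and>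
          (\<forall>\<^sub>F x in nhds x\<^sub>0. \<psi> x - ereal (\<phi> x) \<ge> 0) \<longrightarrow>
        jet2 \<phi> x\<^sub>0 \<notin> closure U \<or> F (jet2 \<phi> x\<^sub>0) \<le> 1)"

end

theory Submission
  imports Defs
begin

text \<open>Let \<open>e = - \<nu>\<close> and \<open>t = (x - x\<^sub>h) \<bullet> e\<close>. On the thin region \<open>{0 \<le> t \<le> 1 / A, h \<ge> 0}\<close> with
  \<open>h = t + A t\<^sup>2 / 2 - b |x - x\<^sub>h|\<^sup>2 / 2\<close>, which touches \<open>\<partial>\<Omega>\<close> only at \<open>x\<^sub>h\<close> when \<open>b\<close> is large, one
  shows \<open>\<psi>\<^sub>2 - \<psi>\<^sub>1 \<ge> \<epsilon> h\<close>. Otherwise the difference \<open>\<psi>\<^sub>2 - \<psi>\<^sub>1 - \<epsilon> h\<close> has a negative interior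
  minimum. Say \<open>\<psi>\<^sub>1\<close> is \<open>C\<^bsup>1,1\<^esup>\<close>. Doubling the variables and Jensen's lemma give a set of positive
  measure of almost-minimum points; by Rademacher's theorem \<open>\<nabla>\<psi>\<^sub>1\<close> is differentiable at one of them.
  There a quadratic touches \<open>\<psi>\<^sub>1\<close> from above, and a quadratic with nearly the same second-order
  data plus \<open>\<epsilon>\<close> times those of \<open>h\<close> touches \<open>\<psi>\<^sub>2\<close> from below at a nearby point. For large \<open>A\<close>
  strict ellipticity makes \<open>F > 1\<close> at the second jet, a contradiction. Since all Hessians are bounded by
  the \<open>C\<^bsup>1,1\<^esup>\<close> norm, continuity of \<open>F\<close> in \<open>x\<close> is enough to compare the two points.\<close>

section \<open>Lipschitz functions of one real variable\<close>

text \<open>The order of the constants is delicate. \<open>A\<close> has to be large compared with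
  the ellipticity and Lipschitz constants of \<open>F\<close>, which belong to a compact set of
  jets, so this set must not depend on \<open>A\<close>. Therefore \<open>\<epsilon>\<close> is
  chosen after \<open>A\<close> with \<open>\<epsilon> * (A + b) < 1\<close>: adding
  \<open>\<epsilon>\<close> times the barrier raises the Lipschitz constant of the gradient by at
  most 1, while \<open>A * t \<le> 1\<close> on the thin region keeps the gradient of the barrier
  bounded. \<open>\<eta>\<close> is chosen last. The function that is not C^{1,1} is merely
  semicontinuous and has no second-order expansion. In the doubled functional it depends on the
  second variable alone, so the functional is semiconcave in the first variable and Jensen's lemma
  is applied in that variable only; Rademacher's theorem for the gradient takes the place of
  Alexandrov's theorem. A change of sign exchanges the roles of \<open>\<psi>\<^sub>1\<close> and
  \<open>\<psi>\<^sub>2\<close> in the minimisation, but not in the equation, so the final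
  contradiction is derived separately in the two cases.\<close>

text \<open>Intervals on which \<open>\<phi>\<close> has slope at most \<open>a\<close> cover
  \<open>E\<close> finely, so Vitali's theorem selects countably many disjoint ones inside an open
  \<open>T\<close> barely larger than \<open>E\<close>. Their images are disjoint since
  \<open>\<phi>\<close> is increasing, with total length at most \<open>a\<close> times the measure
  of \<open>T\<close>; the uncovered null set stays null under a Lipschitz map.\<close>

lemma emeasure_image_le_slope:
  fixes \<phi> :: "real \<Rightarrow> real"
  assumes mono: "strict_mono \<phi>" and lip: "L-lipschitz_on UNIV \<phi>"
    and E: "E \<in> sets lebesgue" and a: "0 \<le> a"
    and slope: "\<And>x d. x \<in> E \<Longrightarrow> 0 < d \<Longrightarrow>
      \<exists>c e. c < e \<and> x \<in> {c..e} \<and> e - c < d \<and> \<phi> e - \<phi> c \<le> a * (e - c)"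
  shows "emeasure lebesgue (\<phi> ` E) \<le> ennreal a * emeasure lebesgue E"
proof (rule ennreal_le_epsilon)
  fix \<epsilon> :: real
  assume "0 < \<epsilon>"
  \<comment> \<open>Dividing by \<open>a + 1\<close> rather than by \<open>a\<close> also covers
    \<open>a = 0\<close>.\<close>
  define \<delta> where "\<delta> = \<epsilon> / (a + 1)"
  have \<delta>: "0 < \<delta>" "a * \<delta> \<le> \<epsilon>"
    using \<open>0 < \<epsilon>\<close> a by (auto simp: \<delta>_def field_simps)
  obtain T where T: "open T" "E \<subseteq> T" "T - E \<in> lmeasurable" "emeasure lebesgue (T - E) < ennreal \<delta>"
    using sets_lebesgue_outer_open[OF E \<delta>(1)] by blast
  define K where "K = {(c, e). c < e \<and> {c..e} \<subseteq> T \<and> \<phi> e - \<phi> c \<le> a * (e - c)}"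
  define cen where "cen i = (fst i + snd i) / 2" for i :: "real \<times> real"
  define rad where "rad i = (snd i - fst i) / 2" for i :: "real \<times> real"
  have cb: "cball (cen i) (rad i) = {fst i..snd i}" for i
    by (simp add: cball_eq_atLeastAtMost cen_def rad_def field_simps)
  obtain C where C: "countable C" "C \<subseteq> K"
     "pairwise (\<lambda>i j. disjnt (cball (cen i) (rad i)) (cball (cen j) (rad j))) C"
     "negligible (E - (\<Union>i\<in>C. cball (cen i) (rad i)))"
  proof (rule Vitali_covering_theorem_cballs[of K rad E cen])
    show "0 < rad i" if "i \<in> K" for i
      using that by (auto simp: K_def rad_def)
    fix x d :: real
    assume "x \<in> E" "0 < d"
    then obtain r where r: "r > 0" "ball x r \<subseteq> T"
      using T by (meson open_contains_ball subsetD)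
    obtain c e where ce: "c < e" "x \<in> {c..e}" "e - c < min d r" "\<phi> e - \<phi> c \<le> a * (e - c)"
      using slope[OF \<open>x \<in> E\<close>, of "min d r"] r \<open>0 < d\<close> by auto
    have "{c..e} \<subseteq> ball x r"
      using ce by (auto simp: dist_real_def)
    then show "\<exists>i. i \<in> K \<and> x \<in> cball (cen i) (rad i) \<and> rad i < d"
      unfolding cb using ce r by (intro exI[of _ "(c, e)"]) (auto simp: K_def rad_def)
  qed
  define N where "N = E - (\<Union>i\<in>C. {fst i..snd i})"
  have "negligible N"
    using C(4) by (simp add: N_def cb)
  then have negN: "negligible (\<phi> ` N)"
    using lipschitz_onD[OF lip]
    by (intro negligible_locally_Lipschitz_image)
       (auto intro!: exI[of _ UNIV] exI[of _ L] simp: dist_norm)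
  have disj: "disjnt {fst i..snd i} {fst j..snd j}" if "i \<in> C" "j \<in> C" "i \<noteq> j" for i j
    using C(3) that by (auto simp: cb pairwise_def)
  have sep: "snd i < fst j \<or> snd j < fst i" if "i \<in> C" "j \<in> C" "i \<noteq> j" for i j
  proof (rule ccontr)
    assume "\<not> ?thesis"
    moreover have "fst i < snd i" "fst j < snd j"
      using that C(2) by (auto simp: K_def)
    ultimately have "max (fst i) (fst j) \<in> {fst i..snd i} \<inter> {fst j..snd j}"
      by auto
    then show False
      using disj[OF that] by (auto simp: disjnt_def)
  qed
  then have disj\<phi>: "disjoint_family_on (\<lambda>i. {\<phi> (fst i)..\<phi> (snd i)}) C"
    unfolding disjoint_family_on_def
  proof (intro ballI impI)
    fix i j
    assume "i \<in> C" "j \<in> C" "i \<noteq> j"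
    then have "\<phi> (snd i) < \<phi> (fst j) \<or> \<phi> (snd j) < \<phi> (fst i)"
      using sep strict_monoD[OF mono] by blast
    then show "{\<phi> (fst i)..\<phi> (snd i)} \<inter> {\<phi> (fst j)..\<phi> (snd j)} = {}"
      by auto
  qed
  have "\<phi> ` E \<subseteq> \<phi> ` N \<union> (\<Union>i\<in>C. {\<phi> (fst i)..\<phi> (snd i)})"
    using strict_mono_less_eq[OF mono] by (auto simp: N_def)
  then have "emeasure lebesgue (\<phi> ` E)
      \<le> emeasure lebesgue (\<phi> ` N \<union> (\<Union>i\<in>C. {\<phi> (fst i)..\<phi> (snd i)}))"
    using negN C(1) by (intro emeasure_mono sets.Un sets.countable_UN'')
      (auto simp: negligible_iff_null_sets)
  also have "\<dots> \<le> emeasure lebesgue (\<phi> ` N) + emeasure lebesgue (\<Union>i\<in>C. {\<phi> (fst i)..\<phi> (snd i)})"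
    using negN C(1) by (intro emeasure_subadditive sets.countable_UN'') (auto simp: negligible_iff_null_sets)
  also have "emeasure lebesgue (\<phi> ` N) = 0"
    using negN by (simp add: negligible_iff_null_sets null_sets_def)
  also have "emeasure lebesgue (\<Union>i\<in>C. {\<phi> (fst i)..\<phi> (snd i)})
      = (\<integral>\<^sup>+i. emeasure lebesgue {\<phi> (fst i)..\<phi> (snd i)} \<partial>count_space C)"
    using C(1) disj\<phi> by (intro emeasure_UN_countable) auto
  also have "\<dots> \<le> (\<integral>\<^sup>+i. ennreal a * emeasure lebesgue {fst i..snd i} \<partial>count_space C)"
  proof (rule nn_integral_mono)
    fix i
    assume "i \<in> space (count_space C)"
    then have i: "fst i < snd i" "\<phi> (snd i) - \<phi> (fst i) \<le> a * (snd i - fst i)"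
      using C(2) by (auto simp: K_def)
    then show "emeasure lebesgue {\<phi> (fst i)..\<phi> (snd i)} \<le> ennreal a * emeasure lebesgue {fst i..snd i}"
      using strict_monoD[OF mono i(1)] a
      by (auto simp: ennreal_mult[symmetric] intro!: ennreal_leI)
  qed
  also have "\<dots> = ennreal a * (\<integral>\<^sup>+i. emeasure lebesgue {fst i..snd i} \<partial>count_space C)"
    by (intro nn_integral_cmult) auto
  also have "(\<integral>\<^sup>+i. emeasure lebesgue {fst i..snd i} \<partial>count_space C)
      = emeasure lebesgue (\<Union>i\<in>C. {fst i..snd i})"
    using C(1) disj by (intro emeasure_UN_countable[symmetric])
      (auto simp: disjoint_family_on_def disjnt_def)
  also have "\<dots> \<le> emeasure lebesgue T"
    using C(2) T(1) by (intro emeasure_mono) (auto simp: K_def subset_iff split: prod.splits)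
  also have "emeasure lebesgue T = emeasure lebesgue (E \<union> (T - E))"
    using T(2) by (intro arg_cong[where f = "emeasure lebesgue"]) auto
  also have "\<dots> = emeasure lebesgue E + emeasure lebesgue (T - E)"
    using E T(3) by (intro plus_emeasure[symmetric]) auto
  also have "ennreal a * \<dots> \<le> ennreal a * (emeasure lebesgue E + ennreal \<delta>)"
    using T(4) by (intro mult_left_mono add_left_mono) auto
  also have "\<dots> = ennreal a * emeasure lebesgue E + ennreal (a * \<delta>)"
    using a \<delta> by (simp add: distrib_left ennreal_mult)
  also have "\<dots> \<le> ennreal a * emeasure lebesgue E + ennreal \<epsilon>"
    using \<delta> by (intro add_left_mono ennreal_leI)
  finally show "emeasure lebesgue (\<phi> ` E) \<le> ennreal a * emeasure lebesgue E + ennreal \<epsilon>"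
    by (simp add: mult_left_mono)
qed

text \<open>Difference quotients for arbitrarily short steps of either sign fall below
  \<open>a\<close> and also exceed \<open>b\<close>. Bounding the steps by
  \<open>1 / (n + 1)\<close> makes this a countable intersection of open sets when \<open>f\<close>
  is continuous.\<close>

definition slope_gap :: "('a::real_normed_vector \<Rightarrow> real) \<Rightarrow> 'a \<Rightarrow> real \<Rightarrow> real \<Rightarrow> 'a set" where
  "slope_gap f v a b = {x. \<forall>n. (\<exists>t. 0 < \<bar>t\<bar> \<and> \<bar>t\<bar> < inverse (real (Suc n)) \<and> (f (x + t *\<^sub>R v) - f x) / t < a) \<and>
       (\<exists>t. 0 < \<bar>t\<bar> \<and> \<bar>t\<bar> < inverse (real (Suc n)) \<and> b < (f (x + t *\<^sub>R v) - f x) / t)}"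

lemma slope_gapD:
  assumes "x \<in> slope_gap f v a b" "0 < d"
  shows "\<exists>t. 0 < \<bar>t\<bar> \<and> \<bar>t\<bar> < d \<and> (f (x + t *\<^sub>R v) - f x) / t < a"
    "\<exists>t. 0 < \<bar>t\<bar> \<and> \<bar>t\<bar> < d \<and> b < (f (x + t *\<^sub>R v) - f x) / t"
proof -
  obtain n where "inverse (real (Suc n)) < d"
    using reals_Archimedean \<open>0 < d\<close> by blast
  then show "\<exists>t. 0 < \<bar>t\<bar> \<and> \<bar>t\<bar> < d \<and> (f (x + t *\<^sub>R v) - f x) / t < a"
    "\<exists>t. 0 < \<bar>t\<bar> \<and> \<bar>t\<bar> < d \<and> b < (f (x + t *\<^sub>R v) - f x) / t"
    using assms(1) unfolding slope_gap_def by (blast intro: less_trans)+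
qed

lemma borel_slope_gap:
  fixes f :: "'a::euclidean_space \<Rightarrow> real"
  assumes "continuous_on UNIV f"
  shows "slope_gap f v a b \<in> sets borel"
proof -
  have c: "continuous_on UNIV (\<lambda>x. (f (x + t *\<^sub>R v) - f x) / t)" for t
    using continuous_on_compose2[OF assms, of UNIV "\<lambda>x. x + t *\<^sub>R v"] assms
    by (cases "t = 0") (simp_all add: continuous_intros)
  define A where "A n = (\<Union>t\<in>{t. 0 < \<bar>t\<bar> \<and> \<bar>t\<bar> < inverse (real (Suc n))}. {x. (f (x + t *\<^sub>R v) - f x) / t < a})" for n
  define B where "B n = (\<Union>t\<in>{t. 0 < \<bar>t\<bar> \<and> \<bar>t\<bar> < inverse (real (Suc n))}. {x. b < (f (x + t *\<^sub>R v) - f x) / t})" for n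
  have "open (A n)" "open (B n)" for n
    unfolding A_def B_def by (intro open_UN ballI open_Collect_less c continuous_on_const)+
  moreover have "slope_gap f v a b = (\<Inter>n. A n \<inter> B n)"
    unfolding A_def B_def slope_gap_def by blast
  ultimately show ?thesis
    by (auto intro!: sets.countable_INT)
qed

lemma lipschitz_slope_le:
  fixes f :: "'a::real_normed_vector \<Rightarrow> real"
  assumes "L-lipschitz_on UNIV f" "t \<noteq> 0"
  shows "\<bar>(f (x + t *\<^sub>R v) - f x) / t\<bar> \<le> L * norm v"
  using lipschitz_onD[OF assms(1), of "x + t *\<^sub>R v" x] assms(2)
  by (simp add: dist_norm field_simps)

text \<open>If the difference quotient does not converge, then it oscillates across some rational
  interval.\<close>

lemma differentiable_along_of_slope_gap:
  fixes f :: "'a::euclidean_space \<Rightarrow> real"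
  assumes lip: "L-lipschitz_on UNIV f"
    and gap: "\<And>a b. a \<in> \<rat> \<Longrightarrow> b \<in> \<rat> \<Longrightarrow> a < b \<Longrightarrow> x \<notin> slope_gap f v a b"
  shows "\<exists>d. ((\<lambda>t. (f (x + t *\<^sub>R v) - f x) / t) \<longlongrightarrow> d) (at 0)"
proof -
  define q where "q t = (f (x + t *\<^sub>R v) - f x) / t" for t
  \<comment> \<open>The limit will be \<open>Sup A\<close>, the lower limit of the
    quotients.\<close>
  define A where "A = {a. \<forall>\<^sub>F t in at 0. a \<le> q t}"
  have bound: "\<bar>q t\<bar> \<le> L * norm v" if "t \<noteq> 0" for t
    using lipschitz_slope_le[OF lip that] by (simp add: q_def)
  have ev: "(\<forall>\<^sub>F t in at 0. P t)" if "0 < d" "\<And>t. 0 < \<bar>t\<bar> \<Longrightarrow> \<bar>t\<bar> < d \<Longrightarrow> P t" for P and d :: real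
    using that by (auto simp: eventually_at dist_real_def)
  have "- (L * norm v) \<in> A"
    unfolding A_def mem_Collect_eq using bound by (intro ev[of 1]) (fastforce simp: abs_le_iff)+
  have "a \<le> L * norm v" if "a \<in> A" for a
  proof -
    have "\<forall>\<^sub>F t in at 0. a \<le> q t \<and> t \<noteq> 0"
      using that eventually_neq_at_within[of 0 0 UNIV] unfolding A_def by (auto intro: eventually_conj)
    then obtain t where "a \<le> q t" "t \<noteq> 0"
      using eventually_happens by (metis (mono_tags, lifting) trivial_limit_at)
    then show ?thesis
      using bound[of t] by auto
  qed
  then have bdd: "bdd_above A"
    by (auto simp: bdd_above_def)
  \<comment> \<open>The rationals \<open>a'\<close> and \<open>b'\<close> are inserted because gaps
    are excluded only for rational end points.\<close>
  have alt: "(\<forall>\<^sub>F t in at 0. a \<le> q t) \<or> (\<forall>\<^sub>F t in at 0. q t \<le> b)" if "a < b" for a b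
  proof -
    obtain a' where a': "a' \<in> \<rat>" "a < a'" "a' < b"
      using Rats_dense_in_real[OF \<open>a < b\<close>] by blast
    obtain b' where b': "b' \<in> \<rat>" "a' < b'" "b' < b"
      using Rats_dense_in_real[OF \<open>a' < b\<close>] by blast
    obtain n where "(\<forall>t. 0 < \<bar>t\<bar> \<and> \<bar>t\<bar> < inverse (real (Suc n)) \<longrightarrow> a' \<le> q t) \<or>
       (\<forall>t. 0 < \<bar>t\<bar> \<and> \<bar>t\<bar> < inverse (real (Suc n)) \<longrightarrow> q t \<le> b')"
      using gap[OF a'(1) b'(1,2)] unfolding slope_gap_def q_def by (auto simp: not_less) (meson not_le)+
    then show ?thesis
    proof
      assume *: "\<forall>t. 0 < \<bar>t\<bar> \<and> \<bar>t\<bar> < inverse (real (Suc n)) \<longrightarrow> a' \<le> q t"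
      have "\<forall>\<^sub>F t in at 0. a \<le> q t"
        by (rule ev[of "inverse (real (Suc n))"]) (use * a' in force)+
      then show ?thesis ..
    next
      assume *: "\<forall>t. 0 < \<bar>t\<bar> \<and> \<bar>t\<bar> < inverse (real (Suc n)) \<longrightarrow> q t \<le> b'"
      have "\<forall>\<^sub>F t in at 0. q t \<le> b"
        by (rule ev[of "inverse (real (Suc n))"]) (use * b' in force)+
      then show ?thesis ..
    qed
  qed
  have "(q \<longlongrightarrow> Sup A) (at 0)"
  proof (rule order_tendstoI)
    fix y
    assume "y < Sup A"
    then obtain a where "a \<in> A" "y < a"
      using less_cSup_iff[OF _ bdd] \<open>- (L * norm v) \<in> A\<close> by blast
    then show "\<forall>\<^sub>F t in at 0. y < q t"
      by (auto simp: A_def elim: eventually_mono)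
  next
    fix y
    assume "Sup A < y"
    then obtain a b where ab: "Sup A < a" "a < b" "b < y"
      by (meson dense)
    then have "a \<notin> A"
      using cSup_upper[OF _ bdd] by fastforce
    then have "\<forall>\<^sub>F t in at 0. q t \<le> b"
      using alt[OF ab(2)] by (auto simp: A_def)
    then show "\<forall>\<^sub>F t in at 0. q t < y"
      by eventually_elim (use ab in auto)
  qed
  then show ?thesis
    unfolding q_def by blast
qed

text \<open>The covering argument needs intervals, while oscillation is stated with signed steps. A
  step of either sign becomes an interval with \<open>x\<close> at one end, since the quotient is
  unchanged when the end points are swapped.\<close>

lemma slope_interval:
  fixes \<phi> :: "real \<Rightarrow> real"
  assumes "0 < \<bar>t\<bar>" "\<bar>t\<bar> < d" "P ((\<phi> (x + t) - \<phi> x) / t)"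
  obtains c e where "c < e" "x \<in> {c..e}" "e - c < d" "x = c \<or> x = e" "P ((\<phi> e - \<phi> c) / (e - c))"
proof (cases "t > 0")
  case True
  then show ?thesis
    using assms that[of x "x + t"] by auto
next
  case False
  have "(\<phi> x - \<phi> (x + t)) / (x - (x + t)) = (\<phi> (x + t) - \<phi> x) / t"
    using nonzero_minus_divide_divide[of t "\<phi> (x + t) - \<phi> x"] assms(1) by auto
  then have "P ((\<phi> x - \<phi> (x + t)) / (x - (x + t)))"
    using assms(3) by simp
  moreover have "x + t < x" "x - (x + t) < d" "x \<in> {x + t..x}"
    using False assms(1,2) by auto
  ultimately show ?thesis
    using that[of "x + t" x] by blast
qed

text \<open>Where the slopes of \<open>\<phi>\<close> oscillate between values below \<open>a\<close> and above \<open>b\<close>, the map \<open>\<phi>\<close>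
  shrinks measure by the factor \<open>a\<close>, while its inverse shrinks it by \<open>1 / b\<close>.\<close>

lemma negligible_slope_gap_expanding:
  fixes \<phi> :: "real \<Rightarrow> real"
  assumes lip: "L-lipschitz_on UNIV \<phi>" and exp: "\<And>x y. x \<le> y \<Longrightarrow> y - x \<le> \<phi> y - \<phi> x"
    and "0 \<le> a" "a < b"
  shows "negligible (slope_gap \<phi> 1 a b)"
proof -
  have sm: "strict_mono \<phi>"
    using exp by (intro strict_monoI) (smt (verit))
  have cont: "continuous_on UNIV \<phi>"
    using lip lipschitz_on_continuous_on by blast
  have surj: "surj \<phi>"
  proof -
    have "y \<in> range \<phi>" for y
    proof -
      define r where "r = \<bar>y - \<phi> 0\<bar>"
      have "\<phi> (- r) \<le> y" "y \<le> \<phi> r"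
        using exp[of "-r" 0] exp[of 0 r] by (auto simp: r_def)
      then show ?thesis
        using IVT'[of \<phi> "-r" y r] continuous_on_subset[OF cont] by (auto simp: r_def)
    qed
    then show ?thesis by blast
  qed
  \<comment> \<open>\<open>\<phi>\<close> expands distances, so its inverse lives on the whole line
    and has Lipschitz constant 1; the covering estimate thus applies to both maps.\<close>
  define \<psi> where "\<psi> = inv \<phi>"
  have \<phi>\<psi>: "\<phi> (\<psi> y) = y" and \<psi>\<phi>: "\<psi> (\<phi> x) = x" for x y
    using surj strict_mono_imp_inj_on[OF sm] by (auto simp: \<psi>_def surj_f_inv_f)
  have \<psi>sm: "strict_mono \<psi>"
    by (intro strict_monoI) (metis \<phi>\<psi> sm strict_mono_less)
  have "y - x \<ge> \<psi> y - \<psi> x" if "x \<le> y" for x y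
    using exp[of "\<psi> x" "\<psi> y"] that strict_mono_less_eq[OF \<psi>sm] by (simp add: \<phi>\<psi>)
  then have \<psi>lip: "1-lipschitz_on UNIV \<psi>"
    using strict_mono_less_eq[OF \<psi>sm]
    by (intro lipschitz_onI) (auto simp: dist_real_def, smt (verit))
  \<comment> \<open>Bounded pieces have finite measure, which permits cancelling the measure of
    \<open>E\<close> at the end.\<close>
  have "negligible (slope_gap \<phi> 1 a b \<inter> cbox u v)" for u v
  proof -
    define E where "E = slope_gap \<phi> 1 a b \<inter> cbox u v"
    have Eb: "E \<in> sets borel"
      using borel_slope_gap[OF cont] by (auto simp: E_def)
    have Em: "E \<in> sets lebesgue"
      using Eb sets_completionI_sets[of E lborel] by simp
    have "emeasure lebesgue E \<le> emeasure lebesgue (cbox u v)"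
      by (intro emeasure_mono) (auto simp: E_def)
    also have "\<dots> < \<infinity>"
      using fmeasurableD2[OF lmeasurable_cbox[of u v]] by (simp add: less_top)
    finally have Efin: "emeasure lebesgue E < \<infinity>" .
    have img: "\<phi> ` E = \<psi> -` E"
      using \<phi>\<psi> \<psi>\<phi> by (auto simp: image_iff) metis
    have "\<psi> \<in> borel_measurable borel"
      using \<psi>lip lipschitz_on_continuous_on borel_measurable_continuous_onI by blast
    then have "\<phi> ` E \<in> sets borel"
      unfolding img using Eb measurable_sets[of \<psi> borel borel E] by auto
    then have \<phi>Em: "\<phi> ` E \<in> sets lebesgue"
      using sets_completionI_sets[of "\<phi> ` E" lborel] by simp
    have 1: "emeasure lebesgue (\<phi> ` E) \<le> ennreal a * emeasure lebesgue E"
    proof (rule emeasure_image_le_slope[OF sm lip Em \<open>0 \<le> a\<close>])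
      fix x d :: real
      assume "x \<in> E" "0 < d"
      then obtain t where t: "0 < \<bar>t\<bar>" "\<bar>t\<bar> < d" "(\<phi> (x + t) - \<phi> x) / t < a"
        using slope_gapD(1)[of x \<phi> 1 a b d] by (auto simp: E_def)
      show "\<exists>c e. c < e \<and> x \<in> {c..e} \<and> e - c < d \<and> \<phi> e - \<phi> c \<le> a * (e - c)"
        using slope_interval[of t d "\<lambda>s. s < a", OF t]
        by (metis diff_gt_0_iff_gt less_imp_le mult.commute pos_divide_less_eq)
    qed
    have 2: "emeasure lebesgue (\<psi> ` \<phi> ` E) \<le> ennreal (1 / b) * emeasure lebesgue (\<phi> ` E)"
    proof (rule emeasure_image_le_slope[OF \<psi>sm \<psi>lip \<phi>Em])
      show "0 \<le> 1 / b"
        using assms by simp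
      fix y d :: real
      assume "y \<in> \<phi> ` E" "0 < d"
      then obtain x where x: "x \<in> E" "y = \<phi> x" by blast
      have L0: "L \<ge> 0"
        using lip lipschitz_on_nonneg by blast
      \<comment> \<open>\<open>\<phi>\<close> stretches lengths by at most \<open>L\<close>, so an
        interval shorter than \<open>d / (L + 1)\<close> has an image shorter than
        \<open>d\<close>.\<close>
      obtain t where t: "0 < \<bar>t\<bar>" "\<bar>t\<bar> < d / (L + 1)" "(\<phi> (x + t) - \<phi> x) / t > b"
        using slope_gapD(2)[of x \<phi> 1 a b "d / (L + 1)"] x \<open>0 < d\<close> L0 by (auto simp: E_def)
      obtain c e where ce: "c < e" "x \<in> {c..e}" "e - c < d / (L + 1)" "b < (\<phi> e - \<phi> c) / (e - c)"
        using slope_interval[of t "d / (L + 1)" "\<lambda>s. b < s", OF t] by metis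
      have "\<phi> c < \<phi> e"
        using sm ce(1) strict_monoD by blast
      moreover have "\<phi> e - \<phi> c < d"
      proof -
        have "\<phi> e - \<phi> c \<le> L * (e - c)"
          using lipschitz_onD[OF lip, of e c] ce(1) \<open>\<phi> c < \<phi> e\<close> by (simp add: dist_real_def)
        also have "\<dots> \<le> (L + 1) * (e - c)"
          using ce(1) by (simp add: mult_right_mono)
        also have "\<dots> < d"
          using ce(3) L0 by (simp add: field_simps)
        finally show ?thesis .
      qed
      moreover have "\<psi> (\<phi> e) - \<psi> (\<phi> c) \<le> 1 / b * (\<phi> e - \<phi> c)"
        using ce(1,4) assms(3,4) by (simp add: \<psi>\<phi> field_simps)
      moreover have "y \<in> {\<phi> c..\<phi> e}"
        using ce(2) x strict_mono_less_eq[OF sm] by auto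
      ultimately show "\<exists>c e. c < e \<and> y \<in> {c..e} \<and> e - c < d \<and> \<psi> e - \<psi> c \<le> 1 / b * (e - c)"
        by blast
    qed
    \<comment> \<open>Going to the image and back returns to \<open>E\<close> with the factor
      \<open>a / b < 1\<close>.\<close>
    have "emeasure lebesgue E \<le> ennreal (1 / b) * (ennreal a * emeasure lebesgue E)"
      using 2 mult_left_mono[OF 1, of "ennreal (1 / b)"] by (simp add: image_image \<psi>\<phi>)
    also have "\<dots> = ennreal (a / b) * emeasure lebesgue E"
      using assms by (simp add: mult.assoc[symmetric] ennreal_mult[symmetric])
    finally have "emeasure lebesgue E \<le> ennreal (a / b) * emeasure lebesgue E" .
    moreover obtain r where r: "emeasure lebesgue E = ennreal r" "r \<ge> 0"
      using Efin by (metis ennreal_cases infinity_ennreal_def order_less_irrefl)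
    ultimately have "r \<le> a / b * r"
      using assms by (simp add: ennreal_mult[symmetric])
    then have "r \<le> 0"
      using assms r(2) by (auto simp: field_simps mult_le_cancel_right)
    then show ?thesis
      using r negligible_iff_emeasure0[OF Em] unfolding E_def[symmetric] by simp
  qed
  then show ?thesis
    using negligible_on_intervals by blast
qed

section \<open>Rademacher's theorem\<close>

text \<open>Adding \<open>(L + 1) * x\<close> raises every slope by \<open>L + 1\<close>, hence to
  at least 1, and shifts the gap by the same amount. If the shifted lower end is negative there is
  no gap at all, since slopes are at least \<open>- L\<close>.\<close>

lemma negligible_slope_gap_real:
  fixes \<phi> :: "real \<Rightarrow> real"
  assumes lip: "L-lipschitz_on UNIV \<phi>" and "a < b"
  shows "negligible (slope_gap \<phi> 1 a b)"
proof (cases "a + (L + 1) < 0")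
  case True
  have "x \<notin> slope_gap \<phi> 1 a b" for x
  proof
    assume "x \<in> slope_gap \<phi> 1 a b"
    then obtain t where "t \<noteq> 0" "(\<phi> (x + t *\<^sub>R 1) - \<phi> x) / t < a"
      using slope_gapD(1)[of x \<phi> 1 a b 1] by auto
    moreover from this have "\<bar>(\<phi> (x + t *\<^sub>R 1) - \<phi> x) / t\<bar> \<le> L"
      using lipschitz_slope_le[OF lip, of t x 1] by simp
    ultimately show False
      using True by linarith
  qed
  then have "slope_gap \<phi> 1 a b = {}" by blast
  then show ?thesis by simp
next
  case False
  define \<phi>' where "\<phi>' x = \<phi> x + (L + 1) * x" for x
  have L0: "0 \<le> L"
    using lip lipschitz_on_nonneg by blast
  have q: "(\<phi>' (x + t) - \<phi>' x) / t = (\<phi> (x + t) - \<phi> x) / t + (L + 1)" if "0 < \<bar>t\<bar>" for x t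
    using that by (simp add: \<phi>'_def field_simps)
  have "slope_gap \<phi> 1 a b = slope_gap \<phi>' 1 (a + (L + 1)) (b + (L + 1))"
    unfolding slope_gap_def by (simp add: q cong: conj_cong)
  moreover have "negligible (slope_gap \<phi>' 1 (a + (L + 1)) (b + (L + 1)))"
  proof (rule negligible_slope_gap_expanding)
    show "(L + (L + 1))-lipschitz_on UNIV \<phi>'"
    proof (rule lipschitz_onI)
      fix x y :: real
      have "\<phi>' x - \<phi>' y = (\<phi> x - \<phi> y) + (L + 1) * (x - y)"
        by (simp add: \<phi>'_def algebra_simps)
      also have "\<bar>\<dots>\<bar> \<le> \<bar>\<phi> x - \<phi> y\<bar> + \<bar>(L + 1) * (x - y)\<bar>"
        by (rule abs_triangle_ineq)
      also have "\<dots> \<le> L * \<bar>x - y\<bar> + (L + 1) * \<bar>x - y\<bar>"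
        using lipschitz_onD[OF lip, of x y] L0 by (simp add: dist_real_def abs_mult)
      finally show "dist (\<phi>' x) (\<phi>' y) \<le> (L + (L + 1)) * dist x y"
        by (simp add: dist_real_def algebra_simps)
    qed (use L0 in simp)
    fix x y :: real
    assume "x \<le> y"
    then have "\<bar>\<phi> y - \<phi> x\<bar> \<le> L * (y - x)"
      using lipschitz_onD[OF lip, of y x] by (simp add: dist_real_def)
    then show "y - x \<le> \<phi>' y - \<phi>' x"
      by (simp add: \<phi>'_def algebra_simps)
  qed (use assms(2) False in auto)
  ultimately show ?thesis by simp
qed

lemma negligible_iff_emeasure_lborel:
  assumes "S \<in> sets borel"
  shows "negligible S \<longleftrightarrow> emeasure lborel S = 0"
proof -
  have "S \<in> sets lborel"
    using assms by simp
  then have "S \<in> sets lebesgue" "emeasure lebesgue S = emeasure lborel S"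
    by (auto simp: main_part_sets intro: sets_completionI_sets)
  then show ?thesis
    using negligible_iff_emeasure0 by metis
qed

text \<open>By Fubini, \<open>\<integral> |S| dt = \<integral> |{t. x + t v \<in> S}| dx = 0\<close>.\<close>

lemma negligible_if_negligible_on_lines:
  fixes v :: "'a::euclidean_space"
  assumes S: "S \<in> sets borel" and lines: "\<And>x. negligible {t::real. x + t *\<^sub>R v \<in> S}"
  shows "negligible S"
proof -
  have meas: "(\<lambda>(x, t). indicator S (x + t *\<^sub>R v) :: ennreal) \<in> borel_measurable (lborel \<Otimes>\<^sub>M lborel)"
    using S by measurable
  have 1: "(\<integral>\<^sup>+t. indicator S (x + t *\<^sub>R v) \<partial>lborel) = 0" for x
  proof -
    have b: "{t. x + t *\<^sub>R v \<in> S} \<in> sets borel"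
      using measurable_sets[of "\<lambda>t::real. x + t *\<^sub>R v" borel borel S] S by (simp add: vimage_def)
    have "(\<integral>\<^sup>+t. indicator S (x + t *\<^sub>R v) \<partial>lborel) = (\<integral>\<^sup>+t. indicator {t. x + t *\<^sub>R v \<in> S} t \<partial>lborel)"
      by (intro nn_integral_cong) (auto simp: indicator_def)
    also have "\<dots> = emeasure lborel {t. x + t *\<^sub>R v \<in> S}"
      using b by simp
    also have "\<dots> = 0"
      using lines[of x] b negligible_iff_emeasure_lborel by blast
    finally show ?thesis .
  qed
  have 2: "(\<integral>\<^sup>+x. indicator S (x + t *\<^sub>R v) \<partial>lborel) = emeasure lborel S" for t
  proof -
    have "emeasure lborel S = (\<integral>\<^sup>+x. indicator S x \<partial>distr lborel borel ((+) (t *\<^sub>R v)))"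
      using S by (simp add: lborel_distr_plus)
    also have "\<dots> = (\<integral>\<^sup>+x. indicator S (x + t *\<^sub>R v) \<partial>lborel)"
      using S by (subst nn_integral_distr) (auto simp: add.commute)
    finally show ?thesis by simp
  qed
  \<comment> \<open>The factor \<open>\<infinity>\<close> is the length of the line of shifts
    \<open>t\<close>; the product can vanish only if the measure of \<open>S\<close> does.\<close>
  have "emeasure lborel S * \<infinity> = (\<integral>\<^sup>+(t::real). emeasure lborel S \<partial>lborel)"
    by simp
  also have "\<dots> = (\<integral>\<^sup>+t. (\<integral>\<^sup>+x. indicator S (x + t *\<^sub>R v) \<partial>lborel) \<partial>lborel)"
    by (simp add: 2)
  also have "\<dots> = (\<integral>\<^sup>+x. (\<integral>\<^sup>+t. indicator S (x + t *\<^sub>R v) \<partial>lborel) \<partial>lborel)"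
    by (rule lborel_pair.Fubini'[OF meas])
  also have "\<dots> = 0"
    by (simp add: 1)
  finally have "emeasure lborel S = 0"
    by (auto simp: ennreal_mult_eq_top_iff)
  then show ?thesis
    using S negligible_iff_emeasure_lborel by blast
qed

lemma negligible_slope_gap:
  fixes f :: "'a::euclidean_space \<Rightarrow> real"
  assumes lip: "L-lipschitz_on UNIV f" and "a < b"
  shows "negligible (slope_gap f v a b)"
proof (rule negligible_if_negligible_on_lines)
  show "slope_gap f v a b \<in> sets borel"
    using borel_slope_gap lipschitz_on_continuous_on[OF lip] by blast
  fix x
  have "(L * norm v)-lipschitz_on UNIV (\<lambda>t. f (x + t *\<^sub>R v))"
  proof (rule lipschitz_onI)
    fix s t :: real
    show "dist (f (x + s *\<^sub>R v)) (f (x + t *\<^sub>R v)) \<le> L * norm v * dist s t"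
      using lipschitz_onD[OF lip, of "x + s *\<^sub>R v" "x + t *\<^sub>R v"]
      by (simp add: dist_norm mult_ac flip: scaleR_diff_left)
  qed (use lipschitz_on_nonneg[OF lip] in simp)
  moreover have "{t. x + t *\<^sub>R v \<in> slope_gap f v a b} = slope_gap (\<lambda>t. f (x + t *\<^sub>R v)) 1 a b"
    by (simp add: slope_gap_def scaleR_left_distrib add.assoc)
  ultimately show "negligible {t. x + t *\<^sub>R v \<in> slope_gap f v a b}"
    using negligible_slope_gap_real assms(2) by metis
qed

lemma negligible_not_differentiable_along:
  fixes f :: "'a::euclidean_space \<Rightarrow> real"
  assumes lip: "L-lipschitz_on UNIV f"
  shows "negligible {x. \<nexists>d. ((\<lambda>t. (f (x + t *\<^sub>R v) - f x) / t) \<longlongrightarrow> d) (at 0)}"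
proof (rule negligible_subset)
  let ?Q = "{(a, b). a \<in> \<rat> \<and> b \<in> \<rat> \<and> a < (b::real)}"
  have "countable ?Q"
    by (rule countable_subset[of _ "\<rat> \<times> \<rat>"]) (auto simp: countable_rat)
  then show "negligible (\<Union>(a, b)\<in>?Q. slope_gap f v a b)"
    using negligible_slope_gap[OF lip]
    by (intro negligible_countable_Union countable_image) auto
  show "{x. \<nexists>d. ((\<lambda>t. (f (x + t *\<^sub>R v) - f x) / t) \<longlongrightarrow> d) (at 0)} \<subseteq> (\<Union>(a, b)\<in>?Q. slope_gap f v a b)"
  proof
    fix x
    assume "x \<in> {x. \<nexists>d. ((\<lambda>t. (f (x + t *\<^sub>R v) - f x) / t) \<longlongrightarrow> d) (at 0)}"
    then obtain a b where "a \<in> \<rat>" "b \<in> \<rat>" "a < b" "x \<in> slope_gap f v a b"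
      using differentiable_along_of_slope_gap[OF lip, of x v] by blast
    then show "x \<in> (\<Union>(a, b)\<in>?Q. slope_gap f v a b)"
      by blast
  qed
qed

text \<open>Frechet differentiability tested only on increments from \<open>V\<close>, so that
  \<open>V\<close> can grow by one coordinate direction at a time.\<close>

definition differentiable_along :: "'a::euclidean_space set \<Rightarrow> ('a \<Rightarrow> real) \<Rightarrow> 'a \<Rightarrow> bool" where
  "differentiable_along V f x \<longleftrightarrow>
     (\<exists>w. \<forall>e>0. \<exists>d>0. \<forall>h\<in>V. norm h < d \<longrightarrow> \<bar>f (x + h) - f x - w \<bullet> h\<bar> \<le> e * norm h)"

text \<open>Where the distance to \<open>K\<close> is differentiable along \<open>V\<close>, its derivative at a point of \<open>K\<close>
  vanishes because it is a minimum; so \<open>K\<close> has points at distance \<open>o(|h|)\<close> from \<open>x + h\<close>. This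
  replaces the Lebesgue density theorem.\<close>

lemma infdist_differentiable_along_zero:
  assumes "differentiable_along V (\<lambda>y. infdist y K) x" and "x \<in> K" and V: "subspace V" and "0 < e"
  shows "\<exists>d>0. \<forall>h\<in>V. norm h < d \<longrightarrow> infdist (x + h) K \<le> e * norm h"
proof -
  obtain w where w: "\<And>e. e > 0 \<Longrightarrow> \<exists>d>0. \<forall>h\<in>V. norm h < d \<longrightarrow>
      \<bar>infdist (x + h) K - infdist x K - w \<bullet> h\<bar> \<le> e * norm h"
    using assms(1) unfolding differentiable_along_def by blast
  obtain d where d: "d > 0" "\<And>h. h \<in> V \<Longrightarrow> norm h < d \<Longrightarrow>
      \<bar>infdist (x + h) K - infdist x K - w \<bullet> h\<bar> \<le> e / 2 * norm h"
    using w[of "e / 2"] \<open>0 < e\<close> by auto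
  have "infdist (x + h) K \<le> e * norm h" if h: "h \<in> V" "norm h < d" for h
  proof -
    have "infdist x K = 0"
      using \<open>x \<in> K\<close> by simp
    moreover have "- h \<in> V" "norm (- h) < d"
      using h subspace_neg[OF V] by auto
    ultimately have "\<bar>infdist (x + h) K - w \<bullet> h\<bar> \<le> e / 2 * norm h"
        "\<bar>infdist (x + - h) K + w \<bullet> h\<bar> \<le> e / 2 * norm h"
      using d(2)[OF h] d(2)[of "- h"] by auto
    then have "infdist (x + h) K - w \<bullet> h \<le> e / 2 * norm h" "w \<bullet> h \<le> e / 2 * norm h"
      using infdist_nonneg[of "x + - h" K] by linarith+
    then show ?thesis
      by simp
  qed
  then show ?thesis
    using d(1) by blast
qed

lemma norm_orthogonal_parts:
  fixes h b :: "'a::real_inner"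
  assumes "norm b = 1" "h \<bullet> b = 0"
  shows "norm h \<le> norm (h + t *\<^sub>R b)" "\<bar>t\<bar> \<le> norm (h + t *\<^sub>R b)"
proof -
  have "(norm (h + t *\<^sub>R b))\<^sup>2 = (norm h)\<^sup>2 + t\<^sup>2"
    using assms
    by (simp add: power2_norm_eq_inner inner_add_left inner_add_right inner_commute[of b h] norm_eq_1 power2_eq_square[of t])
  then have "(norm h)\<^sup>2 \<le> (norm (h + t *\<^sub>R b))\<^sup>2" "\<bar>t\<bar>\<^sup>2 \<le> (norm (h + t *\<^sub>R b))\<^sup>2"
    by (metis le_add_same_cancel1 zero_le_power2, metis le_add_same_cancel2 power2_abs zero_le_power2)
  then show "norm h \<le> norm (h + t *\<^sub>R b)" "\<bar>t\<bar> \<le> norm (h + t *\<^sub>R b)"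
    using power2_le_imp_le norm_ge_zero by blast+
qed

text \<open>A derivative along \<open>span B\<close> and one in the new direction \<open>b\<close>
  do not by themselves combine to a linear approximation. \<open>K d \<eta> n\<close> collects the
  points where the increment along \<open>b\<close> is linear with slope \<open>d\<close> up to
  \<open>\<eta>\<close>, uniformly for steps below \<open>1 / (n + 1)\<close>. Its distance function
  is Lipschitz, so the induction hypothesis covers it. Hence, for almost every \<open>x\<close> in
  \<open>K d \<eta> n\<close> and small \<open>h\<close> in \<open>span B\<close>, there is a point
  of \<open>K d \<eta> n\<close> within \<open>\<eta> * norm h\<close> of \<open>x + h\<close>, and
  from there the step along \<open>b\<close> is under control.\<close>

lemma negligible_not_differentiable_along_span:
  fixes f :: "'a::euclidean_space \<Rightarrow> real"
  assumes "finite B" "B \<subseteq> Basis" "L-lipschitz_on UNIV f"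
  shows "negligible {x. \<not> differentiable_along (span B) f x}"
  using assms
proof (induction B arbitrary: f L rule: finite_induct)
  case empty
  have "differentiable_along (span {}) f x" for x
    by (auto simp: differentiable_along_def intro: exI[of _ "1::real"])
  then show ?case by simp
next
  case (insert b B)
  note lip = insert.prems(2)
  have b: "norm b = 1" and B: "B \<subseteq> Basis"
    using insert.prems by auto
  have L0: "0 \<le> L"
    using lip lipschitz_on_nonneg by blast
  have cont: "continuous_on UNIV f"
    using lip lipschitz_on_continuous_on by blast
  define K where "K d \<eta> n = {x. \<forall>t. \<bar>t\<bar> < inverse (real (Suc n)) \<longrightarrow> \<bar>f (x + t *\<^sub>R b) - f x - t * d\<bar> \<le> \<eta> * \<bar>t\<bar>}"
    for d \<eta> n
  have Kcl: "closed (K d \<eta> n)" for d \<eta> n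
  proof -
    have "continuous_on UNIV (\<lambda>x. f (x + t *\<^sub>R b))" for t
      using continuous_on_compose2[OF cont, of UNIV "\<lambda>x. x + t *\<^sub>R b"] by (simp add: continuous_intros)
    then have "closed {x. \<bar>f (x + t *\<^sub>R b) - f x - t * d\<bar> \<le> \<eta> * \<bar>t\<bar>}" for t
      by (intro closed_Collect_le continuous_intros cont)
    then have "closed (\<Inter>t\<in>{t. \<bar>t\<bar> < inverse (real (Suc n))}. {x. \<bar>f (x + t *\<^sub>R b) - f x - t * d\<bar> \<le> \<eta> * \<bar>t\<bar>})"
      by blast
    moreover have "K d \<eta> n = (\<Inter>t\<in>{t. \<bar>t\<bar> < inverse (real (Suc n))}. {x. \<bar>f (x + t *\<^sub>R b) - f x - t * d\<bar> \<le> \<eta> * \<bar>t\<bar>})"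
      by (auto simp: K_def)
    ultimately show ?thesis by simp
  qed
  define N1 where "N1 = {x. \<nexists>d. ((\<lambda>t. (f (x + t *\<^sub>R b) - f x) / t) \<longlongrightarrow> d) (at 0)}"
  define N2 where "N2 = {x. \<not> differentiable_along (span B) f x}"
  \<comment> \<open>Rational \<open>d\<close> and \<open>\<eta>\<close> keep this union
    countable.\<close>
  define N3 where "N3 = (\<Union>(d, \<eta>, n)\<in>\<rat> \<times> \<rat> \<times> UNIV. {x. \<not> differentiable_along (span B) (\<lambda>y. infdist y (K d \<eta> n)) x})"
  have "negligible N1"
    unfolding N1_def by (rule negligible_not_differentiable_along[OF lip])
  moreover have "negligible N2"
    unfolding N2_def using insert.IH[OF B lip] .
  moreover have "negligible N3"
    unfolding N3_def
  proof (intro negligible_countable_Union countable_image)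
    show "countable (\<rat> \<times> \<rat> \<times> (UNIV :: nat set) :: (real \<times> real \<times> nat) set)"
      by (simp add: countable_rat)
    have "1-lipschitz_on UNIV (\<lambda>y. infdist y (K d \<eta> n))" for d \<eta> n
      by (intro lipschitz_onI) (auto simp: dist_real_def infdist_triangle_abs)
    then show "negligible N" if "N \<in> (\<lambda>(d, \<eta>, n). {x. \<not> differentiable_along (span B) (\<lambda>y. infdist y (K d \<eta> n)) x}) ` (\<rat> \<times> \<rat> \<times> UNIV)" for N
      using that insert.IH[OF B, of 1] by auto
  qed
  ultimately have "negligible (N1 \<union> N2 \<union> N3)"
    by (intro negligible_Un)
  moreover have "differentiable_along (span (insert b B)) f x" if x: "x \<notin> N1 \<union> N2 \<union> N3" for x
  proof -
    obtain d0 where d0: "((\<lambda>t. (f (x + t *\<^sub>R b) - f x) / t) \<longlongrightarrow> d0) (at 0)"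
      using x by (auto simp: N1_def)
    obtain w where w: "\<And>e. e > 0 \<Longrightarrow> \<exists>d>0. \<forall>h\<in>span B. norm h < d \<longrightarrow> \<bar>f (x + h) - f x - w \<bullet> h\<bar> \<le> e * norm h"
      using x unfolding N2_def differentiable_along_def by blast
    define w' where "w' = w + (d0 - w \<bullet> b) *\<^sub>R b"
    have orth: "h \<bullet> b = 0" if "h \<in> span B" for h
    proof -
      have "orthogonal b y" if "y \<in> B" for y
        using insert.hyps insert.prems that inner_not_same_Basis[of b y]
        unfolding orthogonal_def by blast
      then have "orthogonal b h"
        using orthogonal_to_span[OF \<open>h \<in> span B\<close>] by blast
      then show ?thesis
        unfolding orthogonal_def by (metis inner_commute)
    qed
    show ?thesis
      unfolding differentiable_along_def
    proof (intro exI[of _ w'] allI impI)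
      fix e :: real
      assume "0 < e"
      \<comment> \<open>The errors collected below add up to
        \<open>(3 + 2 * L) * \<eta> * norm k\<close>, which \<open>c * \<eta> * norm k\<close>
        dominates.\<close>
      define c where "c = 4 * L + 4"
      have c: "c > 0" using L0 by (simp add: c_def)
      obtain \<eta> where \<eta>: "\<eta> \<in> \<rat>" "0 < \<eta>" "\<eta> < e / c"
        using Rats_dense_in_real[of 0 "e / c"] \<open>0 < e\<close> c by auto
      obtain d where d: "d \<in> \<rat>" "d0 - \<eta> / 2 < d" "d < d0 + \<eta> / 2"
        using Rats_dense_in_real[of "d0 - \<eta> / 2" "d0 + \<eta> / 2"] \<eta> by auto
      have dd: "\<bar>d - d0\<bar> \<le> \<eta> / 2"
        using d(2,3) by linarith
      obtain s where s: "s > 0" "\<And>t. t \<noteq> 0 \<Longrightarrow> \<bar>t\<bar> < s \<Longrightarrow> \<bar>(f (x + t *\<^sub>R b) - f x) / t - d0\<bar> < \<eta> / 2"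
        using tendstoD[OF d0, of "\<eta> / 2"] \<eta>(2) by (auto simp: eventually_at dist_real_def)
      obtain n where n: "inverse (real (Suc n)) < s"
        using reals_Archimedean[OF s(1)] by blast
      have xK: "x \<in> K d \<eta> n"
        unfolding K_def
      proof (intro CollectI allI impI)
        fix t
        assume t: "\<bar>t\<bar> < inverse (real (Suc n))"
        show "\<bar>f (x + t *\<^sub>R b) - f x - t * d\<bar> \<le> \<eta> * \<bar>t\<bar>"
        proof (cases "t = 0")
          case False
          then have "f (x + t *\<^sub>R b) - f x - t * d = ((f (x + t *\<^sub>R b) - f x) / t - d) * t"
            by (simp add: field_simps)
          moreover have "\<bar>(f (x + t *\<^sub>R b) - f x) / t - d\<bar> \<le> \<eta>"
            using s(2)[OF False] t n dd by linarith
          ultimately show ?thesis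
            by (simp add: abs_mult mult_right_mono)
        qed simp
      qed
      have "differentiable_along (span B) (\<lambda>y. infdist y (K d \<eta> n)) x"
        using x \<eta>(1) d(1) by (auto simp: N3_def)
      then obtain r1 where r1: "r1 > 0" "\<And>h. h \<in> span B \<Longrightarrow> norm h < r1 \<Longrightarrow> infdist (x + h) (K d \<eta> n) \<le> \<eta> * norm h"
        using infdist_differentiable_along_zero[OF _ xK subspace_span \<eta>(2)] by metis
      obtain r2 where r2: "r2 > 0" "\<And>h. h \<in> span B \<Longrightarrow> norm h < r2 \<Longrightarrow> \<bar>f (x + h) - f x - w \<bullet> h\<bar> \<le> \<eta> * norm h"
        using w[OF \<eta>(2)] by blast
      define r where "r = min (min r1 r2) (inverse (real (Suc n)))"
      have "\<bar>f (x + k) - f x - w' \<bullet> k\<bar> \<le> e * norm k" if k: "k \<in> span (insert b B)" "norm k < r" for k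
      proof -
        obtain t where "k - t *\<^sub>R b \<in> span B"
          using k(1) span_breakdown_eq by blast
        then obtain h where h: "h \<in> span B" "k = h + t *\<^sub>R b"
          by (metis diff_add_cancel)
        have nk: "norm h \<le> norm k" "\<bar>t\<bar> \<le> norm k"
          using norm_orthogonal_parts[OF b orth[OF h(1)]] h(2) by auto
        obtain z where z: "z \<in> K d \<eta> n" "infdist (x + h) (K d \<eta> n) = dist (x + h) z"
          using infdist_attains_inf[OF Kcl] xK by blast
        have \<eta>k: "\<eta> * norm h \<le> \<eta> * norm k" "\<eta> * \<bar>t\<bar> \<le> \<eta> * norm k"
          using nk \<eta>(2) by (auto intro: mult_left_mono)
        have kr: "norm h < r1" "norm h < r2" "\<bar>t\<bar> < inverse (real (Suc n))"
          using k(2) nk unfolding r_def by linarith+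
        have zn: "norm (x + h - z) \<le> \<eta> * norm k"
          using r1(2)[OF h(1) kr(1)] z(2) \<eta>k(1) unfolding dist_norm by linarith
        have Lz: "L * norm (x + h - z) \<le> L * (\<eta> * norm k)"
          using zn L0 by (rule mult_left_mono)
        have 1: "\<bar>f (x + h) - f x - w \<bullet> h\<bar> \<le> \<eta> * norm k"
          using r2(2)[OF h(1) kr(2)] \<eta>k(1) by linarith
        have "\<bar>f (z + t *\<^sub>R b) - f z - t * d\<bar> \<le> \<eta> * \<bar>t\<bar>"
          using z(1) kr(3) unfolding K_def by blast
        then have 2: "\<bar>f (z + t *\<^sub>R b) - f z - t * d\<bar> \<le> \<eta> * norm k"
          using \<eta>k(2) by linarith
        have 3: "\<bar>f (x + h) - f z\<bar> \<le> L * (\<eta> * norm k)"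
          using lipschitz_onD[OF lip, of "x + h" z] Lz unfolding dist_norm by simp
        have 4: "\<bar>f (x + k) - f (z + t *\<^sub>R b)\<bar> \<le> L * (\<eta> * norm k)"
          using lipschitz_onD[OF lip, of "x + k" "z + t *\<^sub>R b"] Lz
          unfolding dist_norm h(2) by (simp add: algebra_simps)
        have 5: "\<bar>t * d - t * d0\<bar> \<le> \<eta> * norm k"
        proof -
          have "\<bar>t * d - t * d0\<bar> = \<bar>t\<bar> * \<bar>d - d0\<bar>"
            by (simp add: abs_mult flip: right_diff_distrib)
          also have "\<dots> \<le> norm k * \<eta>"
            using nk(2) dd \<eta>(2) by (intro mult_mono) auto
          finally show ?thesis by (simp add: mult.commute)
        qed
        have wk: "w' \<bullet> k = w \<bullet> h + t * d0"
          using orth[OF h(1)] b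
          by (simp add: w'_def h(2) inner_add_left inner_add_right inner_commute norm_eq_1 algebra_simps)
        \<comment> \<open>The chain leads from \<open>x + k\<close> to
          \<open>z + t *\<^sub>R b\<close>, \<open>z\<close>, \<open>x + h\<close> and
          \<open>x\<close>; the Lipschitz bound pays for the jump to \<open>z\<close> and for the
          jump back.\<close>
        have "\<bar>f (x + k) - f x - w' \<bullet> k\<bar> \<le> 3 * (\<eta> * norm k) + 2 * (L * (\<eta> * norm k))"
          using 1 2 3 4 5 wk by linarith
        also have "\<dots> \<le> c * \<eta> * norm k"
          using \<eta>(2) L0 by (simp add: c_def algebra_simps)
        also have "\<dots> \<le> e * norm k"
          using \<eta>(3) c by (intro mult_right_mono) (auto simp: field_simps)
        finally show ?thesis .
      qed
      moreover have "r > 0"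
        using r1(1) r2(1) by (simp add: r_def)
      ultimately show "\<exists>d>0. \<forall>h\<in>span (insert b B). norm h < d \<longrightarrow> \<bar>f (x + h) - f x - w' \<bullet> h\<bar> \<le> e * norm h"
        by blast
    qed
  qed
  ultimately show ?case
    by (elim negligible_subset) blast
qed

text \<open>The scalar case for the span of all basis vectors, applied to each of the finitely many
  coordinates of \<open>f\<close>.\<close>

theorem rademacher:
  fixes f :: "'a::euclidean_space \<Rightarrow> 'b::euclidean_space"
  assumes lip: "L-lipschitz_on UNIV f"
  shows "negligible {x. \<not> f differentiable (at x)}"
proof (rule negligible_subset)
  have "L-lipschitz_on UNIV (\<lambda>x. f x \<bullet> i)" if "i \<in> Basis" for i
  proof (rule lipschitz_onI)
    fix x y
    have "dist (f x \<bullet> i) (f y \<bullet> i) \<le> dist (f x) (f y)"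
      using Basis_le_norm[OF that, of "f x - f y"] by (simp add: dist_norm inner_diff_left)
    also have "\<dots> \<le> L * dist x y"
      using lipschitz_onD[OF lip] by simp
    finally show "dist (f x \<bullet> i) (f y \<bullet> i) \<le> L * dist x y" .
  qed (use lipschitz_on_nonneg[OF lip] in simp)
  then show "negligible (\<Union>i\<in>(Basis::'b set). {x. \<not> differentiable_along (span (Basis::'a set)) (\<lambda>x. f x \<bullet> i) x})"
    using negligible_not_differentiable_along_span[OF finite_Basis order_refl]
    by (intro negligible_Union) auto
  have "f differentiable (at x)" if dx: "\<And>i. i \<in> Basis \<Longrightarrow> differentiable_along (span Basis) (\<lambda>x. f x \<bullet> i) x" for x
  proof -
    have "(\<lambda>x. f x \<bullet> i) differentiable (at x)" if i: "i \<in> Basis" for i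
    proof -
      obtain w where w: "\<And>e. e > 0 \<Longrightarrow> \<exists>d>0. \<forall>h. norm h < d \<longrightarrow> \<bar>f (x + h) \<bullet> i - f x \<bullet> i - w \<bullet> h\<bar> \<le> e * norm h"
        using dx[OF i] by (auto simp: differentiable_along_def)
      have "((\<lambda>x. f x \<bullet> i) has_derivative (\<lambda>h. w \<bullet> h)) (at x)"
        unfolding has_derivative_at_alt
      proof (intro conjI allI impI)
        fix e :: real
        assume "0 < e"
        then obtain d where "d > 0" "\<And>h. norm h < d \<Longrightarrow> \<bar>f (x + h) \<bullet> i - f x \<bullet> i - w \<bullet> h\<bar> \<le> e * norm h"
          using w by metis
        then show "\<exists>d>0. \<forall>y. norm (y - x) < d \<longrightarrow> norm (f y \<bullet> i - f x \<bullet> i - w \<bullet> (y - x)) \<le> e * norm (y - x)"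
          by (intro exI[of _ d]) (metis add.commute diff_add_cancel real_norm_def)
      qed (rule bounded_linear_inner_right)
      then show ?thesis
        using differentiable_def by blast
    qed
    then show ?thesis
      using differentiable_componentwise_within by blast
  qed
  then show "{x. \<not> f differentiable (at x)} \<subseteq> (\<Union>i\<in>(Basis::'b set). {x. \<not> differentiable_along (span (Basis::'a set)) (\<lambda>x. f x \<bullet> i) x})"
    by blast
qed

section \<open>Semicontinuous functions and Taylor expansions\<close>

text \<open>Without a minimum, every point has a neighbourhood on which \<open>f\<close> exceeds
  some value \<open>f (Y x)\<close>. Among the finitely many values of a subcover the smallest is
  taken at a point that lies in one of these neighbourhoods, and so exceeds another of the
  values.\<close>

lemma lsc_attains_inf:
  fixes f :: "'a::metric_space \<Rightarrow> ereal"
  assumes S: "compact S" "S \<noteq> {}"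
    and lsc: "\<And>x t. x \<in> S \<Longrightarrow> ereal t < f x \<Longrightarrow> \<forall>\<^sub>F y in at x within S. ereal t < f y"
  shows "\<exists>x\<in>S. \<forall>y\<in>S. f x \<le> f y"
proof (rule ccontr)
  assume neg: "\<not> ?thesis"
  have "\<exists>y T. x \<in> S \<longrightarrow> y \<in> S \<and> open T \<and> x \<in> T \<and> (\<forall>z\<in>T \<inter> S. f y < f z)" for x
  proof (cases "x \<in> S")
    case True
    then obtain y where y: "y \<in> S" "f y < f x"
      using neg not_le by blast
    obtain t where t: "f y < ereal t" "ereal t < f x"
      using ereal_dense2[OF y(2)] by blast
    obtain T where "open T" "x \<in> T" "\<And>z. z \<in> T \<Longrightarrow> z \<noteq> x \<Longrightarrow> z \<in> S \<Longrightarrow> ereal t < f z"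
      using lsc[OF True t(2)] unfolding eventually_at_topological by blast
    then have "\<forall>z\<in>T \<inter> S. f y < f z"
      using t by (metis IntD1 IntD2 less_trans)
    then show ?thesis
      using y \<open>open T\<close> \<open>x \<in> T\<close> by blast
  qed auto
  then obtain Y T where YT: "\<And>x. x \<in> S \<Longrightarrow> Y x \<in> S \<and> open (T x) \<and> x \<in> T x \<and> (\<forall>z\<in>T x \<inter> S. f (Y x) < f z)"
    by metis
  obtain C where C: "C \<subseteq> S" "finite C" "S \<subseteq> (\<Union>x\<in>C. T x)"
    using compactE_image[OF S(1), of S T] YT by blast
  then have "C \<noteq> {}"
    using S(2) by auto
  define m where "m = Min ((\<lambda>x. f (Y x)) ` C)"
  have "m \<in> (\<lambda>x. f (Y x)) ` C"
    unfolding m_def using C(2) \<open>C \<noteq> {}\<close> by (intro Min_in) auto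
  then obtain c where c: "c \<in> C" "f (Y c) = m"
    by auto
  have c_min: "f (Y c) \<le> f (Y x)" if "x \<in> C" for x
    unfolding c(2) m_def using C(2) that by simp
  obtain x where "x \<in> C" "Y c \<in> T x"
    using C(1,3) c(1) YT by blast
  then have "f (Y x) < f (Y c)"
    using YT C(1) c(1) by blast
  then show False
    using c_min[OF \<open>x \<in> C\<close>] by simp
qed

lemma lsc_on_eventually_less:
  assumes "lsc_on S f" "x \<in> S" "t < f x"
  shows "\<forall>\<^sub>F y in at x within S. t < f y"
proof -
  have "t < Liminf (at x within S) f"
    using assms unfolding lsc_on_def by (metis less_le_trans)
  then show ?thesis
    by (rule less_LiminfD)
qed

text \<open>The two variables are those of the doubled functional. Minimising \<open>u\<close> plus
  a continuous function of one variable is the case in which \<open>k\<close> ignores its first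
  argument.\<close>

lemma lsc_add_continuous_attains_inf:
  fixes u :: "'a::metric_space \<Rightarrow> ereal" and k :: "'a \<times> 'a \<Rightarrow> real"
  assumes S: "compact S" "S \<noteq> {}" and lsc: "lsc_on S u" and k: "continuous_on (S \<times> S) k"
  shows "\<exists>x\<in>S. \<exists>y\<in>S. \<forall>x'\<in>S. \<forall>y'\<in>S. u y + ereal (k (x, y)) \<le> u y' + ereal (k (x', y'))"
proof -
  have "\<exists>z\<in>S \<times> S. \<forall>z'\<in>S \<times> S. u (snd z) + ereal (k z) \<le> u (snd z') + ereal (k z')"
  proof (rule lsc_attains_inf)
    show "compact (S \<times> S)" "S \<times> S \<noteq> {}"
      using S by (auto intro: compact_Times)
    fix z t
    assume z: "z \<in> S \<times> S" and t: "ereal t < u (snd z) + ereal (k z)"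
    have iff: "ereal t < u y + ereal r \<longleftrightarrow> ereal (t - r) < u y" for y t r
      by (cases "u y") auto
    obtain s where s: "ereal (t - k z) < ereal s" "ereal s < u (snd z)"
      using ereal_dense2 t unfolding iff by blast
    have "\<forall>\<^sub>F y in at (snd z) within S. ereal s < u y"
      using lsc_on_eventually_less[OF lsc] z s(2) by auto
    then obtain d1 where d1: "d1 > 0" "\<And>y. y \<in> S \<Longrightarrow> dist y (snd z) < d1 \<Longrightarrow> ereal s < u y"
      unfolding eventually_at using s(2) by metis
    obtain d2 where d2: "d2 > 0" "\<And>z'. z' \<in> S \<times> S \<Longrightarrow> dist z' z < d2 \<Longrightarrow> dist (k z') (k z) < s - (t - k z)"
      using k z s(1) unfolding continuous_on_iff by (metis diff_gt_0_iff_gt less_ereal.simps(1))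
    show "\<forall>\<^sub>F z' in at z within S \<times> S. ereal t < u (snd z') + ereal (k z')"
      unfolding eventually_at
    proof (intro exI conjI ballI impI)
      show "0 < min d1 d2"
        using d1 d2 by simp
      fix z'
      assume z': "z' \<in> S \<times> S" "z' \<noteq> z \<and> dist z' z < min d1 d2"
      have "dist (snd z') (snd z) < d1"
        using dist_snd_le[of z' z] z' by linarith
      then have "ereal s < u (snd z')"
        using d1(2) z'(1) by auto
      moreover have "t - k z' < s"
        using d2(2)[OF z'(1)] z'(2) by (simp add: dist_real_def)
      ultimately show "ereal t < u (snd z') + ereal (k z')"
        unfolding iff by (metis less_ereal.simps(1) less_trans)
    qed
  qed
  then show ?thesis by (auto simp: Bex_def Ball_def)
qed

text \<open>Mean value inequality for \<open>v\<close> minus its tangent at \<open>x\<close>, along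
  the segment, where the gradient differs from \<open>g x\<close> by at most
  \<open>L * norm (z - x)\<close>. This gives \<open>L\<close> in place of the sharp
  \<open>L / 2\<close>, which is enough for semiconcavity.\<close>

lemma C11_taylor_bound:
  fixes v :: "'a::euclidean_space \<Rightarrow> real"
  assumes S: "convex S" and x: "x \<in> S" "z \<in> S"
    and dv: "\<And>x. x \<in> S \<Longrightarrow> (v has_derivative (\<lambda>h. g x \<bullet> h)) (at x within S)"
    and lip: "L-lipschitz_on S g"
  shows "\<bar>v z - v x - g x \<bullet> (z - x)\<bar> \<le> L * (norm (z - x))\<^sup>2"
proof -
  have seg: "closed_segment x z \<subseteq> S"
    using S x by (simp add: closed_segment_subset)
  have "norm ((v z - g x \<bullet> z) - (v x - g x \<bullet> x)) \<le> (L * norm (z - x)) * norm (z - x)"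
  proof (rule differentiable_bound[of "closed_segment x z" "\<lambda>y. v y - g x \<bullet> y" "\<lambda>y h. g y \<bullet> h - g x \<bullet> h"])
    fix y
    assume y: "y \<in> closed_segment x z"
    have "(v has_derivative (\<lambda>h. g y \<bullet> h)) (at y within closed_segment x z)"
      using dv seg y by (meson has_derivative_subset subsetD)
    then show "((\<lambda>y. v y - g x \<bullet> y) has_derivative (\<lambda>h. g y \<bullet> h - g x \<bullet> h)) (at y within closed_segment x z)"
      by (auto intro!: derivative_eq_intros)
    have "norm (g y - g x) \<le> L * norm (z - x)"
    proof -
      have "norm (g y - g x) \<le> L * norm (y - x)"
        using lipschitz_onD[OF lip, of y x] y seg x by (auto simp: dist_norm)
      also have "\<dots> \<le> L * norm (z - x)"
        using segment_bound(1)[OF y] lipschitz_on_nonneg[OF lip] by (simp add: mult_left_mono)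
      finally show ?thesis .
    qed
    then have "norm (g y \<bullet> h - g x \<bullet> h) \<le> L * norm (z - x) * norm h" for h
      using Cauchy_Schwarz_ineq2[of "g y - g x" h] mult_right_mono[of "norm (g y - g x)" "L * norm (z - x)" "norm h"]
      by (simp add: inner_diff_left)
    then show "onorm (\<lambda>h. g y \<bullet> h - g x \<bullet> h) \<le> L * norm (z - x)"
      by (intro onorm_le) 
  qed auto
  then show ?thesis
    by (simp add: inner_diff_right power2_eq_square algebra_simps)
qed

lemma lipschitz_derivative_bound:
  fixes g :: "'a::real_normed_vector \<Rightarrow> 'b::real_normed_vector"
  assumes "L-lipschitz_on UNIV g" "(g has_derivative B) (at x)"
  shows "norm (B h) \<le> L * norm h"
proof (cases "h = 0")
  case True
  then show ?thesis
    using assms(2) by (simp add: linear_0[OF has_derivative_linear])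
next
  case False
  show ?thesis
  proof (rule field_le_epsilon)
    fix e :: real
    assume "0 < e"
    define e' where "e' = e / norm h"
    have e': "e' > 0" "e' * norm h = e"
      using \<open>0 < e\<close> False by (auto simp: e'_def)
    obtain d where d: "d > 0" "\<And>y. norm (y - x) < d \<Longrightarrow> norm (g y - g x - B (y - x)) \<le> e' * norm (y - x)"
      using assms(2) e'(1) unfolding has_derivative_at_alt by blast
    define t where "t = d / (2 * norm h)"
    have t: "t > 0" "t * norm h < d"
      using d(1) False by (auto simp: t_def)
    have "norm (B (t *\<^sub>R h)) \<le> norm (g (x + t *\<^sub>R h) - g x) + norm (g (x + t *\<^sub>R h) - g x - B (t *\<^sub>R h))"
      by (metis add.commute diff_add_cancel norm_minus_commute norm_triangle_ineq)
    also have "\<dots> \<le> L * (t * norm h) + e' * (t * norm h)"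
      using d(2)[of "x + t *\<^sub>R h"] lipschitz_onD[OF assms(1), of "x + t *\<^sub>R h" x] t
      by (intro add_mono) (auto simp: dist_norm)
    also have "e' * (t * norm h) = t * e"
      using e'(2) by (metis mult.left_commute)
    finally have "t * norm (B h) \<le> t * (L * norm h + e)"
      using t linear_cmul[OF has_derivative_linear[OF assms(2)], of t h]
      by (simp add: algebra_simps)
    then show "norm (B h) \<le> L * norm h + e"
      using t(1) by simp
  qed
qed

text \<open>Along the segment from \<open>x0\<close> to \<open>x0 + h\<close>, the difference
  between \<open>v\<close> and its quadratic model has derivative \<open>(g (x0 + t *\<^sub>R h) - g
  x0 - B (t *\<^sub>R h)) \<bullet> h\<close>, which is at most
  \<open>\<eta> * (norm h)\<^sup>2\<close>. So differentiability of the gradient at the single point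
  \<open>x0\<close> suffices, which is what Rademacher's theorem provides.\<close>

lemma second_order_expansion:
  fixes v :: "'a::euclidean_space \<Rightarrow> real"
  assumes r: "0 < r" and dv: "\<And>x. x \<in> ball x0 r \<Longrightarrow> (v has_derivative (\<lambda>h. g x \<bullet> h)) (at x)"
    and dg: "(g has_derivative B) (at x0)" and "0 < \<eta>"
  shows "\<exists>d>0. \<forall>h. norm h < d \<longrightarrow> \<bar>v (x0 + h) - v x0 - g x0 \<bullet> h - (h \<bullet> B h) / 2\<bar> \<le> \<eta> * (norm h)\<^sup>2"
proof -
  obtain d where d: "d > 0" "\<And>y. norm (y - x0) < d \<Longrightarrow> norm (g y - g x0 - B (y - x0)) \<le> \<eta> * norm (y - x0)"
    using dg \<open>0 < \<eta>\<close> unfolding has_derivative_at_alt by blast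
  have "\<bar>v (x0 + h) - v x0 - g x0 \<bullet> h - (h \<bullet> B h) / 2\<bar> \<le> \<eta> * (norm h)\<^sup>2" if h: "norm h < min d r" for h
  proof -
    define \<psi> where "\<psi> t = v (x0 + t *\<^sub>R h) - t * (g x0 \<bullet> h) - t\<^sup>2 * ((h \<bullet> B h) / 2)" for t
    define \<psi>' where "\<psi>' t = g (x0 + t *\<^sub>R h) \<bullet> h - g x0 \<bullet> h - t * (h \<bullet> B h)" for t
    have th: "norm (t *\<^sub>R h) \<le> norm h" if "t \<in> {0..1}" for t
      using that by (simp add: mult_left_le_one_le)
    have "norm (\<psi> 1 - \<psi> 0) \<le> (\<eta> * (norm h)\<^sup>2) * norm (1 - 0 :: real)"
    proof (rule differentiable_bound[of "{0..1}" \<psi> "\<lambda>t s. s * \<psi>' t"])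
      fix t :: real
      assume t: "t \<in> {0..1}"
      have inb: "x0 + t *\<^sub>R h \<in> ball x0 r"
        using th[OF t] h by (simp add: dist_norm)
      have "((\<lambda>t. v (x0 + t *\<^sub>R h)) has_derivative (\<lambda>s. g (x0 + t *\<^sub>R h) \<bullet> (s *\<^sub>R h))) (at t within {0..1})"
        by (rule has_derivative_compose[where f = "\<lambda>t. x0 + t *\<^sub>R h" and f' = "\<lambda>s. s *\<^sub>R h"
              and g = v and g' = "\<lambda>k. g (x0 + t *\<^sub>R h) \<bullet> k"])
          (use dv[OF inb] in \<open>auto intro!: derivative_eq_intros\<close>)
      then show "(\<psi> has_derivative (\<lambda>s. s * \<psi>' t)) (at t within {0..1})"
        unfolding \<psi>_def \<psi>'_def
        by (auto intro!: derivative_eq_intros simp: algebra_simps)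
      have "\<psi>' t = (g (x0 + t *\<^sub>R h) - g x0 - B (t *\<^sub>R h)) \<bullet> h"
        using linear_cmul[OF has_derivative_linear[OF dg], of t h]
        by (simp add: \<psi>'_def inner_diff_left inner_diff_right inner_commute[of h])
      also have "\<bar>\<dots>\<bar> \<le> norm (g (x0 + t *\<^sub>R h) - g x0 - B (t *\<^sub>R h)) * norm h"
        by (rule Cauchy_Schwarz_ineq2)
      also have "\<dots> \<le> (\<eta> * norm (t *\<^sub>R h)) * norm h"
        using d(2)[of "x0 + t *\<^sub>R h"] th[OF t] h by (intro mult_right_mono) auto
      also have "\<dots> \<le> (\<eta> * norm h) * norm h"
        using th[OF t] \<open>0 < \<eta>\<close> by (intro mult_right_mono mult_left_mono) auto
      finally have "\<bar>\<psi>' t\<bar> \<le> \<eta> * (norm h)\<^sup>2"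
        by (simp add: power2_eq_square mult.assoc)
      from mult_left_mono[OF this abs_ge_zero]
      have "norm (s * \<psi>' t) \<le> \<eta> * (norm h)\<^sup>2 * norm s" for s
        by (simp add: abs_mult mult_ac)
      then show "onorm (\<lambda>s. s * \<psi>' t) \<le> \<eta> * (norm h)\<^sup>2"
        by (intro onorm_le)
    qed auto
    then show ?thesis
      by (simp add: \<psi>_def algebra_simps)
  qed
  then show ?thesis
    using d(1) r by (intro exI[of _ "min d r"]) auto
qed

text \<open>A device for choosing a small parameter: each pair in \<open>C\<close> encodes one
  requirement, a constant times \<open>\<sigma>\<close> below a positive bound.\<close>

lemma exists_small_multiplier:
  fixes C :: "(real \<times> real) set"
  assumes "finite C" "\<forall>z\<in>C. 0 < snd z"
  shows "\<exists>\<sigma>>0. \<forall>z\<in>C. fst z * \<sigma> < snd z"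
proof -
  have "\<forall>\<^sub>F \<sigma> in at_right 0. \<forall>z\<in>C. fst z * \<sigma> < snd z"
  proof (intro eventually_ball_finite assms(1) ballI)
    fix z
    assume "z \<in> C"
    moreover have "((\<lambda>\<sigma>. fst z * \<sigma>) \<longlongrightarrow> fst z * 0) (at_right 0)"
      by (intro tendsto_intros)
    ultimately show "\<forall>\<^sub>F \<sigma> in at_right 0. fst z * \<sigma> < snd z"
      using assms(2) by (auto intro: order_tendstoD)
  qed
  then have "\<forall>\<^sub>F \<sigma> in at_right 0. 0 < \<sigma> \<and> (\<forall>z\<in>C. fst z * \<sigma> < snd z)"
    using eventually_at_right_less by (rule eventually_conj[rotated])
  then show ?thesis
    using eventually_happens'[OF trivial_limit_at_right_real] by blast
qed

section \<open>Jensen's lemma and contact points\<close>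

text \<open>The pair \<open>(x, y)\<close> minimises \<open>u y + c x y - p \<bullet> x\<close> over
  \<open>S \<times> S\<close>. As \<open>u\<close> may be infinite, all real terms are collected on
  one side and the finite value at \<open>y\<close> is named \<open>s\<close>.\<close>

definition tilted_min ::
    "('a::euclidean_space \<Rightarrow> ereal) \<Rightarrow> ('a \<Rightarrow> 'a \<Rightarrow> real) \<Rightarrow> 'a set \<Rightarrow> 'a \<Rightarrow> 'a \<Rightarrow> 'a \<Rightarrow> real \<Rightarrow> bool" where
  "tilted_min u c S p x y s \<longleftrightarrow> x \<in> S \<and> y \<in> S \<and> u y = ereal s \<and>
     (\<forall>x'\<in>S. \<forall>y'\<in>S. ereal (s + c x y - c x' y' - p \<bullet> (x - x')) \<le> u y')"

lemma tilted_minD: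
  assumes "tilted_min u c S p x y s" "x' \<in> S" "y' \<in> S" "u y' = ereal s'"
  shows "s + c x y - p \<bullet> x \<le> s' + c x' y' - p \<bullet> x'"
proof -
  have "ereal (s + c x y - c x' y' - p \<bullet> (x - x')) \<le> u y'"
    using assms(1-3) unfolding tilted_min_def by blast
  then show ?thesis
    using assms(4) by (simp add: inner_diff_right)
qed

text \<open>First-order condition at a minimiser, for which a one-sided quadratic bound on
  \<open>c\<close> is enough: a short step against \<open>w x y - p\<close> would lower the
  functional linearly and raise it only quadratically.\<close>

lemma tilted_min_slope:
  assumes min: "tilted_min u c S p x y s" and S: "S = cball a \<rho>" and near: "norm (x - a) < \<rho>"
    and sc: "\<And>x y z. x \<in> S \<Longrightarrow> y \<in> S \<Longrightarrow> z \<in> S \<Longrightarrow> c z y - c x y \<le> w x y \<bullet> (z - x) + C * (norm (z - x))\<^sup>2"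
  shows "w x y = p"
proof (rule ccontr)
  assume "w x y \<noteq> p"
  define e where "e = w x y - p"
  have e: "e \<noteq> 0" "norm e > 0"
    using \<open>w x y \<noteq> p\<close> by (auto simp: e_def)
  \<comment> \<open>The first requirement keeps \<open>z\<close> in the ball, the second lets the
    linear decrease outweigh the quadratic term.\<close>
  obtain t where t: "t > 0" "norm e * t < \<rho> - norm (x - a)" "C * t < 1"
    using exists_small_multiplier[of "{(norm e, \<rho> - norm (x - a)), (C, 1)}"] near by auto
  define z where "z = x - t *\<^sub>R e"
  have "norm (z - a) \<le> norm (x - a) + norm (t *\<^sub>R e)"
    unfolding z_def using norm_triangle_ineq4[of "x - a" "t *\<^sub>R e"] by (simp add: algebra_simps)
  then have zS: "z \<in> S"
    using t by (simp add: S dist_norm norm_minus_commute mult.commute)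
  have xy: "x \<in> S" "y \<in> S" "u y = ereal s"
    using min by (auto simp: tilted_min_def)
  have "0 \<le> c z y - c x y - p \<bullet> (z - x)"
    using tilted_minD[OF min zS xy(2,3)] by (simp add: inner_diff_right)
  also have "\<dots> \<le> w x y \<bullet> (z - x) + C * (norm (z - x))\<^sup>2 - p \<bullet> (z - x)"
    using sc[OF xy(1,2) zS] by simp
  also have "\<dots> = e \<bullet> (z - x) + C * (norm (z - x))\<^sup>2"
    by (simp add: e_def inner_diff_left)
  also have "\<dots> = t * (norm e)\<^sup>2 * (C * t - 1)"
    using t(1) by (simp add: z_def dot_square_norm power2_eq_square algebra_simps)
  finally have "0 \<le> t * (norm e)\<^sup>2 * (C * t - 1)" .
  moreover have "t * (norm e)\<^sup>2 * (C * t - 1) < 0"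
    using t e by (intro mult_pos_neg) auto
  ultimately show False by simp
qed

text \<open>Jensen's lemma: the minimised function lies above its supporting plane of slope \<open>p1\<close> at \<open>x1\<close>, and
  by semiconcavity below a paraboloid of slope \<open>p0\<close> at \<open>x0\<close>. Comparing the two near \<open>x1\<close> bounds
  \<open>p1 - p0\<close>.\<close>

lemma tilted_min_slope_lipschitz:
  assumes min0: "tilted_min u c S p0 x0 y0 s0" and min1: "tilted_min u c S p1 x1 y1 s1"
    and S: "S = cball a \<rho>" and "0 < \<rho>" and near: "norm (x0 - a) \<le> \<rho> / 4" "norm (x1 - a) \<le> \<rho> / 4"
    and sc: "\<And>x y z. x \<in> S \<Longrightarrow> y \<in> S \<Longrightarrow> z \<in> S \<Longrightarrow> c z y - c x y \<le> w x y \<bullet> (z - x) + C * (norm (z - x))\<^sup>2"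
    and "0 \<le> C"
  shows "norm (p1 - p0) \<le> 4 * C * norm (x1 - x0)"
proof -
  have w0: "w x0 y0 = p0"
    using tilted_min_slope[OF min0 S _ sc] near(1) \<open>0 < \<rho>\<close> by simp
  have in0: "x0 \<in> S" "y0 \<in> S" "u y0 = ereal s0" and in1: "x1 \<in> S" "y1 \<in> S" "u y1 = ereal s1"
    using min0 min1 by (auto simp: tilted_min_def)
  \<comment> \<open>Minimality for \<open>p1\<close> is tested at \<open>(z, y0)\<close> and
    minimality for \<open>p0\<close> at \<open>(x1, y1)\<close>; on adding the two, the values of
    \<open>u\<close> cancel.\<close>
  have key: "(p1 - p0) \<bullet> (z - x1) \<le> C * (norm (z - x0))\<^sup>2" if z: "z \<in> S" for z
  proof -
    have "s1 + c x1 y1 - p1 \<bullet> x1 \<le> s0 + c z y0 - p1 \<bullet> z"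
      using tilted_minD[OF min1 z in0(2,3)] .
    moreover have "s0 + c x0 y0 - p0 \<bullet> x0 \<le> s1 + c x1 y1 - p0 \<bullet> x1"
      using tilted_minD[OF min0 in1] .
    moreover have "c z y0 - c x0 y0 \<le> p0 \<bullet> (z - x0) + C * (norm (z - x0))\<^sup>2"
      using sc[OF in0(1,2) z] w0 by simp
    ultimately show ?thesis
      by (simp add: inner_diff_left inner_diff_right)
  qed
  \<comment> \<open>A step of length \<open>r\<close> from \<open>x1\<close> in the direction of
    \<open>p1 - p0\<close> stays within \<open>2 * r\<close> of \<open>x0\<close>, hence the factor
    4. The length is left free so that \<open>r\<close> can tend to 0 when
    \<open>x1 = x0\<close>.\<close>
  have bound: "norm (p1 - p0) \<le> 4 * C * r" if r: "0 < r" "norm (x1 - x0) \<le> r" "r \<le> 3 * \<rho> / 4" for r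
  proof (cases "p1 = p0")
    case False
    define e where "e = (p1 - p0) /\<^sub>R norm (p1 - p0)"
    have e: "norm e = 1" "(p1 - p0) \<bullet> e = norm (p1 - p0)"
      using False by (auto simp: e_def power2_norm_eq_inner[symmetric] power2_eq_square)
    define z where "z = x1 + r *\<^sub>R e"
    have "norm (z - a) \<le> norm (x1 - a) + norm (r *\<^sub>R e)"
      unfolding z_def using norm_triangle_ineq[of "x1 - a" "r *\<^sub>R e"] by (simp add: algebra_simps)
    then have "z \<in> S"
      using near(2) r e(1) by (simp add: S dist_norm norm_minus_commute)
    have "norm (z - x0) \<le> norm (x1 - x0) + norm (r *\<^sub>R e)"
      unfolding z_def using norm_triangle_ineq[of "x1 - x0" "r *\<^sub>R e"] by (simp add: algebra_simps)
    then have "norm (z - x0) \<le> 2 * r"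
      using r e(1) by simp
    have "r * norm (p1 - p0) = (p1 - p0) \<bullet> (z - x1)"
      by (simp add: z_def e(2))
    also have "\<dots> \<le> C * (norm (z - x0))\<^sup>2"
      using key[OF \<open>z \<in> S\<close>] .
    also have "\<dots> \<le> C * (2 * r)\<^sup>2"
      using \<open>norm (z - x0) \<le> 2 * r\<close> \<open>0 \<le> C\<close> by (intro mult_left_mono power_mono) auto
    finally have "r * norm (p1 - p0) \<le> r * (4 * C * r)"
      by (simp add: power2_eq_square algebra_simps)
    then show ?thesis
      using r(1) by simp
  qed (use r \<open>0 \<le> C\<close> in simp)
  have le: "norm (x1 - x0) \<le> \<rho> / 2"
    using norm_triangle_ineq4[of "x1 - a" "x0 - a"] near by simp
  show ?thesis
  proof (cases "x1 = x0")
    case False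
    then show ?thesis
      using bound[of "norm (x1 - x0)"] le \<open>0 < \<rho>\<close> by simp
  next
    case True
    have "norm (p1 - p0) \<le> 0"
    proof (rule field_le_epsilon)
      fix e :: real
      assume "0 < e"
      obtain r where r: "r > 0" "4 * C * r < e" "1 * r < 3 * \<rho> / 4"
        using exists_small_multiplier[of "{(4 * C, e), (1, 3 * \<rho> / 4)}"] \<open>0 < e\<close> \<open>0 < \<rho>\<close> by auto
      then show "norm (p1 - p0) \<le> 0 + e"
        using bound[of r] True by simp
    qed
    then show ?thesis
      using True by simp
  qed
qed

text \<open>By the Lipschitz estimate, a minimiser determines its slope, and the slope is a
  Lipschitz function \<open>P\<close> of the minimiser. \<open>P\<close> reaches every slope in the
  ball of radius \<open>\<pi>\<close>, while a Lipschitz image of a null set would be null.\<close>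

lemma not_negligible_tilted_min:
  fixes a :: "'a::euclidean_space"
  assumes S: "S = cball a \<rho>" and "0 < \<rho>" "0 < \<pi>"
    and sc: "\<And>x y z. x \<in> S \<Longrightarrow> y \<in> S \<Longrightarrow> z \<in> S \<Longrightarrow> c z y - c x y \<le> w x y \<bullet> (z - x) + C * (norm (z - x))\<^sup>2"
    and "0 \<le> C"
    and ex: "\<And>p. norm p \<le> \<pi> \<Longrightarrow> \<exists>x y s. tilted_min u c S p x y s"
    and near: "\<And>p x y s. norm p \<le> \<pi> \<Longrightarrow> tilted_min u c S p x y s \<Longrightarrow> norm (x - a) \<le> \<rho> / 4"
  shows "\<not> negligible {x. \<exists>p y s. norm p \<le> \<pi> \<and> tilted_min u c S p x y s}" (is "\<not> negligible ?X")
proof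
  assume neg: "negligible ?X"
  define P where "P x = (SOME p. \<exists>y s. norm p \<le> \<pi> \<and> tilted_min u c S p x y s)" for x
  have P: "\<exists>y s. norm (P x) \<le> \<pi> \<and> tilted_min u c S (P x) x y s" if "x \<in> ?X" for x
  proof -
    have "\<exists>p y s. norm p \<le> \<pi> \<and> tilted_min u c S p x y s"
      using that by blast
    from someI_ex[OF this] show ?thesis
      unfolding P_def .
  qed
  have lip: "norm (p1 - p0) \<le> 4 * C * norm (x1 - x0)"
    if "norm p0 \<le> \<pi>" "tilted_min u c S p0 x0 y0 s0" "norm p1 \<le> \<pi>" "tilted_min u c S p1 x1 y1 s1"
    for p0 x0 y0 s0 p1 x1 y1 s1
    using tilted_min_slope_lipschitz[OF that(2,4) S \<open>0 < \<rho>\<close> near[OF that(1,2)] near[OF that(3,4)] sc \<open>0 \<le> C\<close>] .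
  have "negligible (P ` ?X)"
  proof (rule negligible_locally_Lipschitz_image[OF order_refl neg])
    fix x
    assume x: "x \<in> ?X"
    have "\<forall>y\<in>?X \<inter> UNIV. norm (P y - P x) \<le> 4 * C * norm (y - x)"
      using P[OF x] P lip by blast
    then show "\<exists>T B. open T \<and> x \<in> T \<and> (\<forall>y\<in>?X \<inter> T. norm (P y - P x) \<le> B * norm (y - x))"
      by blast
  qed
  moreover have "ball (0::'a) \<pi> \<subseteq> P ` ?X"
  proof
    fix p
    assume "p \<in> ball (0::'a) \<pi>"
    then have p: "norm p \<le> \<pi>"
      by simp
    then obtain x y s where x: "tilted_min u c S p x y s"
      using ex by blast
    then have "x \<in> ?X"
      using p by blast
    then obtain y' s' where "norm (P x) \<le> \<pi>" "tilted_min u c S (P x) x y' s'"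
      using P by blast
    then have "norm (P x - p) \<le> 4 * C * norm (x - x)"
      using lip[OF p x] by blast
    then show "p \<in> P ` ?X"
      using \<open>x \<in> ?X\<close> by auto
  qed
  ultimately have "negligible (ball (0::'a) \<pi>)"
    using negligible_subset by blast
  then show False
    using open_not_negligible[of "ball (0::'a) \<pi>"] \<open>0 < \<pi>\<close> by simp
qed

text \<open>Doubling of variables: minimise
  \<open>u y - v x + \<tau> |x - a|\<^sup>2 + |x - y|\<^sup>2 / (2 \<sigma>) - p \<bullet> (x - a)\<close> over \<open>x\<close> and \<open>y\<close>. As \<open>p\<close> varies, the
  minimisers \<open>x\<close> form a set of positive measure, so at one of them \<open>g\<close> is differentiable. Moving \<open>x\<close> and
  \<open>y\<close> by the same vector transfers the expansion of \<open>v\<close> at \<open>x\<close> to a lower bound for \<open>u\<close> at \<open>y\<close>; no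
  second-order regularity of \<open>u\<close> is needed.\<close>

lemma contact_points:
  fixes u :: "'a::euclidean_space \<Rightarrow> ereal" and v :: "'a \<Rightarrow> real"
  assumes "0 < \<rho>" and lsc: "lsc_on (cball a \<rho>) u"
    and dv: "\<And>x. x \<in> cball a \<rho> \<Longrightarrow> (v has_derivative (\<lambda>h. g x \<bullet> h)) (at x)"
    and lip: "L-lipschitz_on (cball a \<rho>) g"
    and vu: "\<And>x. x \<in> cball a \<rho> \<Longrightarrow> ereal (v x) \<le> u x" and ua: "u a = ereal (v a)"
    and "0 < \<eta>"
  obtains x0 y0 s q B where "dist x0 a < \<eta>" "dist y0 a < \<eta>"
    "u y0 = ereal s" "\<bar>s - v x0\<bar> < \<eta>" "norm (q - g x0) < \<eta>"
    "bounded_linear B" "\<And>h. norm (B h) \<le> L * norm h"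
    "\<exists>d>0. \<forall>h. norm h < d \<longrightarrow> \<bar>v (x0 + h) - v x0 - g x0 \<bullet> h - (h \<bullet> B h) / 2\<bar> \<le> \<eta> * (norm h)\<^sup>2"
    "\<exists>d>0. \<forall>h. norm h < d \<longrightarrow> ereal (s + q \<bullet> h + (h \<bullet> B h) / 2 - \<eta> * (norm h)\<^sup>2) \<le> u (y0 + h)"
proof -
  define S where "S = cball a \<rho>"
  have aS: "a \<in> S" and cS: "convex S" "compact S" "S \<noteq> {}"
    using \<open>0 < \<rho>\<close> by (auto simp: S_def)
  have lip: "L-lipschitz_on S g" and L0: "0 \<le> L"
    using lip lipschitz_on_nonneg by (auto simp: S_def)
  have dvS: "(v has_derivative (\<lambda>h. g x \<bullet> h)) (at x within S)" if "x \<in> S" for x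
    using dv that by (auto simp: S_def intro: has_derivative_at_withinI)
  define G where "G = norm (g a) + L * \<rho>"
  have G0: "0 \<le> G"
    using L0 \<open>0 < \<rho>\<close> by (simp add: G_def)
  have gG: "norm (g x) \<le> G" if "x \<in> S" for x
  proof -
    have "norm (g x) \<le> norm (g a) + norm (g x - g a)"
      by (metis add.commute diff_add_cancel norm_triangle_ineq)
    also have "norm (g x - g a) \<le> L * norm (x - a)"
      using lipschitz_onD[OF lip that aS] by (simp add: dist_norm)
    also have "\<dots> \<le> L * \<rho>"
      using that L0 by (intro mult_left_mono) (auto simp: S_def dist_norm norm_minus_commute)
    finally show ?thesis by (simp add: G_def)
  qed
  have vlip: "\<bar>v x - v y\<bar> \<le> G * norm (x - y)" if "x \<in> S" "y \<in> S" for x y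
  proof -
    have "norm (v x - v y) \<le> G * norm (x - y)"
    proof (rule differentiable_bound[OF cS(1) dvS])
      show "onorm (\<lambda>h. g x \<bullet> h) \<le> G" if "x \<in> S" for x
        using gG[OF that] Cauchy_Schwarz_ineq2[of "g x"] mult_right_mono[of "norm (g x)" G]
        by (intro onorm_le) (simp, meson norm_ge_zero order_trans)
    qed (use that in auto)
    then show ?thesis by simp
  qed

  \<comment> \<open>\<open>\<tau>\<close> draws the minimisers towards \<open>a\<close>; what it
    adds to slopes and to second-order terms has to remain a fraction of
    \<open>\<eta>\<close>.\<close>
  define \<tau> where "\<tau> = min (\<eta> / 4) (\<eta> / (8 * \<rho>))"
  have \<tau>: "0 < \<tau>" "\<tau> \<le> \<eta> / 4" "2 * \<tau> * \<rho> \<le> \<eta> / 4"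
    using \<open>0 < \<eta>\<close> \<open>0 < \<rho>\<close> by (auto simp: \<tau>_def min_def field_simps)
  define \<zeta> where "\<zeta> = min \<eta> \<rho> / 4"
  have \<zeta>: "0 < \<zeta>" "\<zeta> \<le> \<rho> / 4" "\<zeta> \<le> \<eta> / 4"
    using \<open>0 < \<eta>\<close> \<open>0 < \<rho>\<close> by (auto simp: \<zeta>_def)
  define k where "k = 2 * G + 2 * \<rho> + 1"
  have k: "1 \<le> k"
    using G0 \<open>0 < \<rho>\<close> by (simp add: k_def)
  \<comment> \<open>\<open>\<sigma>\<close> is both the doubling parameter and the largest size of a
    tilt \<open>p\<close>. The requirements serve, in this order, the bounds on
    \<open>norm (x - a)\<close> and \<open>norm (x - y)\<close>, the upper and the lower bound on
    \<open>s - v x\<close>, and the smallness of the tilt.\<close>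
  have "\<exists>\<sigma>>0. \<forall>z\<in>{(G * k + \<rho>, \<tau> * \<zeta>\<^sup>2), (k, \<zeta>), (\<rho>, \<eta>), (G * k, \<eta>), (1, \<eta> / 4)}. fst z * \<sigma> < snd z"
    by (rule exists_small_multiplier) (use \<tau> \<zeta> \<open>0 < \<eta>\<close> in auto)
  then obtain \<sigma> where \<sigma>: "0 < \<sigma>" "(G * k + \<rho>) * \<sigma> < \<tau> * \<zeta>\<^sup>2" "k * \<sigma> < \<zeta>" "\<rho> * \<sigma> < \<eta>"
      "G * k * \<sigma> < \<eta>" "\<sigma> < \<eta> / 4"
    by auto
  define c where "c x y = \<tau> * (norm (x - a))\<^sup>2 - v x + (norm (x - y))\<^sup>2 / (2 * \<sigma>)" for x y
  \<comment> \<open>\<open>w\<close> is the gradient of \<open>c\<close> in \<open>x\<close>, and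
    \<open>C\<close> is a semiconcavity constant of \<open>c\<close> in \<open>x\<close>. The
    doubling term makes \<open>C\<close> large, but only its finiteness matters.\<close>
  define w where "w x y = (2 * \<tau>) *\<^sub>R (x - a) - g x + (x - y) /\<^sub>R \<sigma>" for x y
  define C where "C = L + \<tau> + 1 / (2 * \<sigma>)"
  have C0: "0 \<le> C"
    using L0 \<tau> \<sigma> by (simp add: C_def)
  have sc: "c z y - c x y \<le> w x y \<bullet> (z - x) + C * (norm (z - x))\<^sup>2" if "x \<in> S" "y \<in> S" "z \<in> S" for x y z
  proof -
    have sq: "(norm (z - b))\<^sup>2 - (norm (x - b))\<^sup>2 = 2 * ((x - b) \<bullet> (z - x)) + (norm (z - x))\<^sup>2" for b
      by (simp add: power2_norm_eq_inner inner_diff_left inner_diff_right inner_commute)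
    have "- (v z - v x) \<le> - (g x \<bullet> (z - x)) + L * (norm (z - x))\<^sup>2"
      using C11_taylor_bound[OF cS(1) that(1,3) dvS lip] by (simp add: abs_le_iff)
    moreover have "c z y - c x y = 2 * (\<tau> * ((x - a) \<bullet> (z - x))) + \<tau> * (norm (z - x))\<^sup>2 - (v z - v x)
        + ((x - y) \<bullet> (z - x) / \<sigma> + 1 / (2 * \<sigma>) * (norm (z - x))\<^sup>2)"
    proof -
      have "c z y - c x y = \<tau> * ((norm (z - a))\<^sup>2 - (norm (x - a))\<^sup>2) - (v z - v x)
          + ((norm (z - y))\<^sup>2 - (norm (x - y))\<^sup>2) / (2 * \<sigma>)"
        unfolding c_def right_diff_distrib diff_divide_distrib by simp
      then show ?thesis
        unfolding sq distrib_left add_divide_distrib by simp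
    qed
    moreover have "w x y \<bullet> (z - x) = 2 * (\<tau> * ((x - a) \<bullet> (z - x))) - g x \<bullet> (z - x) + (x - y) \<bullet> (z - x) / \<sigma>"
      unfolding w_def inner_add_left inner_diff_left[of _ "g x"] by (simp add: divide_inverse mult.commute)
    moreover have "C * (norm (z - x))\<^sup>2 = L * (norm (z - x))\<^sup>2 + \<tau> * (norm (z - x))\<^sup>2 + 1 / (2 * \<sigma>) * (norm (z - x))\<^sup>2"
      by (simp only: C_def distrib_right)
    ultimately show ?thesis
      by linarith
  qed

  have est: "norm (x - a) < \<zeta> \<and> norm (x - y) < \<zeta> \<and> \<bar>s - v x\<bar> < \<eta>"
    if p: "norm p \<le> \<sigma>" and min: "tilted_min u c S p x y s" for p x y s
  proof -
    define d where "d = norm (x - y)"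
    have xy: "x \<in> S" "y \<in> S" "u y = ereal s"
      using min by (auto simp: tilted_min_def)
    \<comment> \<open>Comparison with the pair \<open>(a, a)\<close>, where both penalties vanish
      and \<open>u\<close> equals \<open>v\<close>.\<close>
    have "s + c x y - p \<bullet> x \<le> v a + c a a - p \<bullet> a"
      using tilted_minD[OF min aS aS ua] .
    then have 1: "s - v x + \<tau> * (norm (x - a))\<^sup>2 + d\<^sup>2 / (2 * \<sigma>) \<le> p \<bullet> (x - a)"
      by (simp add: c_def d_def inner_diff_right)
    have "p \<bullet> (x - a) \<le> norm p * norm (x - a)"
      by (rule norm_cauchy_schwarz)
    also have "\<dots> \<le> \<sigma> * \<rho>"
      using p xy(1) \<sigma>(1) by (intro mult_mono) (auto simp: S_def dist_norm norm_minus_commute)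
    finally have 2: "p \<bullet> (x - a) \<le> \<sigma> * \<rho>" .
    have "v y \<le> s"
      using vu[of y] xy(2,3) by (simp add: S_def)
    then have 3: "- (G * d) \<le> s - v x"
      using vlip[OF xy(1,2)] by (simp add: d_def abs_le_iff)
    have nn: "0 \<le> \<tau> * (norm (x - a))\<^sup>2" "0 \<le> d\<^sup>2 / (2 * \<sigma>)" "0 \<le> d"
      using \<tau>(1) \<sigma>(1) by (auto simp: d_def)
    \<comment> \<open>Since \<open>v \<le> u\<close> and \<open>v\<close> has Lipschitz constant
      \<open>G\<close>, separating \<open>x\<close> from \<open>y\<close> gains at most
      \<open>G * d\<close>; the penalty \<open>d\<^sup>2 / (2 * \<sigma>)\<close> therefore forces
      \<open>d\<close> to be of order \<open>\<sigma>\<close>.\<close>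
    have "d \<le> k * \<sigma>"
    proof (rule ccontr)
      assume "\<not> d \<le> k * \<sigma>"
      then have d: "k * \<sigma> < d" by simp
      have "\<sigma> \<le> k * \<sigma>"
        using k \<sigma>(1) by simp
      then have "\<sigma> < d"
        using d by linarith
      have "d\<^sup>2 / (2 * \<sigma>) \<le> G * d + \<sigma> * \<rho>"
        using 1 2 3 nn(1) by linarith
      then have "d\<^sup>2 \<le> 2 * \<sigma> * (G * d + \<sigma> * \<rho>)"
        using \<sigma>(1) by (simp add: field_simps)
      also have "\<dots> \<le> 2 * \<sigma> * (G * d + d * \<rho>)"
        using \<sigma>(1) \<open>\<sigma> < d\<close> \<open>0 < \<rho>\<close> by (intro mult_left_mono add_left_mono mult_right_mono) auto
      also have "\<dots> = (k - 1) * \<sigma> * d"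
        by (simp add: k_def algebra_simps)
      also have "\<dots> < k * \<sigma> * d"
        using \<sigma>(1) \<open>\<sigma> < d\<close> by (intro mult_strict_right_mono) auto
      also have "\<dots> < d * d"
        using d \<sigma>(1) \<open>\<sigma> < d\<close> by (intro mult_strict_right_mono) auto
      finally show False
        by (simp add: power2_eq_square)
    qed
    then have Gd: "G * d \<le> G * (k * \<sigma>)"
      using G0 by (rule mult_left_mono)
    have "\<tau> * (norm (x - a))\<^sup>2 \<le> (G * k + \<rho>) * \<sigma>"
      using 1 2 3 nn(2) Gd by (simp add: algebra_simps)
    also have "\<dots> < \<tau> * \<zeta>\<^sup>2"
      by (rule \<sigma>(2))
    finally have "(norm (x - a))\<^sup>2 < \<zeta>\<^sup>2"
      using mult_less_cancel_left_pos[OF \<tau>(1)] by blast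
    then have "norm (x - a) < \<zeta>"
      using \<zeta>(1) by (meson less_imp_le power2_less_imp_less)
    moreover have "d < \<zeta>"
      using \<open>d \<le> k * \<sigma>\<close> \<sigma>(3) by linarith
    moreover have "s - v x < \<eta>"
      using 1 2 nn \<sigma>(4)[unfolded mult.commute[of \<rho>]] by linarith
    moreover have "- \<eta> < s - v x"
      using 3 Gd \<sigma>(5)[unfolded mult.assoc] by linarith
    ultimately show ?thesis
      by (auto simp: d_def)
  qed

  have ex: "\<exists>x y s. tilted_min u c S p x y s" if p: "norm p \<le> \<sigma>" for p
  proof -
    have cv: "continuous_on S v"
      using dvS by (meson differentiableI differentiable_imp_continuous_on differentiable_on_def)
    have "continuous_on (S \<times> S) (\<lambda>z. v (fst z))"
      by (rule continuous_on_compose2[OF cv]) (auto intro: continuous_intros)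
    then have "continuous_on (S \<times> S) (\<lambda>z. c (fst z) (snd z) - p \<bullet> fst z)"
      unfolding c_def using \<sigma>(1) by (intro continuous_intros) auto
    from lsc_add_continuous_attains_inf[OF cS(2,3) _ this] obtain x y where xy: "x \<in> S" "y \<in> S"
      "\<And>x' y'. x' \<in> S \<Longrightarrow> y' \<in> S \<Longrightarrow> u y + ereal (c x y - p \<bullet> x) \<le> u y' + ereal (c x' y' - p \<bullet> x')"
      using lsc unfolding S_def by fastforce
    have "u y \<noteq> \<infinity>"
      using xy(3)[OF aS aS] ua by auto
    moreover have "u y \<noteq> -\<infinity>"
      using vu[of y] xy(2) by (auto simp: S_def)
    ultimately obtain s where s: "u y = ereal s"
      by (cases "u y") auto
    have "ereal (s + c x y - c x' y' - p \<bullet> (x - x')) \<le> u y'" if "x' \<in> S" "y' \<in> S" for x' y'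
      using xy(3)[OF that] s by (cases "u y'") (auto simp: inner_diff_right)
    then have "tilted_min u c S p x y s"
      using xy s by (simp add: tilted_min_def)
    then show ?thesis by blast
  qed

  \<comment> \<open>Composing with the nearest-point projection extends \<open>g\<close> from the
    ball to the whole space with the same constant \<open>L\<close>, as Rademacher's theorem
    requires; in the interior of the ball \<open>g\<close> is unchanged.\<close>
  define cp where "cp x = closest_point S x" for x
  have "L-lipschitz_on UNIV (\<lambda>x. g (cp x))"
  proof (rule lipschitz_onI)
    fix x y
    have "dist (g (cp x)) (g (cp y)) \<le> L * dist (cp x) (cp y)"
      using lipschitz_onD[OF lip] closest_point_in_set[of S] cS compact_imp_closed by (auto simp: cp_def)
    also have "\<dots> \<le> L * dist x y"
      using closest_point_lipschitz[of S] cS compact_imp_closed L0 by (auto simp: cp_def intro!: mult_left_mono)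
    finally show "dist (g (cp x)) (g (cp y)) \<le> L * dist x y" .
  qed (rule L0)
  note gPi = this
  have "\<not> negligible {x. \<exists>p y s. norm p \<le> \<sigma> \<and> tilted_min u c S p x y s}"
  proof (rule not_negligible_tilted_min[OF S_def \<open>0 < \<rho>\<close> \<sigma>(1) sc C0 ex])
    show "norm (x - a) \<le> \<rho> / 4" if "norm p \<le> \<sigma>" "tilted_min u c S p x y s" for p x y s
      using est[OF that] \<zeta>(2) by linarith
  qed
  then have "\<not> {x. \<exists>p y s. norm p \<le> \<sigma> \<and> tilted_min u c S p x y s} \<subseteq> {x. \<not> (\<lambda>x. g (cp x)) differentiable (at x)}"
    using negligible_subset[OF rademacher[OF gPi]] by blast
  then obtain x0 p y0 s where p: "norm p \<le> \<sigma>" and min: "tilted_min u c S p x0 y0 s"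
    and diff: "(\<lambda>x. g (cp x)) differentiable (at x0)"
    by blast
  obtain B where B: "((\<lambda>x. g (cp x)) has_derivative B) (at x0)"
    using diff unfolding differentiable_def by blast
  have near: "norm (x0 - a) < \<zeta>" "norm (x0 - y0) < \<zeta>" "\<bar>s - v x0\<bar> < \<eta>"
    using est[OF p min] by auto
  have xy: "x0 \<in> S" "y0 \<in> S" "u y0 = ereal s"
    using min by (auto simp: tilted_min_def)
  have ya: "norm (y0 - a) < 2 * \<zeta>"
    using norm_triangle_ineq4[of "x0 - a" "x0 - y0"] near by simp
  have in_ball: "x0 + h \<in> ball a \<rho>" "y0 + h \<in> ball a \<rho>" if "norm h < \<rho> / 4" for h
    using norm_triangle_ineq[of "x0 - a" h] norm_triangle_ineq[of "y0 - a" h] near ya \<zeta> that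
    by (auto simp: dist_norm norm_minus_commute algebra_simps)
  have "(g has_derivative B) (at x0)"
  proof (rule has_derivative_transform_within_open[OF B, of "ball a \<rho>"])
    show "x0 \<in> ball a \<rho>"
      using in_ball(1)[of 0] \<open>0 < \<rho>\<close> by simp
    show "g (cp x) = g x" if "x \<in> ball a \<rho>" for x
      using that closest_point_self[of x S] by (simp add: cp_def S_def)
  qed simp
  then have exp: "\<exists>d>0. \<forall>h. norm h < d \<longrightarrow> \<bar>v (x0 + h) - v x0 - g x0 \<bullet> h - (h \<bullet> B h) / 2\<bar> \<le> e * (norm h)\<^sup>2"
    if "0 < e" for e
  proof (rule second_order_expansion[of "\<rho> / 4", rotated 2])
    fix x
    assume "x \<in> ball x0 (\<rho> / 4)"
    then have "x \<in> ball a \<rho>"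
      using in_ball(1)[of "x - x0"] by (simp add: dist_norm norm_minus_commute)
    then show "(v has_derivative (\<lambda>h. g x \<bullet> h)) (at x)"
      using dv by simp
  qed (use \<open>0 < \<rho>\<close> that in auto)
  \<comment> \<open>The slope of \<open>v\<close> at \<open>x0\<close>, corrected by the penalty
    around \<open>a\<close> and by the tilt; both corrections together stay below
    \<open>\<eta>\<close>.\<close>
  define q where "q = g x0 - (2 * \<tau>) *\<^sub>R (x0 - a) + p"
  have "\<exists>d>0. \<forall>h. norm h < d \<longrightarrow> ereal (s + q \<bullet> h + (h \<bullet> B h) / 2 - \<eta> * (norm h)\<^sup>2) \<le> u (y0 + h)"
  proof -
    obtain d where d: "d > 0" "\<And>h. norm h < d \<Longrightarrow>
        \<bar>v (x0 + h) - v x0 - g x0 \<bullet> h - (h \<bullet> B h) / 2\<bar> \<le> \<eta> / 4 * (norm h)\<^sup>2"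
      using exp[of "\<eta> / 4"] \<open>0 < \<eta>\<close> by auto
    have "ereal (s + q \<bullet> h + (h \<bullet> B h) / 2 - \<eta> * (norm h)\<^sup>2) \<le> u (y0 + h)" if h: "norm h < min d (\<rho> / 4)" for h
    proof -
      have "x0 + h \<in> S" "y0 + h \<in> S"
        using in_ball[of h] h by (auto simp: S_def)
      then have "ereal (s + c x0 y0 - c (x0 + h) (y0 + h) - p \<bullet> (x0 - (x0 + h))) \<le> u (y0 + h)"
        using min unfolding tilted_min_def by blast
      moreover have "s + q \<bullet> h + (h \<bullet> B h) / 2 - \<eta> * (norm h)\<^sup>2
          \<le> s + c x0 y0 - c (x0 + h) (y0 + h) - p \<bullet> (x0 - (x0 + h))"
      proof -
        have "(norm (x0 + h - a))\<^sup>2 = (norm (x0 - a))\<^sup>2 + 2 * ((x0 - a) \<bullet> h) + (norm h)\<^sup>2"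
          by (simp add: power2_norm_eq_inner inner_diff_left inner_diff_right inner_add_left inner_add_right inner_commute)
        then have sq: "\<tau> * (norm (x0 + h - a))\<^sup>2 = \<tau> * (norm (x0 - a))\<^sup>2 + \<tau> * (2 * ((x0 - a) \<bullet> h)) + \<tau> * (norm h)\<^sup>2"
          by (simp only: distrib_left)
        have "c x0 y0 - c (x0 + h) (y0 + h) = v (x0 + h) - v x0 - \<tau> * (2 * ((x0 - a) \<bullet> h)) - \<tau> * (norm h)\<^sup>2"
          unfolding c_def sq by simp
        moreover have "q \<bullet> h = g x0 \<bullet> h - \<tau> * (2 * ((x0 - a) \<bullet> h)) + p \<bullet> h"
          by (simp add: q_def inner_add_left inner_diff_left)
        moreover have "- (\<eta> / 4 * (norm h)\<^sup>2) \<le> v (x0 + h) - v x0 - g x0 \<bullet> h - (h \<bullet> B h) / 2"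
        proof -
          have "norm h < d"
            using h by simp
          from d(2)[OF this] show ?thesis
            by linarith
        qed
        moreover have "\<tau> * (norm h)\<^sup>2 \<le> \<eta> / 4 * (norm h)\<^sup>2"
          using \<tau>(2) by (intro mult_right_mono) auto
        moreover have "0 \<le> \<eta> * (norm h)\<^sup>2"
          using \<open>0 < \<eta>\<close> by simp
        ultimately show ?thesis
          by (simp add: inner_diff_right inner_add_right)
      qed
      ultimately show ?thesis
        by (meson ereal_less_eq(3) order_trans)
    qed
    then show ?thesis
      using d(1) \<open>0 < \<rho>\<close> by (intro exI[of _ "min d (\<rho> / 4)"]) auto
  qed
  moreover have "norm (q - g x0) < \<eta>"
  proof -
    have "norm (q - g x0) \<le> norm ((2 * \<tau>) *\<^sub>R (x0 - a)) + norm p"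
      unfolding q_def using norm_triangle_ineq4[of p "(2 * \<tau>) *\<^sub>R (x0 - a)"] by simp
    also have "norm ((2 * \<tau>) *\<^sub>R (x0 - a)) \<le> 2 * \<tau> * \<rho>"
      using near(1) \<zeta>(2) \<tau>(1) \<open>0 < \<rho>\<close> by simp
    finally show ?thesis
      using p \<tau>(3) \<sigma>(6) \<open>0 < \<eta>\<close> by linarith
  qed
  moreover have "dist x0 a < \<eta>" "dist y0 a < \<eta>"
    using near(1) ya \<zeta>(1,3) by (auto simp: dist_norm)
  moreover note lipschitz_derivative_bound[OF gPi B] has_derivative_bounded_linear[OF B] exp[OF \<open>0 < \<eta>\<close>] near(3) xy(3)
  ultimately show ?thesis
    by (intro that[of x0 y0 s q B]) blast+
qed

section \<open>Strict gain and quadratic test functions\<close>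

lemma closed_Sym: "closed (Sym :: (real^'n^'n) set)"
  unfolding Sym_def transpose_def
  by (intro closed_Collect_eq continuous_intros)

lemma Sym_add: "M \<in> Sym \<Longrightarrow> N \<in> Sym \<Longrightarrow> M + N \<in> Sym"
  and Sym_diff: "M \<in> Sym \<Longrightarrow> N \<in> Sym \<Longrightarrow> M - N \<in> Sym"
  and Sym_scaleR: "M \<in> Sym \<Longrightarrow> c *\<^sub>R M \<in> Sym"
  and Sym_mat: "mat c \<in> Sym"
  by (simp_all add: Sym_def transpose_def vec_eq_iff mat_def) 

lemma closed_jet_space: "closed (jet_space \<Omega>)"
  unfolding jet_space_def by (intro closed_Times closed_Sym closed_closure closed_UNIV)

lemma closure_subset_jet_space:
  assumes "openin (top_of_set (jet_space \<Omega>)) U"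
  shows "closure U \<subseteq> jet_space \<Omega>"
  using assms closure_minimal[OF _ closed_jet_space] openin_imp_subset by blast

text \<open>A point of the closure outside the relatively open \<open>U\<close> lies on its relative
  boundary, where \<open>F < 1\<close>. This is what makes the bounded jets with
  \<open>F \<ge> 1\<close> a compact subset of \<open>U\<close>, to which (F3) and (F4) can be
  applied.\<close>

lemma superlevel_subset:
  assumes U: "openin (top_of_set (jet_space \<Omega>)) U" and F2: "boundary_below_one \<Omega> F U"
    and j: "j \<in> closure U" "1 \<le> F j"
  shows "j \<in> U"
proof (rule ccontr)
  assume "j \<notin> U"
  have sub: "U \<subseteq> jet_space \<Omega>"
    using U openin_imp_subset by blast
  have jj: "j \<in> jet_space \<Omega>"
    using j closure_subset_jet_space[OF U] by blast
  have "j \<in> top_of_set (jet_space \<Omega>) frontier_of U"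
    using jj j(1) \<open>j \<notin> U\<close> sub U
    by (simp add: frontier_of_def closure_of_subtopology interior_of_openin Int_absorb1)
  moreover obtain x s p M where "j = (x, s, p, M)"
    by (cases j) auto
  ultimately have "F j < 1"
    using F2 jj unfolding boundary_below_one_def slice_def jet_space_def by blast
  then show False
    using j(2) by simp
qed

text \<open>Adding \<open>\<epsilon>\<close> times the jet of a function with Hessian \<open>A N - P\<close> raises \<open>F\<close>: by strict ellipticity
  \<open>A N\<close> contributes a multiple of \<open>\<epsilon> A\<close>, while by the Lipschitz condition the other terms cost at
  most a multiple of \<open>\<epsilon>\<close>, independent of \<open>A\<close>. The \<open>\<eta>\<close>-neighbourhood also allows for a change of
  the base point, where \<open>F\<close> is merely continuous.\<close>

lemma strict_gain:
  fixes F :: "'n::finite jet \<Rightarrow> real"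
  assumes U: "openin (top_of_set (jet_space \<Omega>)) U" and F: "continuous_on (closure U) F"
    and F1: "elliptic F U" and F2: "boundary_below_one \<Omega> F U"
    and F3: "locally_strictly_elliptic F U" and F4: "locally_lipschitz_in_jet F U"
    and N: "N \<in> Sym" "nonneg_definite N" "N \<noteq> 0" and P: "P \<in> Sym" and "0 \<le> Q"
  shows "\<exists>A\<^sub>0. \<forall>A\<ge>A\<^sub>0. \<exists>\<epsilon>\<^sub>0>0. \<forall>\<epsilon>. 0 < \<epsilon> \<and> \<epsilon> \<le> \<epsilon>\<^sub>0 \<longrightarrow> (\<exists>\<eta>>0. \<forall>x s p M \<sigma> q j.
      (x, s, p, M) \<in> closure U \<and> 1 \<le> F (x, s, p, M) \<and> norm (x, s, p, M) \<le> R \<and>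
      \<bar>\<sigma>\<bar> \<le> \<epsilon> * Q \<and> norm q \<le> Q \<and> j \<in> jet_space \<Omega> \<and>
      dist j (x, s + \<sigma>, p + \<epsilon> *\<^sub>R q, M + \<epsilon> *\<^sub>R (A *\<^sub>R N - P)) < \<eta> \<longrightarrow> j \<in> U \<and> 1 < F j)"
proof -
  define G where "G = {j \<in> closure U. 1 \<le> F j} \<inter> cball 0 R"
  have G_iff: "j \<in> G \<longleftrightarrow> j \<in> closure U \<and> 1 \<le> F j \<and> norm j \<le> R" for j
    by (auto simp: G_def)
  have G: "compact G"
    unfolding G_def
    by (intro closed_Int_compact continuous_on_closed_Collect_le continuous_on_const F closed_closure compact_cball)
  have GU: "G \<subseteq> U"
    using superlevel_subset[OF U F2] by (auto simp: G_iff)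
  show ?thesis
  proof (cases "G = {}")
    case True
    then have "\<not> ((x, s, p, M) \<in> closure U \<and> 1 \<le> F (x, s, p, M) \<and> norm (x, s, p, M) \<le> R)" for x s p M
      using G_iff by blast
    then show ?thesis
      by (intro exI[of _ 0] allI impI exI[of _ "1::real"] conjI) auto
  next
    case False
    obtain T where T: "open T" "U = jet_space \<Omega> \<inter> T"
      using U by (auto simp: openin_open)
    obtain \<kappa> where \<kappa>: "0 < \<kappa>" "(\<Union>j\<in>G. cball j \<kappa>) \<subseteq> T"
      using compact_subset_open_imp_cball_epsilon_subset[OF G T(1)] GU T(2) by blast
    \<comment> \<open>A compact neighbourhood of \<open>G\<close> inside \<open>U\<close>, fixed
      before \<open>A\<close>. For small \<open>\<epsilon>\<close> the perturbed jets stay in it,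
      and \<open>\<delta>\<close> and \<open>C\<close> below are its constants.\<close>
    define K where "K = jet_space \<Omega> \<inter> {j. infdist j G \<le> \<kappa>}"
    have K: "compact K"
      unfolding K_def by (intro closed_Int_compact closed_jet_space compact_infdist_le False G \<kappa>(1))
    have KU: "K \<subseteq> U"
    proof
      fix j
      assume j: "j \<in> K"
      obtain i where "i \<in> G" "infdist j G = dist j i"
        using infdist_attains_inf[OF compact_imp_closed[OF G] False] by blast
      then have "j \<in> (\<Union>j\<in>G. cball j \<kappa>)"
        using j by (auto simp: K_def dist_commute)
      then have "j \<in> T"
        using \<kappa>(2) by blast
      then show "j \<in> U"
        using j T(2) by (simp add: K_def)
    qed
    have inK: "j \<in> K" if "i \<in> G" "dist j i \<le> \<kappa>" "j \<in> jet_space \<Omega>" for i j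
      using that infdist_le2 by (auto simp: K_def)
    obtain \<delta> where \<delta>: "0 < \<delta>" "\<And>x s p M N. (x, s, p, M) \<in> K \<Longrightarrow> N \<in> Sym \<Longrightarrow> nonneg_definite N \<Longrightarrow>
        \<delta> * norm N \<le> F (x, s, p, M + N) - F (x, s, p, M)"
      using F3 K KU unfolding locally_strictly_elliptic_def by meson
    obtain C where C: "0 < C" "\<And>x s p M s' p' M'. (x, s, p, M) \<in> K \<Longrightarrow> (x, s', p', M') \<in> K \<Longrightarrow>
        \<bar>F (x, s, p, M) - F (x, s', p', M')\<bar> \<le> C * (\<bar>s - s'\<bar> + norm (p - p') + norm (M - M'))"
      using F4 K KU unfolding locally_lipschitz_in_jet_def by meson
    have Fu: "uniformly_continuous_on K F"
      using KU closure_subset by (intro compact_uniformly_continuous K continuous_on_subset[OF F]) blast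
    have Npos: "0 < norm N"
      using N(3) by simp
    \<comment> \<open>The elliptic gain has to exceed the Lipschitz cost by 1. Multiplied by
      \<open>\<epsilon>\<close>, this surplus pays for the passage to \<open>j\<close>, where
      uniform continuity is used with tolerance \<open>\<epsilon>\<close>.\<close>
    define A0 where "A0 = max 0 ((C * (2 * Q + norm P) + 1) / (\<delta> * norm N))"
    have A0: "0 \<le> A" "C * (2 * Q + norm P) + 1 \<le> \<delta> * (A * norm N)" if "A0 \<le> A" for A
    proof -
      have "(C * (2 * Q + norm P) + 1) / (\<delta> * norm N) \<le> A"
        using that by (simp add: A0_def)
      then show "C * (2 * Q + norm P) + 1 \<le> \<delta> * (A * norm N)"
        using \<delta>(1) Npos by (simp add: pos_divide_le_eq mult.commute mult.left_commute)
    qed (use that in \<open>simp add: A0_def\<close>)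
    show ?thesis
    proof (rule exI[of _ A0], intro allI impI)
      fix A
      assume "A0 \<le> A"
      note A = A0[OF this]
      \<comment> \<open>\<open>W\<close> bounds the displacement of the jet per unit of
        \<open>\<epsilon>\<close>; the summand 1 makes it positive.\<close>
      define W where "W = 2 * Q + A * norm N + norm P + 1"
      have W: "0 < W"
        using A(1) \<open>0 \<le> Q\<close> by (simp add: W_def add_nonneg_pos)
      show "\<exists>\<epsilon>\<^sub>0>0. \<forall>\<epsilon>. 0 < \<epsilon> \<and> \<epsilon> \<le> \<epsilon>\<^sub>0 \<longrightarrow> (\<exists>\<eta>>0. \<forall>x s p M \<sigma> q j.
        (x, s, p, M) \<in> closure U \<and> 1 \<le> F (x, s, p, M) \<and> norm (x, s, p, M) \<le> R \<and>
        \<bar>\<sigma>\<bar> \<le> \<epsilon> * Q \<and> norm q \<le> Q \<and> j \<in> jet_space \<Omega> \<and>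
        dist j (x, s + \<sigma>, p + \<epsilon> *\<^sub>R q, M + \<epsilon> *\<^sub>R (A *\<^sub>R N - P)) < \<eta> \<longrightarrow> j \<in> U \<and> 1 < F j)"
      proof (rule exI[of _ "\<kappa> / (2 * W)"], intro conjI allI impI)
        show "0 < \<kappa> / (2 * W)"
          using \<kappa>(1) W by simp
        fix \<epsilon>
        assume \<epsilon>: "0 < \<epsilon> \<and> \<epsilon> \<le> \<kappa> / (2 * W)"
        then have \<epsilon>W: "\<epsilon> * W \<le> \<kappa> / 2"
          using W by (simp add: field_simps)
        obtain \<eta>1 where \<eta>1: "0 < \<eta>1" "\<And>i j. i \<in> K \<Longrightarrow> j \<in> K \<Longrightarrow> dist j i < \<eta>1 \<Longrightarrow> dist (F j) (F i) < \<epsilon>"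
          using Fu \<epsilon> unfolding uniformly_continuous_on_def by metis
        show "\<exists>\<eta>>0. \<forall>x s p M \<sigma> q j.
          (x, s, p, M) \<in> closure U \<and> 1 \<le> F (x, s, p, M) \<and> norm (x, s, p, M) \<le> R \<and>
          \<bar>\<sigma>\<bar> \<le> \<epsilon> * Q \<and> norm q \<le> Q \<and> j \<in> jet_space \<Omega> \<and>
          dist j (x, s + \<sigma>, p + \<epsilon> *\<^sub>R q, M + \<epsilon> *\<^sub>R (A *\<^sub>R N - P)) < \<eta> \<longrightarrow> j \<in> U \<and> 1 < F j"
        proof (rule exI[of _ "min \<eta>1 (\<kappa> / 2)"], rule conjI, goal_cases)
          case 1
          show ?case
            using \<eta>1(1) \<kappa>(1) by simp
        next
          case 2
          show ?case
          proof (intro allI impI)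
            fix x :: "real^'n" and s :: real and p :: "real^'n" and M :: "real^'n^'n" and \<sigma> :: real
              and q :: "real^'n" and j :: "'n jet"
            \<comment> \<open>\<open>?jA\<close> adds only the elliptic term, \<open>?jB\<close> the
              remaining terms at the same base point, as (F4) demands, and \<open>j\<close> may
              change the base point. The three passages use (F3), (F4) and uniform
              continuity.\<close>
            let ?jA = "(x, s, p, M + \<epsilon> *\<^sub>R A *\<^sub>R N)"
            let ?jB = "(x, s + \<sigma>, p + \<epsilon> *\<^sub>R q, M + \<epsilon> *\<^sub>R (A *\<^sub>R N - P))"
            assume *: "(x, s, p, M) \<in> closure U \<and> 1 \<le> F (x, s, p, M) \<and> norm (x, s, p, M) \<le> R \<and>
              \<bar>\<sigma>\<bar> \<le> \<epsilon> * Q \<and> norm q \<le> Q \<and> j \<in> jet_space \<Omega> \<and> dist j ?jB < min \<eta>1 (\<kappa> / 2)"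
            then have jG: "(x, s, p, M) \<in> G"
              by (simp add: G_iff)
            then have js: "(x, s, p, M) \<in> jet_space \<Omega>" and jK: "(x, s, p, M) \<in> K"
              using GU KU T(2) inK[OF jG] \<kappa>(1) by auto
            have nn: "norm (a, b, c, d) \<le> norm a + norm b + norm c + norm d"
              for a :: "real^'n" and b :: real and c :: "real^'n" and d :: "real^'n^'n"
              using norm_Pair_le[of a "(b, c, d)"] norm_Pair_le[of b "(c, d)"] norm_Pair_le[of c d] by linarith
            have sumP: "norm (\<epsilon> *\<^sub>R q) \<le> \<epsilon> * Q" "norm (\<epsilon> *\<^sub>R (A *\<^sub>R N - P)) \<le> \<epsilon> * (A * norm N + norm P)"
              using * \<epsilon> A(1) norm_triangle_ineq4[of "A *\<^sub>R N" P] by (auto intro!: mult_left_mono)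
            have jsA: "?jA \<in> jet_space \<Omega>" and jsB: "?jB \<in> jet_space \<Omega>"
              using js N(1) P by (auto simp: jet_space_def intro!: Sym_add Sym_diff Sym_scaleR)
            have "dist ?jA (x, s, p, M) \<le> \<epsilon> * (A * norm N)"
              using \<epsilon> A(1) by (simp add: dist_Pair_Pair dist_norm)
            also have "\<dots> \<le> \<epsilon> * W"
              using \<epsilon> A(1) \<open>0 \<le> Q\<close> by (intro mult_left_mono) (auto simp: W_def)
            finally have jAK: "?jA \<in> K"
              using \<epsilon>W \<kappa>(1) by (intro inK[OF jG _ jsA]) simp
            have "dist ?jB (x, s, p, M) \<le> norm (0 :: real^'n) + norm \<sigma> + norm (\<epsilon> *\<^sub>R q) + norm (\<epsilon> *\<^sub>R (A *\<^sub>R N - P))"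
              using nn[of 0 \<sigma> "\<epsilon> *\<^sub>R q" "\<epsilon> *\<^sub>R (A *\<^sub>R N - P)"] by (simp add: dist_norm)
            also have "\<dots> \<le> \<epsilon> * Q + \<epsilon> * Q + \<epsilon> * (A * norm N + norm P)"
              using * by (intro add_mono sumP) auto
            also have "\<dots> \<le> \<epsilon> * W"
              using \<epsilon> by (simp add: W_def algebra_simps)
            finally have dB: "dist ?jB (x, s, p, M) \<le> \<kappa> / 2"
              using \<epsilon>W by simp
            then have jBK: "?jB \<in> K"
              using \<kappa>(1) by (intro inK[OF jG _ jsB]) simp
            have "dist j (x, s, p, M) \<le> \<kappa>"
              using dB * dist_triangle[of j "(x, s, p, M)" ?jB] by simp
            then have jK': "j \<in> K"
              using inK[OF jG] * by blast
            have "\<epsilon> *\<^sub>R A *\<^sub>R N \<in> Sym" "nonneg_definite (\<epsilon> *\<^sub>R A *\<^sub>R N)"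
              using N \<epsilon> A(1) by (auto simp: nonneg_definite_def scaleR_matrix_vector_assoc[symmetric] intro!: Sym_scaleR)
            from \<delta>(2)[OF jK this] have "\<epsilon> * (\<delta> * (A * norm N)) \<le> F ?jA - F (x, s, p, M)"
              using \<epsilon> A(1) by (simp add: mult.left_commute mult.assoc)
            moreover have "\<epsilon> * (C * (2 * Q + norm P) + 1) \<le> \<epsilon> * (\<delta> * (A * norm N))"
              using A(2) \<epsilon> by (intro mult_left_mono) auto
            moreover have "\<bar>F ?jA - F ?jB\<bar> \<le> \<epsilon> * (C * (2 * Q + norm P))"
            proof -
              have eq: "M + \<epsilon> *\<^sub>R A *\<^sub>R N - (M + \<epsilon> *\<^sub>R (A *\<^sub>R N - P)) = \<epsilon> *\<^sub>R P"
                by (simp add: scaleR_diff_right)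
              have "\<bar>F ?jA - F ?jB\<bar> \<le> C * (\<bar>s - (s + \<sigma>)\<bar> + norm (p - (p + \<epsilon> *\<^sub>R q)) + norm (\<epsilon> *\<^sub>R P))"
                using C(2)[OF jAK jBK] unfolding eq .
              also have "\<dots> \<le> C * (\<epsilon> * Q + \<epsilon> * Q + \<epsilon> * norm P)"
                using C(1) * sumP(1) \<epsilon> by (intro mult_left_mono add_mono) auto
              finally show ?thesis
                by (simp add: algebra_simps)
            qed
            moreover have "dist (F j) (F ?jB) < \<epsilon>"
              using \<eta>1(2)[OF jBK jK'] * by simp
            ultimately have "1 < F j"
              using * by (simp add: dist_real_def distrib_left abs_le_iff abs_less_iff)
            then show "j \<in> U \<and> 1 < F j"
              using jK' KU by blast
          qed
        qed
      qed
    qed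
  qed
qed

section \<open>Quadratic test functions and symmetric second-order data\<close>

definition quadratic :: "real \<Rightarrow> real^'n \<Rightarrow> real^'n^'n \<Rightarrow> real^'n \<Rightarrow> real^'n \<Rightarrow> real" where
  "quadratic s p M y x = s + p \<bullet> (x - y) + ((x - y) \<bullet> (M *v (x - y))) / 2"

lemma grad_eqI:
  assumes "(f has_derivative (\<lambda>h. w \<bullet> h)) (at x)"
  shows "grad f x = w"
  unfolding grad_def frechet_derivative_at[OF assms, symmetric]
  by (simp add: vec_eq_iff inner_axis)

lemma Sym_inner:
  assumes "M \<in> Sym"
  shows "x \<bullet> (M *v y) = (M *v x) \<bullet> y"
proof -
  have "M *v x = x v* M"
    using assms unfolding Sym_def by (metis (mono_tags) mem_Collect_eq transpose_matrix_vector)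
  then show ?thesis
    using dot_lmul_matrix[of x M y] by simp
qed

lemma has_derivative_matrix_vector_mult:
  fixes M :: "real^'n^'m"
  shows "((\<lambda>x. p + M *v (x - y)) has_derivative (\<lambda>h. M *v h)) (at x)"
  by (rule derivative_eq_intros bounded_linear.has_derivative[OF matrix_vector_mul_bounded_linear] refl | simp)+

lemma quadratic_has_derivative:
  assumes "M \<in> Sym"
  shows "(quadratic s p M y has_derivative (\<lambda>h. (p + M *v (x - y)) \<bullet> h)) (at x)"
proof -
  have d: "((\<lambda>x. M *v (x - y)) has_derivative (\<lambda>h. M *v h)) (at x)"
    using has_derivative_matrix_vector_mult[of 0 M y x] by simp
  have "((\<lambda>x. s + p \<bullet> (x - y) + ((x - y) \<bullet> (M *v (x - y))) / 2) has_derivative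
      (\<lambda>h. p \<bullet> h + ((x - y) \<bullet> (M *v h) + h \<bullet> (M *v (x - y))) / 2)) (at x)"
    by (rule derivative_eq_intros d refl | simp)+
  moreover have "(\<lambda>h. p \<bullet> h + ((x - y) \<bullet> (M *v h) + h \<bullet> (M *v (x - y))) / 2) = (\<lambda>h. (p + M *v (x - y)) \<bullet> h)"
    using Sym_inner[OF assms, of "x - y"] inner_commute[of _ "M *v (x - y)"] by (auto simp: inner_add_left)
  ultimately show ?thesis
    unfolding quadratic_def by metis
qed

lemma grad_quadratic:
  assumes "M \<in> Sym"
  shows "grad (quadratic s p M y) = (\<lambda>x. p + M *v (x - y))"
  using grad_eqI[OF quadratic_has_derivative[OF assms]] by blast

lemma hess_quadratic:
  fixes M :: "real^'n^'n"
  assumes "M \<in> Sym"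
  shows "hess (quadratic s p M y) x = M"
  unfolding hess_def jacobian_def grad_quadratic[OF assms]
    frechet_derivative_at[OF has_derivative_matrix_vector_mult, symmetric]
  by (rule matrix_of_matrix_vector_mul)

lemma C2_on_quadratic:
  fixes M :: "real^'n^'n"
  assumes "M \<in> Sym"
  shows "C2_on S (quadratic s p M y)"
proof -
  have "hess (quadratic s p M y) = (\<lambda>x. M)"
    using hess_quadratic[OF assms] by blast
  then show ?thesis
    unfolding C2_on_def grad_quadratic[OF assms]
    by (intro conjI ballI differentiableI[OF quadratic_has_derivative[OF assms]]
        differentiableI[OF has_derivative_matrix_vector_mult]) simp
qed

lemma jet2_quadratic:
  fixes M :: "real^'n^'n"
  assumes "M \<in> Sym"
  shows "jet2 (quadratic s p M y) y = (y, s, p, M)"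
  by (simp add: jet2_def grad_quadratic[OF assms] hess_quadratic[OF assms] quadratic_def)

text \<open>A quadratic is C^2 on all of \<open>\<Omega>\<close>, so a bound on an arbitrarily small
  ball already makes it a test function.\<close>

lemma subsolution_test_quadratic:
  assumes "viscosity_subsolution F U \<Omega> \<psi>" "y \<in> \<Omega>" "M \<in> Sym" "\<psi> y = ereal s"
    and "\<exists>d>0. \<forall>h. norm h < d \<longrightarrow> \<psi> (y + h) \<le> ereal (s + p \<bullet> h + (h \<bullet> (M *v h)) / 2)"
  shows "(y, s, p, M) \<in> closure U" "1 \<le> F (y, s, p, M)"
proof -
  obtain d where d: "d > 0" "\<And>h. norm h < d \<Longrightarrow> \<psi> (y + h) \<le> ereal (s + p \<bullet> h + (h \<bullet> (M *v h)) / 2)"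
    using assms(5) by blast
  have "\<forall>\<^sub>F x in nhds y. \<psi> x - ereal (quadratic s p M y x) \<le> 0"
    unfolding eventually_nhds_metric
  proof (intro exI[of _ d] conjI allI impI d(1))
    fix x
    assume "dist x y < d"
    then have "\<psi> x \<le> ereal (quadratic s p M y x)"
      using d(2)[of "x - y"] by (simp add: dist_norm quadratic_def)
    then show "\<psi> x - ereal (quadratic s p M y x) \<le> 0"
      by (cases "\<psi> x") auto
  qed
  moreover have "\<psi> y - ereal (quadratic s p M y y) = 0"
    using assms(4) by (simp add: quadratic_def)
  ultimately have "jet2 (quadratic s p M y) y \<in> closure U \<and> 1 \<le> F (jet2 (quadratic s p M y) y)"
    using assms(1,2) C2_on_quadratic[OF assms(3)] unfolding viscosity_subsolution_def by blast
  then show "(y, s, p, M) \<in> closure U" "1 \<le> F (y, s, p, M)"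
    by (auto simp: jet2_quadratic[OF assms(3)])
qed

lemma supersolution_test_quadratic:
  assumes "viscosity_supersolution F U \<Omega> \<psi>" "y \<in> \<Omega>" "M \<in> Sym" "\<psi> y = ereal s"
    and "\<exists>d>0. \<forall>h. norm h < d \<longrightarrow> ereal (s + p \<bullet> h + (h \<bullet> (M *v h)) / 2) \<le> \<psi> (y + h)"
  shows "(y, s, p, M) \<notin> closure U \<or> F (y, s, p, M) \<le> 1"
proof -
  obtain d where d: "d > 0" "\<And>h. norm h < d \<Longrightarrow> ereal (s + p \<bullet> h + (h \<bullet> (M *v h)) / 2) \<le> \<psi> (y + h)"
    using assms(5) by blast
  have "\<forall>\<^sub>F x in nhds y. 0 \<le> \<psi> x - ereal (quadratic s p M y x)"
    unfolding eventually_nhds_metric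
  proof (intro exI[of _ d] conjI allI impI d(1))
    fix x
    assume "dist x y < d"
    then have "ereal (quadratic s p M y x) \<le> \<psi> x"
      using d(2)[of "x - y"] by (simp add: dist_norm quadratic_def)
    then show "0 \<le> \<psi> x - ereal (quadratic s p M y x)"
      by (cases "\<psi> x") auto
  qed
  moreover have "\<psi> y - ereal (quadratic s p M y y) = 0"
    using assms(4) by (simp add: quadratic_def)
  ultimately have "jet2 (quadratic s p M y) y \<notin> closure U \<or> F (jet2 (quadratic s p M y) y) \<le> 1"
    using assms(1,2) C2_on_quadratic[OF assms(3)] unfolding viscosity_supersolution_def by blast
  then show ?thesis
    by (simp add: jet2_quadratic[OF assms(3)])
qed

text \<open>The derivative of the gradient at a point found by Rademacher's theorem is not known to
  be symmetric, while a jet requires a matrix in \<open>Sym\<close>. Symmetrising preserves the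
  quadratic form, and the entries remain bounded by \<open>L\<close>.\<close>

lemma symmetric_matrix_of_quadratic_form:
  fixes B :: "real^'n \<Rightarrow> real^'n"
  assumes "bounded_linear B" and bound: "\<And>h. norm (B h) \<le> L * norm h"
  obtains M where "M \<in> Sym" "\<And>h. h \<bullet> (M *v h) = h \<bullet> B h" "norm M \<le> real CARD('n) * (real CARD('n) * L)"
proof -
  define A where "A = matrix B"
  have AB: "A *v h = B h" for h
    using matrix_works[of B h] assms(1) unfolding A_def by (simp add: bounded_linear.linear)
  define M where "M = (1 / 2) *\<^sub>R (A + transpose A)"
  have "M \<in> Sym"
    by (simp add: M_def Sym_def transpose_def vec_eq_iff)
  moreover have "h \<bullet> (M *v h) = h \<bullet> B h" for h
  proof -
    have "h \<bullet> (transpose A *v h) = h \<bullet> (A *v h)"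
      using dot_lmul_matrix[of h A h] by (simp add: transpose_matrix_vector inner_commute)
    then show ?thesis
      by (simp add: M_def scaleR_matrix_vector_assoc[symmetric] matrix_vector_mult_add_rdistrib inner_add_right AB)
  qed
  moreover have "norm M \<le> real CARD('n) * (real CARD('n) * L)"
  proof -
    have entry: "\<bar>A $ i $ j\<bar> \<le> L" for i j
    proof -
      have "A $ i $ j = B (axis j 1) $ i"
        by (simp add: A_def matrix_def)
      also have "\<bar>\<dots>\<bar> \<le> norm (B (axis j 1))"
        by (rule component_le_norm_cart)
      also have "\<dots> \<le> L"
        using bound[of "axis j 1"] by simp
      finally show ?thesis .
    qed
    have "\<bar>M $ i $ j\<bar> \<le> L" for i j
      using entry[of i j] entry[of j i] by (simp add: M_def transpose_def abs_le_iff)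
    then have "norm (M $ i) \<le> real CARD('n) * L" for i
      using norm_le_l1_cart[of "M $ i"] sum_bounded_above[of UNIV "\<lambda>j. \<bar>M $ i $ j\<bar>" L] by simp
    then have "(\<Sum>i\<in>UNIV. norm (M $ i)) \<le> real CARD('n) * (real CARD('n) * L)"
      using sum_bounded_above[of UNIV "\<lambda>i. norm (M $ i)" "real CARD('n) * L"] by simp
    then show ?thesis
      using L2_set_le_sum[of UNIV "\<lambda>i. norm (M $ i)"] by (simp add: norm_vec_def)
  qed
  ultimately show ?thesis
    using that by blast
qed

section \<open>The barrier argument\<close>

lemma lsc_on_subset:
  assumes "lsc_on S f" "T \<subseteq> S"
  shows "lsc_on T f"
  unfolding lsc_on_def
proof
  fix x
  assume "x \<in> T"
  show "f x \<le> Liminf (at x within T) f"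
    unfolding le_Liminf_iff
  proof (intro allI impI)
    fix y
    assume "y < f x"
    then have "\<forall>\<^sub>F z in at x within S. y < f z"
      using lsc_on_eventually_less assms \<open>x \<in> T\<close> by blast
    then show "\<forall>\<^sub>F z in at x within T. y < f z"
      using at_le[OF assms(2)] filter_leD by blast
  qed
qed

section \<open>The quadratic barrier and the comparison on the thin region\<close>

definition outer :: "real^'n \<Rightarrow> real^'n^'n" where
  "outer e = (\<chi> i j. e $ i * e $ j)"

lemma outer_mult: "outer e *v h = (e \<bullet> h) *\<^sub>R e"
  by (simp add: outer_def matrix_vector_mult_def vec_eq_iff inner_vec_def sum_distrib_left mult_ac)

lemma Sym_outer: "outer e \<in> Sym"
  by (simp add: outer_def Sym_def transpose_def vec_eq_iff mult.commute)

lemma nonneg_definite_outer: "nonneg_definite (outer e)"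
  by (simp add: nonneg_definite_def outer_mult inner_commute)

lemma scaleR_mat_mult: "(c *\<^sub>R mat 1) *v h = c *\<^sub>R (h :: real^'n)"
  by (simp add: scaleR_matrix_vector_assoc[symmetric])

text \<open>Since the barrier is quadratic, adding it to a quadratic test function gives a quadratic test
  function again.\<close>

definition barrier :: "real \<Rightarrow> real \<Rightarrow> real^'n \<Rightarrow> real^'n \<Rightarrow> real" where
  "barrier A b e z = z \<bullet> e + A / 2 * (z \<bullet> e)\<^sup>2 - b / 2 * (z \<bullet> z)"

definition barrier_grad :: "real \<Rightarrow> real \<Rightarrow> real^'n \<Rightarrow> real^'n \<Rightarrow> real^'n" where
  "barrier_grad A b e z = (1 + A * (z \<bullet> e)) *\<^sub>R e - b *\<^sub>R z"

definition barrier_hess :: "real \<Rightarrow> real \<Rightarrow> real^'n \<Rightarrow> real^'n^'n" where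
  "barrier_hess A b e = A *\<^sub>R outer e - b *\<^sub>R mat 1"

lemma barrier_expansion:
  "barrier A b e (z + h) = barrier A b e z + barrier_grad A b e z \<bullet> h + (h \<bullet> (barrier_hess A b e *v h)) / 2"
  by (simp add: barrier_def barrier_grad_def barrier_hess_def matrix_vector_mult_diff_rdistrib
      scaleR_mat_mult scaleR_matrix_vector_assoc[symmetric] outer_mult inner_add_left inner_diff_left
      inner_add_right inner_diff_right inner_commute power2_eq_square field_simps)

lemma barrier_has_derivative:
  "((\<lambda>x. barrier A b e (x - a)) has_derivative (\<lambda>h. barrier_grad A b e (x - a) \<bullet> h)) (at x)"
  unfolding barrier_def barrier_grad_def power2_eq_square
  by (rule derivative_eq_intros refl)+
    (auto simp: inner_diff_left inner_diff_right inner_add_left inner_commute algebra_simps)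

lemma barrier_grad_lipschitz:
  assumes "norm e = 1" "0 \<le> A" "0 \<le> b"
  shows "norm (barrier_grad A b e z - barrier_grad A b e w) \<le> (A + b) * norm (z - w)"
proof -
  have "barrier_grad A b e z - barrier_grad A b e w = (A * ((z - w) \<bullet> e)) *\<^sub>R e - b *\<^sub>R (z - w)"
    by (simp add: barrier_grad_def inner_diff_left algebra_simps)
  also have "norm \<dots> \<le> norm ((A * ((z - w) \<bullet> e)) *\<^sub>R e) + norm (b *\<^sub>R (z - w))"
    by (rule norm_triangle_ineq4)
  also have "\<dots> \<le> A * norm (z - w) + b * norm (z - w)"
    using assms Cauchy_Schwarz_ineq2[of "z - w" e] by (simp add: abs_mult mult_left_mono)
  finally show ?thesis
    by (simp add: distrib_right)
qed

text \<open>The outcome of the doubling argument for \<open>f + \<epsilon> barrier\<close> and \<open>u\<close>. It is used with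
  \<open>(f, u) = (\<psi>\<^sub>1, \<psi>\<^sub>2)\<close> and with \<open>(f, u) = (- \<psi>\<^sub>2, - \<psi>\<^sub>1)\<close>.\<close>

definition touching ::
    "(real^'n) set \<Rightarrow> (real^'n \<Rightarrow> real) \<Rightarrow> (real^'n \<Rightarrow> real^'n) \<Rightarrow> (real^'n \<Rightarrow> ereal) \<Rightarrow> real^'n^'n \<Rightarrow>
      real \<Rightarrow> real \<Rightarrow> real \<Rightarrow> real \<Rightarrow> bool" where
  "touching X f g u H Q K \<epsilon> \<eta> \<longleftrightarrow> (\<exists>x y s q M k.
     x \<in> X \<and> y \<in> X \<and> dist x y < \<eta> \<and> u y = ereal s \<and>
     \<bar>s - f x\<bar> \<le> \<epsilon> * Q \<and> norm k \<le> Q \<and> norm (q - (g x + \<epsilon> *\<^sub>R k)) < \<eta> \<and> M \<in> Sym \<and> norm M \<le> K \<and>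
     (\<exists>d>0. \<forall>h. norm h < d \<longrightarrow>
        f (x + h) \<le> f x + g x \<bullet> h + (h \<bullet> ((M + \<eta> *\<^sub>R mat 1 - \<epsilon> *\<^sub>R H) *v h)) / 2) \<and>
     (\<exists>d>0. \<forall>h. norm h < d \<longrightarrow>
        ereal (s + q \<bullet> h + (h \<bullet> ((M - \<eta> *\<^sub>R mat 1) *v h)) / 2) \<le> u (y + h)))"

lemma touchingI:
  assumes "x \<in> X" "y \<in> X" "dist x y < \<eta>" "u y = ereal s"
    "\<bar>s - f x\<bar> \<le> \<epsilon> * Q" "norm k \<le> Q" "norm (q - (g x + \<epsilon> *\<^sub>R k)) < \<eta>" "M \<in> Sym" "norm M \<le> K"
    "\<exists>d>0. \<forall>h. norm h < d \<longrightarrow>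
       f (x + h) \<le> f x + g x \<bullet> h + (h \<bullet> ((M + \<eta> *\<^sub>R mat 1 - \<epsilon> *\<^sub>R H) *v h)) / 2"
    "\<exists>d>0. \<forall>h. norm h < d \<longrightarrow> ereal (s + q \<bullet> h + (h \<bullet> ((M - \<eta> *\<^sub>R mat 1) *v h)) / 2) \<le> u (y + h)"
  shows "touching X f g u H Q K \<epsilon> \<eta>"
  unfolding touching_def
  by (rule exI[of _ x], rule exI[of _ y], rule exI[of _ s], rule exI[of _ q], rule exI[of _ M], rule exI[of _ k])
    (intro conjI assms)

text \<open>If \<open>f\<close> plus \<open>\<epsilon>\<close> times the barrier exceeded
  \<open>u\<close> somewhere on \<open>D\<close>, then lowering it by the largest excess would make
  it touch \<open>u\<close> from below in the interior of \<open>D\<close>, and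
  \<open>contact_points\<close> would give a touching configuration. \<open>Q\<close> and the matrix
  bound do not involve \<open>A\<close>, because \<open>A\<^sub>0\<close> may depend on
  them.\<close>

lemma hopf_of_no_touching:
  fixes f :: "real^'n \<Rightarrow> real" and u :: "real^'n \<Rightarrow> ereal"
  assumes \<Omega>: "open \<Omega>" and e: "norm e = 1" and r: "0 < r" and C: "0 \<le> C" and b: "3 * C < b"
    and inside: "\<And>x. x \<in> ball a r \<Longrightarrow> C * (norm (x - a))\<^sup>2 < (x - a) \<bullet> e \<Longrightarrow> x \<in> \<Omega>"
    and df: "\<And>x. x \<in> \<Omega> \<Longrightarrow> (f has_derivative (\<lambda>h. g x \<bullet> h)) (at x)"
    and cf: "continuous_on (\<Omega> \<union> {a}) f" and lip: "L-lipschitz_on (\<Omega> \<inter> ball a r) g"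
    and lsc: "lsc_on (\<Omega> \<union> {a}) u"
    and ua: "u a = ereal (f a)" and fu: "\<And>x. x \<in> \<Omega> \<Longrightarrow> ereal (f x) < u x"
    and Q: "4 + b * r \<le> Q"
    and no_touch: "\<And>A. A\<^sub>0 \<le> A \<Longrightarrow> \<exists>\<epsilon>\<^sub>0>0. \<forall>\<epsilon>. 0 < \<epsilon> \<and> \<epsilon> \<le> \<epsilon>\<^sub>0 \<longrightarrow> 
      (\<exists>\<eta>>0. \<not> touching (\<Omega> \<inter> ball a r) f g u (barrier_hess A b e) Q (real CARD('n) * (real CARD('n) * (L + 1))) \<epsilon> \<eta>)"
  shows "\<exists>\<epsilon>>0. \<exists>t>0. \<forall>s. 0 < s \<and> s \<le> t \<longrightarrow>
    a + s *\<^sub>R e \<in> \<Omega> \<and> ereal (f (a + s *\<^sub>R e) + \<epsilon> * s) \<le> u (a + s *\<^sub>R e)"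
proof -
  have b0: "0 < b"
    using b C by simp
  \<comment> \<open>\<open>b \<le> A\<close> makes the barrier at least \<open>s\<close> at
    \<open>a + s *\<^sub>R e\<close>; the bound involving \<open>r\<close> keeps \<open>D\<close>
    inside the ball of radius \<open>r\<close>.\<close>
  define A where "A = max (max A\<^sub>0 1) (max b (3 / (b * r\<^sup>2) + 1))"
  have A: "A\<^sub>0 \<le> A" "1 \<le> A" "b \<le> A" "3 / (b * r\<^sup>2) < A"
    by (auto simp: A_def less_max_iff_disj)
  have Ar: "3 / A < b * r\<^sup>2"
    using A(2,4) b0 r by (simp add: field_simps)
  define t0 where "t0 = 1 / A"
  have t0: "0 < t0" "t0 \<le> 1" "A * t0 = 1"
    using A(2) by (auto simp: t0_def)
  define \<beta> where "\<beta> x = barrier A b e (x - a)" for x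
  define T where "T x = (x - a) \<bullet> e" for x
  define D where "D = {x. 0 \<le> T x \<and> T x \<le> t0 \<and> 0 \<le> \<beta> x}"
  have cT: "continuous_on X T" and c\<beta>: "continuous_on X \<beta>" for X
    unfolding T_def \<beta>_def barrier_def by (intro continuous_intros)+
  have \<beta>_eq: "\<beta> x = T x + A / 2 * (T x)\<^sup>2 - b / 2 * (norm (x - a))\<^sup>2" for x
    by (simp add: \<beta>_def T_def barrier_def power2_norm_eq_inner)
  \<comment> \<open>On the thin region the convex term is at most half the linear one, whence the
    bound \<open>3 / 2\<close> on the barrier.\<close>
  have AT: "A / 2 * (T x)\<^sup>2 \<le> T x / 2" if "0 \<le> T x" "T x \<le> t0" for x
  proof -
    have "A * T x \<le> A * t0"
      using that A(2) by (intro mult_left_mono) auto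
    then have "A * T x \<le> 1"
      by (simp add: t0(3))
    then have "(A * T x) * T x \<le> 1 * T x"
      using that by (intro mult_right_mono) auto
    then show ?thesis
      by (simp add: power2_eq_square mult.assoc)
  qed
  have D: "b * (norm (x - a))\<^sup>2 \<le> 3 * T x" "norm (x - a) < r" "\<beta> x \<le> 3 / 2" "x = a \<or> (x \<in> \<Omega> \<and> 0 < T x)"
    if x: "x \<in> D" for x
  proof -
    have x': "0 \<le> T x" "T x \<le> t0" "0 \<le> \<beta> x"
      using x by (auto simp: D_def)
    show 1: "b * (norm (x - a))\<^sup>2 \<le> 3 * T x"
      using x'(3) AT[OF x'(1,2)] unfolding \<beta>_eq by simp
    also have "\<dots> \<le> 3 / A"
      using x'(2) by (simp add: t0_def)
    also note Ar
    finally have "(norm (x - a))\<^sup>2 < r\<^sup>2"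
      using mult_less_cancel_left_pos[OF b0] by blast
    then show 2: "norm (x - a) < r"
      using r by (meson less_imp_le power2_less_imp_less)
    have "0 \<le> b / 2 * (norm (x - a))\<^sup>2"
      using b0 by simp
    then show "\<beta> x \<le> 3 / 2"
      using AT[OF x'(1,2)] x'(2) t0(2) unfolding \<beta>_eq by linarith
    show "x = a \<or> (x \<in> \<Omega> \<and> 0 < T x)"
    proof (cases "x = a")
      case False
      then have n: "0 < (norm (x - a))\<^sup>2"
        by simp
      \<comment> \<open>Since \<open>3 * C < b\<close>, the points of \<open>D\<close> other than
        \<open>a\<close> lie strictly inside the paraboloid contained in
        \<open>\<Omega>\<close>.\<close>
      have "3 * C * (norm (x - a))\<^sup>2 < b * (norm (x - a))\<^sup>2"
        using b n by (rule mult_strict_right_mono)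
      then have "C * (norm (x - a))\<^sup>2 < T x"
        using 1 by linarith
      moreover have "0 \<le> C * (norm (x - a))\<^sup>2"
        using C by simp
      ultimately show ?thesis
        using inside[of x] 2 by (simp add: T_def dist_norm norm_minus_commute)
    qed simp
  qed
  have aD: "a \<in> D"
    using t0 by (simp add: D_def T_def \<beta>_def barrier_def)
  have DS: "D \<subseteq> \<Omega> \<union> {a}"
    using D(4) by blast
  have "closed D"
    unfolding D_def by (intro closed_Collect_conj closed_Collect_le cT c\<beta> continuous_on_const)
  moreover have "bounded D"
    using D(2) by (intro boundedI[of _ "norm a + r"]) (smt (verit) norm_triangle_sub)
  ultimately have Dc: "compact D"
    by (simp add: compact_eq_bounded_closed)

  \<comment> \<open>The top face \<open>T = t0\<close> of \<open>D\<close> is compact and contained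
    in \<open>\<Omega>\<close>, so \<open>u - f\<close> is bounded below there by a positive
    constant; if the face is empty, 1 serves.\<close>
  obtain c where c: "0 < c" "\<And>x. x \<in> D \<Longrightarrow> T x = t0 \<Longrightarrow> ereal (f x + c) \<le> u x"
  proof (cases "{x \<in> D. T x = t0} = {}")
    case True
    then show ?thesis
      using that[of 1] by auto
  next
    case False
    have "{x \<in> D. T x = t0} = D \<inter> {x. T x = t0}"
      by auto
    moreover have "closed {x. T x = t0}"
      by (intro closed_Collect_eq cT continuous_on_const)
    ultimately have Ec: "compact {x \<in> D. T x = t0}"
      using Dc by (simp add: compact_Int_closed)
    have ES: "{x \<in> D. T x = t0} \<subseteq> \<Omega> \<union> {a}"
      using DS by auto
    have "continuous_on ({x \<in> D. T x = t0} \<times> {x \<in> D. T x = t0}) (\<lambda>z. - f (snd z))"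
      by (intro continuous_on_minus continuous_on_compose2[OF cf] continuous_intros) (use DS in auto)
    from lsc_add_continuous_attains_inf[OF Ec False lsc_on_subset[OF lsc ES] this]
    obtain y where y: "y \<in> D" "T y = t0" "\<And>x. x \<in> D \<Longrightarrow> T x = t0 \<Longrightarrow> u y + ereal (- f y) \<le> u x + ereal (- f x)"
      by auto
    have "y \<in> \<Omega>"
      using D(4)[OF y(1)] y(2) t0(1) by (auto simp: T_def)
    then have "0 < u y + ereal (- f y)"
      using fu[of y] by (cases "u y") auto
    then obtain c where c: "0 < ereal c" "ereal c < u y + ereal (- f y)"
      using ereal_dense2 by blast
    have "ereal (f x + c) \<le> u x" if "x \<in> D" "T x = t0" for x
    proof -
      have "ereal c \<le> u x + ereal (- f x)"
        using c(2) y(3)[OF that] by (meson less_imp_le order_trans)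
      then show ?thesis
        by (cases "u x") auto
    qed
    then show ?thesis
      using c(1) that[of c] by simp
  qed

  have Q4: "4 \<le> Q"
    using Q b0 r by (smt (verit) mult_pos_pos)
  obtain \<epsilon>0 where \<epsilon>0: "0 < \<epsilon>0" "\<forall>\<epsilon>. 0 < \<epsilon> \<and> \<epsilon> \<le> \<epsilon>0 \<longrightarrow>
      (\<exists>\<eta>>0. \<not> touching (\<Omega> \<inter> ball a r) f g u (barrier_hess A b e) Q (real CARD('n) * (real CARD('n) * (L + 1))) \<epsilon> \<eta>)"
    using no_touch[OF A(1)] by blast
  \<comment> \<open>The second requirement keeps \<open>f + \<epsilon> * \<beta>\<close> below
    \<open>u\<close> on the top face, as \<open>\<beta> \<le> 3 / 2\<close>; the third limits what
    the barrier adds to the Lipschitz constant of the gradient to 1.\<close>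
  have "\<exists>\<epsilon>>0. \<forall>z\<in>{(1, \<epsilon>0), (3 / 2, c), (A + b, 1)}. fst z * \<epsilon> < snd z"
    by (rule exists_small_multiplier) (use \<epsilon>0(1) c(1) in auto)
  then obtain \<epsilon> where \<epsilon>: "0 < \<epsilon>" "\<epsilon> < \<epsilon>0" "3 / 2 * \<epsilon> < c" "(A + b) * \<epsilon> < 1"
    by auto
  obtain \<eta> where \<eta>: "0 < \<eta>" "\<not> touching (\<Omega> \<inter> ball a r) f g u (barrier_hess A b e) Q (real CARD('n) * (real CARD('n) * (L + 1))) \<epsilon> \<eta>"
    using \<epsilon>0(2) \<epsilon>(1,2) less_imp_le by blast
  define v where "v x = f x + \<epsilon> * \<beta> x" for x
  have above: "ereal (v x) \<le> u x" if "x \<in> D" for x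
  proof (rule ccontr)
    assume neg: "\<not> ereal (v x) \<le> u x"
    have "continuous_on (D \<times> D) (\<lambda>z. - v (snd z))"
      unfolding v_def
      by (intro continuous_on_minus continuous_on_add continuous_on_mult continuous_on_const
          continuous_on_compose2[OF cf] continuous_on_compose2[OF c\<beta>[of UNIV]] continuous_intros) (use DS in auto)
    from lsc_add_continuous_attains_inf[OF Dc _ lsc_on_subset[OF lsc DS] this]
    obtain x1 where x1: "x1 \<in> D" "\<And>y. y \<in> D \<Longrightarrow> u x1 + ereal (- v x1) \<le> u y + ereal (- v y)"
      using aD by auto
    have "u x + ereal (- v x) < 0"
      using neg by (cases "u x") auto
    with x1(2)[OF that] have "u x1 + ereal (- v x1) < 0"
      by (rule le_less_trans)
    moreover have "u x1 \<noteq> -\<infinity>"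
      using D(4)[OF x1(1)] ua fu by force
    ultimately obtain sx where sx: "u x1 = ereal sx" "sx < v x1"
      by (cases "u x1") auto
    define m where "m = sx - v x1"
    have m: "m < 0"
      using sx(2) by (simp add: m_def)
    have below: "ereal (v y + m) \<le> u y" if "y \<in> D" for y
      using x1(2)[OF that] sx(1) by (cases "u y") (auto simp: m_def)
    \<comment> \<open>The minimiser avoids the boundary of \<open>D\<close>: at \<open>a\<close> the
      functions \<open>u\<close> and \<open>v\<close> agree, where the barrier vanishes
      \<open>v = f < u\<close>, and on the top face the constant \<open>c\<close> excludes a
      negative difference.\<close>
    have "x1 \<noteq> a"
      using sx ua by (auto simp: v_def \<beta>_def barrier_def)
    then have x1\<Omega>: "x1 \<in> \<Omega>" "0 < T x1"
      using D(4)[OF x1(1)] by auto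
    have fsx: "f x1 < sx"
      using fu[OF x1\<Omega>(1)] sx(1) by simp
    have \<beta>x1: "0 \<le> \<beta> x1" "\<beta> x1 \<le> 3 / 2"
      using x1(1) D(3) by (auto simp: D_def)
    have \<epsilon>\<beta>: "\<epsilon> * \<beta> y \<le> \<epsilon> * (3 / 2)" "0 \<le> \<epsilon> * \<beta> y" if "y \<in> D" for y
      using D(3)[OF that] that \<epsilon>(1) by (auto intro!: mult_left_mono simp: D_def)
    have "\<beta> x1 \<noteq> 0"
      using sx(2) fsx by (auto simp: v_def)
    have "T x1 \<noteq> t0"
    proof
      assume "T x1 = t0"
      then have "f x1 + c \<le> sx"
        using c(2)[OF x1(1)] sx(1) by simp
      then show False
        using \<epsilon>\<beta>(1)[OF x1(1)] \<epsilon>(3) sx(2) by (simp add: v_def)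
    qed
    define D0 where "D0 = {x. 0 < T x \<and> T x < t0 \<and> 0 < \<beta> x}"
    have D0: "D0 \<subseteq> D" "D0 \<subseteq> \<Omega> \<inter> ball a r"
    proof -
      show "D0 \<subseteq> D"
        by (auto simp: D0_def D_def)
      then show "D0 \<subseteq> \<Omega> \<inter> ball a r"
        using D(2,4) by (fastforce simp: D0_def T_def dist_norm norm_minus_commute)
    qed
    have "open D0"
      unfolding D0_def by (intro open_Collect_conj open_Collect_less cT c\<beta> continuous_on_const)
    moreover have "x1 \<in> D0"
      using x1(1) x1\<Omega> \<open>T x1 \<noteq> t0\<close> \<open>\<beta> x1 \<noteq> 0\<close> by (auto simp: D0_def D_def)
    ultimately obtain \<rho> where \<rho>: "0 < \<rho>" "cball x1 \<rho> \<subseteq> D0"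
      using open_contains_cball by blast
    define G where "G x = g x + \<epsilon> *\<^sub>R barrier_grad A b e (x - a)" for x
    \<comment> \<open>Half of \<open>\<eta>\<close>, because matrices enter the test functions with
      the factor 1/2; \<open>\<epsilon>\<close> limits the error in the value, and
      \<open>\<rho>\<close> keeps both contact points in the ball.\<close>
    define \<eta>' where "\<eta>' = min (\<eta> / 2) (min \<epsilon> \<rho>)"
    have \<eta>': "0 < \<eta>'" "2 * \<eta>' \<le> \<eta>" "\<eta>' \<le> \<epsilon>" "\<eta>' \<le> \<rho>"
      using \<eta>(1) \<epsilon>(1) \<rho>(1) by (auto simp: \<eta>'_def)
    have lscu: "lsc_on (cball x1 \<rho>) u"
      by (rule lsc_on_subset[OF lsc]) (use \<rho>(2) D0(2) in blast)
    have dv: "((\<lambda>x. v x + m) has_derivative (\<lambda>h. G x \<bullet> h)) (at x)" if "x \<in> cball x1 \<rho>" for x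
    proof -
      have "x \<in> \<Omega>"
        using that \<rho>(2) D0(2) by blast
      have "((\<lambda>x. f x + \<epsilon> * barrier A b e (x - a) + m) has_derivative
          (\<lambda>h. g x \<bullet> h + \<epsilon> * (barrier_grad A b e (x - a) \<bullet> h) + 0)) (at x)"
        by (intro has_derivative_add has_derivative_mult_right has_derivative_const df \<open>x \<in> \<Omega>\<close> barrier_has_derivative)
      then show ?thesis
        by (simp add: v_def \<beta>_def G_def inner_add_left)
    qed
    have Glip: "(L + 1)-lipschitz_on (cball x1 \<rho>) G"
    proof (rule lipschitz_onI)
      fix x y
      assume xy: "x \<in> cball x1 \<rho>" "y \<in> cball x1 \<rho>"
      have "x \<in> \<Omega> \<inter> ball a r" "y \<in> \<Omega> \<inter> ball a r"
        using xy \<rho>(2) D0(2) by blast+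
      then have "norm (g x - g y) \<le> L * norm (x - y)"
        using lipschitz_onD[OF lip, of x y] unfolding dist_norm by blast
      moreover have "norm (\<epsilon> *\<^sub>R (barrier_grad A b e (x - a) - barrier_grad A b e (y - a))) \<le> 1 * norm (x - y)"
      proof -
        have "norm (barrier_grad A b e (x - a) - barrier_grad A b e (y - a)) \<le> (A + b) * norm (x - y)"
          using barrier_grad_lipschitz[OF e, of A b "x - a" "y - a"] A(2) b0 by simp
        then have "\<epsilon> * norm (barrier_grad A b e (x - a) - barrier_grad A b e (y - a)) \<le> \<epsilon> * ((A + b) * norm (x - y))"
          using \<epsilon>(1) by (intro mult_left_mono) auto
        also have "\<dots> = ((A + b) * \<epsilon>) * norm (x - y)"
          by simp
        also have "\<dots> \<le> 1 * norm (x - y)"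
          using \<epsilon>(4) by (intro mult_right_mono) auto
        finally show ?thesis
          using \<epsilon>(1) by simp
      qed
      moreover have "G x - G y = (g x - g y) + \<epsilon> *\<^sub>R (barrier_grad A b e (x - a) - barrier_grad A b e (y - a))"
        by (simp add: G_def scaleR_diff_right)
      ultimately have "norm (G x - G y) \<le> L * norm (x - y) + 1 * norm (x - y)"
        by (metis add_mono norm_triangle_le)
      then show "dist (G x) (G y) \<le> (L + 1) * dist x y"
        by (simp add: dist_norm distrib_right)
    qed (use lipschitz_on_nonneg[OF lip] in simp)
    have "ereal (v x + m) \<le> u x" if "x \<in> cball x1 \<rho>" for x
      using below that \<rho>(2) D0(1) by blast
    moreover have "u x1 = ereal (v x1 + m)"
      using sx(1) by (simp add: m_def)
    ultimately obtain x0 y0 s q B where ct: "dist x0 x1 < \<eta>'" "dist y0 x1 < \<eta>'"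
      "u y0 = ereal s" "\<bar>s - (v x0 + m)\<bar> < \<eta>'" "norm (q - G x0) < \<eta>'"
      "bounded_linear B" "\<And>h. norm (B h) \<le> (L + 1) * norm h"
      "\<exists>d>0. \<forall>h. norm h < d \<longrightarrow> \<bar>(v (x0 + h) + m) - (v x0 + m) - G x0 \<bullet> h - (h \<bullet> B h) / 2\<bar> \<le> \<eta>' * (norm h)\<^sup>2"
      "\<exists>d>0. \<forall>h. norm h < d \<longrightarrow> ereal (s + q \<bullet> h + (h \<bullet> B h) / 2 - \<eta>' * (norm h)\<^sup>2) \<le> u (y0 + h)"
      using contact_points[OF \<rho>(1) lscu dv Glip _ _ \<eta>'(1)] by blast
    obtain M where M: "M \<in> Sym" "\<And>h. h \<bullet> (M *v h) = h \<bullet> B h"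
      "norm M \<le> real CARD('n) * (real CARD('n) * (L + 1))"
      using symmetric_matrix_of_quadratic_form[OF ct(6,7)] by blast
    have "x0 \<in> cball x1 \<rho>" "y0 \<in> cball x1 \<rho>"
      using ct(1,2) \<eta>'(4) by (auto simp: dist_commute)
    then have x0: "x0 \<in> D0" "y0 \<in> D0"
      using \<rho>(2) by auto
    have x0D: "x0 \<in> D"
      using x0 D0(1) by blast
    have \<eta>h: "2 * (\<eta>' * (norm h)\<^sup>2) \<le> \<eta> * (norm h)\<^sup>2" for h :: "real^'n"
      using mult_right_mono[OF \<eta>'(2), of "(norm h)\<^sup>2"] by (simp add: mult.assoc)
    have "dist x0 y0 < \<eta>"
      using dist_triangle2[of x0 y0 x1] ct(1,2) \<eta>'(2) by linarith
    moreover have "\<bar>s - f x0\<bar> \<le> \<epsilon> * Q"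
    proof -
      have "- (\<epsilon> * (3 / 2)) \<le> m"
        using fsx \<epsilon>\<beta>(1)[OF x1(1)] by (simp add: m_def v_def)
      moreover have "s - f x0 = (s - (v x0 + m)) + \<epsilon> * \<beta> x0 + m"
        by (simp add: v_def)
      \<comment> \<open>At most \<open>\<epsilon>\<close> comes from the contact points, and at most
        \<open>3 / 2 * \<epsilon>\<close> each from the barrier and from \<open>m\<close>.\<close>
      ultimately have "\<bar>s - f x0\<bar> \<le> \<epsilon> * 4"
        using ct(4) \<epsilon>\<beta>[OF x0D] m \<eta>'(3) \<epsilon>(1) by linarith
      also have "\<dots> \<le> \<epsilon> * Q"
        using Q4 \<epsilon>(1) by simp
      finally show ?thesis .
    qed
    moreover have "norm (barrier_grad A b e (x0 - a)) \<le> Q"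
    proof -
      have "0 \<le> T x0" "T x0 \<le> t0"
        using x0(1) by (auto simp: D0_def)
      then have "0 \<le> A * T x0" "A * T x0 \<le> 1"
        using A(2) t0(3) mult_left_mono[of "T x0" t0 A] by auto
      then have "norm ((1 + A * T x0) *\<^sub>R e) \<le> 2"
        using e by simp
      moreover have "norm (b *\<^sub>R (x0 - a)) \<le> b * r"
        using D(2)[OF x0D] b0 by simp
      ultimately show ?thesis
        using norm_triangle_ineq4[of "(1 + A * T x0) *\<^sub>R e" "b *\<^sub>R (x0 - a)"] Q
        unfolding barrier_grad_def T_def by linarith
    qed
    moreover have "norm (q - (g x0 + \<epsilon> *\<^sub>R barrier_grad A b e (x0 - a))) < \<eta>"
      using ct(5) \<eta>' by (simp add: G_def)
    moreover have "\<exists>d>0. \<forall>h. norm h < d \<longrightarrow> f (x0 + h) \<le> f x0 + g x0 \<bullet> h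
        + (h \<bullet> ((M + \<eta> *\<^sub>R mat 1 - \<epsilon> *\<^sub>R barrier_hess A b e) *v h)) / 2"
    proof -
      obtain d where d: "0 < d" "\<And>h. norm h < d \<Longrightarrow>
          \<bar>(v (x0 + h) + m) - (v x0 + m) - G x0 \<bullet> h - (h \<bullet> B h) / 2\<bar> \<le> \<eta>' * (norm h)\<^sup>2"
        using ct(8) by blast
      have "f (x0 + h) \<le> f x0 + g x0 \<bullet> h
          + (h \<bullet> ((M + \<eta> *\<^sub>R mat 1 - \<epsilon> *\<^sub>R barrier_hess A b e) *v h)) / 2" if "norm h < d" for h
      proof -
        have "\<beta> (x0 + h) = \<beta> x0 + barrier_grad A b e (x0 - a) \<bullet> h + (h \<bullet> (barrier_hess A b e *v h)) / 2"
          unfolding \<beta>_def using barrier_expansion[of A b e "x0 - a" h] by (simp add: algebra_simps)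
        then have "\<epsilon> * \<beta> (x0 + h) = \<epsilon> * \<beta> x0 + \<epsilon> * (barrier_grad A b e (x0 - a) \<bullet> h)
            + \<epsilon> * (h \<bullet> (barrier_hess A b e *v h)) / 2"
          by (simp add: distrib_left)
        moreover have "h \<bullet> ((M + \<eta> *\<^sub>R mat 1 - \<epsilon> *\<^sub>R barrier_hess A b e) *v h)
            = h \<bullet> B h + \<eta> * (norm h)\<^sup>2 - \<epsilon> * (h \<bullet> (barrier_hess A b e *v h))"
          by (simp add: matrix_vector_mult_diff_rdistrib matrix_vector_mult_add_rdistrib scaleR_mat_mult
              scaleR_matrix_vector_assoc[symmetric] inner_add_right inner_diff_right M(2) power2_norm_eq_inner)
        moreover have "G x0 \<bullet> h = g x0 \<bullet> h + \<epsilon> * (barrier_grad A b e (x0 - a) \<bullet> h)"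
          by (simp add: G_def inner_add_left)
        moreover have "(v (x0 + h) + m) - (v x0 + m) = f (x0 + h) - f x0 + \<epsilon> * \<beta> (x0 + h) - \<epsilon> * \<beta> x0"
          by (simp add: v_def)
        ultimately show ?thesis
          using d(2)[OF that] \<eta>h[of h] unfolding abs_le_iff by linarith
      qed
      then show ?thesis
        using d(1) by blast
    qed
    moreover have "\<exists>d>0. \<forall>h. norm h < d \<longrightarrow>
        ereal (s + q \<bullet> h + (h \<bullet> ((M - \<eta> *\<^sub>R mat 1) *v h)) / 2) \<le> u (y0 + h)"
    proof -
      have "s + q \<bullet> h + (h \<bullet> ((M - \<eta> *\<^sub>R mat 1) *v h)) / 2 \<le> s + q \<bullet> h + (h \<bullet> B h) / 2 - \<eta>' * (norm h)\<^sup>2" for h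
        using \<eta>h[of h]
        by (simp add: matrix_vector_mult_diff_rdistrib scaleR_mat_mult inner_diff_right M(2) power2_norm_eq_inner)
      then show ?thesis
        using ct(9) by (meson ereal_less_eq(3) order_trans)
    qed
    moreover have "x0 \<in> \<Omega> \<inter> ball a r" "y0 \<in> \<Omega> \<inter> ball a r"
      using x0 D0(2) by auto
    moreover note ct(3) M(1,3)
    ultimately show False
      using \<eta>(2) touchingI by metis
  qed
  have "a + s *\<^sub>R e \<in> \<Omega> \<and> ereal (f (a + s *\<^sub>R e) + \<epsilon> * s) \<le> u (a + s *\<^sub>R e)" if s: "0 < s" "s \<le> t0" for s
  proof -
    have Ts: "T (a + s *\<^sub>R e) = s"
      using e by (simp add: T_def norm_eq_1)
    have "0 \<le> (A - b) / 2 * s\<^sup>2"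
      using A(3) by simp
    then have \<beta>s: "s \<le> \<beta> (a + s *\<^sub>R e)"
      using s(1) e unfolding \<beta>_eq Ts by (simp add: field_simps)
    then have inD: "a + s *\<^sub>R e \<in> D"
      using s Ts by (simp add: D_def)
    then have "ereal (v (a + s *\<^sub>R e)) \<le> u (a + s *\<^sub>R e)"
      by (rule above)
    moreover have "a + s *\<^sub>R e \<in> \<Omega>"
      using D(4)[OF inD] s(1) e by auto
    moreover have "f (a + s *\<^sub>R e) + \<epsilon> * s \<le> v (a + s *\<^sub>R e)"
      using \<beta>s \<epsilon>(1) by (simp add: v_def)
    ultimately show ?thesis
      by (meson ereal_less_eq(3) order_trans)
  qed
  then show ?thesis
    using \<epsilon>(1) t0(1) by blast
qed

section \<open>The Hopf lemma\<close>

text \<open>Shaped after \<open>touching\<close>: the matrices of the two quadratics tested there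
  differ by exactly \<open>\<epsilon> *\<^sub>R H - (2 * \<eta>) *\<^sub>R mat 1\<close>.\<close>

definition strict_gain_at ::
    "(real^'n) set \<Rightarrow> ('n::finite jet \<Rightarrow> real) \<Rightarrow> 'n jet set \<Rightarrow> real \<Rightarrow> real \<Rightarrow> real^'n^'n \<Rightarrow> real \<Rightarrow> real \<Rightarrow> bool" where
  "strict_gain_at \<Omega> F U R Q H \<epsilon> \<eta> \<longleftrightarrow> (\<forall>x s p M y s' p' k.
     (x, s, p, M) \<in> closure U \<and> 1 \<le> F (x, s, p, M) \<and> norm x + \<bar>s\<bar> + norm p + norm M \<le> R \<and>
     y \<in> closure \<Omega> \<and> \<bar>s' - s\<bar> \<le> \<epsilon> * Q \<and> norm k \<le> Q \<and> M \<in> Sym \<and>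
     dist x y < \<eta> \<and> norm (p' - (p + \<epsilon> *\<^sub>R k)) < \<eta> \<longrightarrow>
     (y, s', p', M + \<epsilon> *\<^sub>R H - (2 * \<eta>) *\<^sub>R mat 1) \<in> closure U \<and>
     1 < F (y, s', p', M + \<epsilon> *\<^sub>R H - (2 * \<eta>) *\<^sub>R mat 1))"

lemma strict_gain_atD:
  assumes "strict_gain_at \<Omega> F U R Q H \<epsilon> \<eta>"
    "(x, s, p, M) \<in> closure U" "1 \<le> F (x, s, p, M)" "norm x + \<bar>s\<bar> + norm p + norm M \<le> R"
    "y \<in> closure \<Omega>" "\<bar>s' - s\<bar> \<le> \<epsilon> * Q" "norm k \<le> Q" "M \<in> Sym"
    "dist x y < \<eta>" "norm (p' - (p + \<epsilon> *\<^sub>R k)) < \<eta>"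
  shows "(y, s', p', M + \<epsilon> *\<^sub>R H - (2 * \<eta>) *\<^sub>R mat 1) \<in> closure U \<and>
    1 < F (y, s', p', M + \<epsilon> *\<^sub>R H - (2 * \<eta>) *\<^sub>R mat 1)"
  using assms unfolding strict_gain_at_def by blast

text \<open>\<open>strict_gain\<close> for the rank-one matrix of \<open>e\<close> and
  \<open>b\<close> times the identity. The additional bounds on \<open>\<epsilon>\<close> and
  \<open>\<eta>\<close> keep the test matrices within a radius that is fixed before
  \<open>A\<close>.\<close>

lemma strict_gain_barrier:
  fixes F :: "'n::finite jet \<Rightarrow> real"
  assumes U: "openin (top_of_set (jet_space \<Omega>)) U" and F: "continuous_on (closure U) F"
    and F1: "elliptic F U" and F2: "boundary_below_one \<Omega> F U"
    and F3: "locally_strictly_elliptic F U" and F4: "locally_lipschitz_in_jet F U"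
    and e: "norm e = 1" and Q: "0 \<le> Q"
  shows "\<exists>A\<^sub>0. \<forall>A\<ge>A\<^sub>0. \<exists>\<epsilon>\<^sub>0>0. \<forall>\<epsilon>. 0 < \<epsilon> \<and> \<epsilon> \<le> \<epsilon>\<^sub>0 \<longrightarrow> \<epsilon> \<le> 1 \<and> \<epsilon> * norm (barrier_hess A b e) \<le> 1 \<and>
      (\<exists>\<eta>>0. \<eta> \<le> 1 \<and> \<eta> * norm (mat 1 :: real^'n^'n) \<le> 1 \<and> strict_gain_at \<Omega> F U R Q (barrier_hess A b e) \<epsilon> \<eta>)"
proof -
  have nn: "norm (a, b, c, d) \<le> norm a + norm b + norm c + norm d"
    for a :: "real^'n" and b :: real and c :: "real^'n" and d :: "real^'n^'n"
    using norm_Pair_le[of a "(b, c, d)"] norm_Pair_le[of b "(c, d)"] norm_Pair_le[of c d] by linarith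
  have e0: "outer e \<noteq> 0"
  proof
    assume "outer e = 0"
    then have "outer e *v e = 0" by simp
    then show False
      using e by (auto simp: outer_mult norm_eq_1)
  qed
  define I where "I = (mat 1 :: real^'n^'n)"
  have bI: "b *\<^sub>R mat 1 \<in> Sym"
    by (intro Sym_scaleR Sym_mat)
  obtain A\<^sub>0 where A\<^sub>0: "\<And>A. A\<^sub>0 \<le> A \<Longrightarrow> \<exists>\<epsilon>\<^sub>0>0. \<forall>\<epsilon>. 0 < \<epsilon> \<and> \<epsilon> \<le> \<epsilon>\<^sub>0 \<longrightarrow> (\<exists>\<eta>>0. \<forall>x s p M \<sigma> q j.
      (x, s, p, M) \<in> closure U \<and> 1 \<le> F (x, s, p, M) \<and> norm (x, s, p, M) \<le> R \<and>
      \<bar>\<sigma>\<bar> \<le> \<epsilon> * Q \<and> norm q \<le> Q \<and> j \<in> jet_space \<Omega> \<and>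
      dist j (x, s + \<sigma>, p + \<epsilon> *\<^sub>R q, M + \<epsilon> *\<^sub>R barrier_hess A b e) < \<eta> \<longrightarrow> j \<in> U \<and> 1 < F j)"
    using strict_gain[OF U F F1 F2 F3 F4 Sym_outer nonneg_definite_outer e0 bI Q, of R]
    unfolding barrier_hess_def by blast
  show ?thesis
  proof (rule exI[of _ A\<^sub>0], intro allI impI)
    fix A
    assume "A\<^sub>0 \<le> A"
    define H where "H = barrier_hess A b e"
    obtain \<epsilon>1 where \<epsilon>1: "0 < \<epsilon>1" and gain: "\<And>\<epsilon>. 0 < \<epsilon> \<Longrightarrow> \<epsilon> \<le> \<epsilon>1 \<Longrightarrow> \<exists>\<eta>>0. \<forall>x s p M \<sigma> q j.
      (x, s, p, M) \<in> closure U \<and> 1 \<le> F (x, s, p, M) \<and> norm (x, s, p, M) \<le> R \<and>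
      \<bar>\<sigma>\<bar> \<le> \<epsilon> * Q \<and> norm q \<le> Q \<and> j \<in> jet_space \<Omega> \<and>
      dist j (x, s + \<sigma>, p + \<epsilon> *\<^sub>R q, M + \<epsilon> *\<^sub>R H) < \<eta> \<longrightarrow> j \<in> U \<and> 1 < F j"
      using A\<^sub>0[OF \<open>A\<^sub>0 \<le> A\<close>] unfolding H_def by auto
    have "\<exists>\<epsilon>0>0. \<forall>z\<in>{(1, \<epsilon>1), (1, 1), (norm H, 1)}. fst z * \<epsilon>0 < snd z"
      by (rule exists_small_multiplier) (use \<epsilon>1 in auto)
    then obtain \<epsilon>0 where \<epsilon>0: "0 < \<epsilon>0" "\<epsilon>0 < \<epsilon>1" "\<epsilon>0 < 1" "norm H * \<epsilon>0 < 1"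
      by auto
    show "\<exists>\<epsilon>\<^sub>0>0. \<forall>\<epsilon>. 0 < \<epsilon> \<and> \<epsilon> \<le> \<epsilon>\<^sub>0 \<longrightarrow> \<epsilon> \<le> 1 \<and> \<epsilon> * norm (barrier_hess A b e) \<le> 1 \<and>
      (\<exists>\<eta>>0. \<eta> \<le> 1 \<and> \<eta> * norm (mat 1 :: real^'n^'n) \<le> 1 \<and> strict_gain_at \<Omega> F U R Q (barrier_hess A b e) \<epsilon> \<eta>)"
      unfolding H_def[symmetric] I_def[symmetric]
    proof (rule exI[of _ \<epsilon>0], intro conjI allI impI)
      show "0 < \<epsilon>0"
        by (rule \<epsilon>0(1))
      fix \<epsilon>
      assume \<epsilon>: "0 < \<epsilon> \<and> \<epsilon> \<le> \<epsilon>0"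
      show "\<epsilon> \<le> 1"
        using \<epsilon> \<epsilon>0(3) by simp
      have "\<epsilon> * norm H \<le> \<epsilon>0 * norm H"
        using \<epsilon> by (intro mult_right_mono) auto
      then show "\<epsilon> * norm H \<le> 1"
        using \<epsilon>0(4) by (simp add: mult.commute)
      obtain \<eta>0 where \<eta>0: "0 < \<eta>0" and gain': "\<And>x s p M \<sigma> q j.
        (x, s, p, M) \<in> closure U \<Longrightarrow> 1 \<le> F (x, s, p, M) \<Longrightarrow> norm (x, s, p, M) \<le> R \<Longrightarrow>
        \<bar>\<sigma>\<bar> \<le> \<epsilon> * Q \<Longrightarrow> norm q \<le> Q \<Longrightarrow> j \<in> jet_space \<Omega> \<Longrightarrow>
        dist j (x, s + \<sigma>, p + \<epsilon> *\<^sub>R q, M + \<epsilon> *\<^sub>R H) < \<eta>0 \<Longrightarrow> j \<in> U \<and> 1 < F j"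
        using gain[of \<epsilon>] \<epsilon> \<epsilon>0(2) by auto
      \<comment> \<open>The tolerance \<open>\<eta>0\<close> has to hold one \<open>\<eta>\<close>
        for the base point, one for the slope, and \<open>2 * \<eta> * norm I\<close> for the
        matrix.\<close>
      have "\<exists>\<eta>>0. \<forall>z\<in>{(1, 1), (norm I, 1), (2 + 2 * norm I, \<eta>0)}. fst z * \<eta> < snd z"
        by (rule exists_small_multiplier) (use \<eta>0 in auto)
      then obtain \<eta> where \<eta>: "0 < \<eta>" "\<eta> < 1" "norm I * \<eta> < 1" "(2 + 2 * norm I) * \<eta> < \<eta>0"
        by auto
      have step: "(y, s', p', M + \<epsilon> *\<^sub>R H - (2 * \<eta>) *\<^sub>R I) \<in> closure U \<and>
          1 < F (y, s', p', M + \<epsilon> *\<^sub>R H - (2 * \<eta>) *\<^sub>R I)"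
        if "(x, s, p, M) \<in> closure U" "1 \<le> F (x, s, p, M)" "norm x + \<bar>s\<bar> + norm p + norm M \<le> R"
          "y \<in> closure \<Omega>" "\<bar>s' - s\<bar> \<le> \<epsilon> * Q" "norm k \<le> Q" "M \<in> Sym"
          "dist x y < \<eta>" "norm (p' - (p + \<epsilon> *\<^sub>R k)) < \<eta>" for x s p M y s' p' k
      proof -
        let ?j = "(y, s', p', M + \<epsilon> *\<^sub>R H - (2 * \<eta>) *\<^sub>R I)"
        have "H \<in> Sym" "I \<in> Sym"
          unfolding H_def I_def barrier_hess_def by (intro Sym_diff Sym_scaleR Sym_outer Sym_mat)+
        then have "?j \<in> jet_space \<Omega>"
          using that(4,7) by (auto simp: jet_space_def intro!: Sym_add Sym_diff Sym_scaleR)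
        moreover have "dist ?j (x, s + (s' - s), p + \<epsilon> *\<^sub>R k, M + \<epsilon> *\<^sub>R H) < \<eta>0"
        proof -
          have "dist ?j (x, s + (s' - s), p + \<epsilon> *\<^sub>R k, M + \<epsilon> *\<^sub>R H)
              \<le> norm (y - x) + norm (0 :: real) + norm (p' - (p + \<epsilon> *\<^sub>R k)) + norm ((2 * \<eta>) *\<^sub>R I)"
            using nn[of "y - x" 0 "p' - (p + \<epsilon> *\<^sub>R k)" "- ((2 * \<eta>) *\<^sub>R I)"] by (simp add: dist_norm)
          also have "\<dots> < \<eta> + 0 + \<eta> + 2 * \<eta> * norm I"
            using that(8,9) \<eta>(1) by (simp add: dist_norm norm_minus_commute)
          also have "\<dots> = (2 + 2 * norm I) * \<eta>"
            by (simp add: algebra_simps)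
          finally show ?thesis
            using \<eta>(4) by linarith
        qed
        moreover have "norm (x, s, p, M) \<le> R"
          using nn[of x s p M] that(3) by simp
        ultimately have "?j \<in> U \<and> 1 < F ?j"
          using gain'[OF that(1,2) _ that(5,6)] by blast
        then show ?thesis
          using closure_subset by blast
      qed
      show "\<exists>\<eta>>0. \<eta> \<le> 1 \<and> \<eta> * norm I \<le> 1 \<and> strict_gain_at \<Omega> F U R Q H \<epsilon> \<eta>"
      proof (rule exI[of _ \<eta>], intro conjI)
        show "\<eta> * norm I \<le> 1"
          using \<eta>(3) by (simp add: mult.commute)
        show "strict_gain_at \<Omega> F U R Q H \<epsilon> \<eta>"
          unfolding strict_gain_at_def I_def[symmetric] using step by blast
      qed (use \<eta>(1,2) in auto)
    qed
  qed
qed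

text \<open>The upper quadratic tests \<open>\<psi>\<^sub>1\<close> at \<open>x\<close>, so
  \<open>F \<ge> 1\<close> at its jet, and the strict gain leads to \<open>F > 1\<close> at the jet
  that tests \<open>\<psi>\<^sub>2\<close> at \<open>y\<close>. In the radius
  \<open>3 * R + K + 2\<close>, the summand 2 accounts for the terms with \<open>\<eta>\<close> and
  \<open>\<epsilon>\<close> in the matrix.\<close>

lemma no_touching_C11_subsolution:
  fixes F :: "'n::finite jet \<Rightarrow> real"
  assumes U: "openin (top_of_set (jet_space \<Omega>)) U" and F: "continuous_on (closure U) F"
    and F1: "elliptic F U" and F2: "boundary_below_one \<Omega> F U"
    and F3: "locally_strictly_elliptic F U" and F4: "locally_lipschitz_in_jet F U"
    and e: "norm e = 1" and Q: "0 \<le> Q" and \<Omega>: "open \<Omega>"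
    and sub: "viscosity_subsolution F U \<Omega> \<psi>\<^sub>1" and super: "viscosity_supersolution F U \<Omega> \<psi>\<^sub>2"
    and f: "\<And>x. x \<in> \<Omega> \<Longrightarrow> \<psi>\<^sub>1 x = ereal (f x)"
    and X: "\<And>x. x \<in> X \<Longrightarrow> x \<in> \<Omega> \<and> norm x \<le> R \<and> \<bar>f x\<bar> \<le> R \<and> norm (g x) \<le> R"
  shows "\<exists>A\<^sub>0. \<forall>A\<ge>A\<^sub>0. \<exists>\<epsilon>\<^sub>0>0. \<forall>\<epsilon>. 0 < \<epsilon> \<and> \<epsilon> \<le> \<epsilon>\<^sub>0 \<longrightarrow>
      (\<exists>\<eta>>0. \<not> touching X f g \<psi>\<^sub>2 (barrier_hess A b e) Q K \<epsilon> \<eta>)"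
proof -
  have "\<not> touching X f g \<psi>\<^sub>2 (barrier_hess A b e) Q K \<epsilon> \<eta>"
    if \<epsilon>: "0 < \<epsilon>" "\<epsilon> * norm (barrier_hess A b e) \<le> 1" and \<eta>: "0 < \<eta>" "\<eta> * norm (mat 1 :: real^'n^'n) \<le> 1"
    and gain: "strict_gain_at \<Omega> F U (3 * R + K + 2) Q (barrier_hess A b e) \<epsilon> \<eta>" for A \<epsilon> \<eta>
  proof
    define H where "H = barrier_hess A b e"
    have HS: "H \<in> Sym"
      unfolding H_def barrier_hess_def by (intro Sym_diff Sym_scaleR Sym_outer Sym_mat)
    assume "touching X f g \<psi>\<^sub>2 (barrier_hess A b e) Q K \<epsilon> \<eta>"
    then obtain x y s q M k where t: "x \<in> X" "y \<in> X" "dist x y < \<eta>" "\<psi>\<^sub>2 y = ereal s"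
      "\<bar>s - f x\<bar> \<le> \<epsilon> * Q" "norm k \<le> Q" "norm (q - (g x + \<epsilon> *\<^sub>R k)) < \<eta>" "M \<in> Sym" "norm M \<le> K"
      "\<exists>d>0. \<forall>h. norm h < d \<longrightarrow> f (x + h) \<le> f x + g x \<bullet> h + (h \<bullet> ((M + \<eta> *\<^sub>R mat 1 - \<epsilon> *\<^sub>R H) *v h)) / 2"
      "\<exists>d>0. \<forall>h. norm h < d \<longrightarrow> ereal (s + q \<bullet> h + (h \<bullet> ((M - \<eta> *\<^sub>R mat 1) *v h)) / 2) \<le> \<psi>\<^sub>2 (y + h)"
      unfolding touching_def H_def by blast
    define M1 where "M1 = M + \<eta> *\<^sub>R mat 1 - \<epsilon> *\<^sub>R H"
    have xy: "x \<in> \<Omega>" "y \<in> \<Omega>"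
      using X t(1,2) by auto
    have M1: "M1 \<in> Sym" and M2: "M - \<eta> *\<^sub>R mat 1 \<in> Sym"
      unfolding M1_def by (intro Sym_add Sym_diff Sym_scaleR Sym_mat t(8) HS)+
    obtain d where d: "0 < d" "\<And>h. norm h < d \<Longrightarrow> f (x + h) \<le> f x + g x \<bullet> h + (h \<bullet> (M1 *v h)) / 2"
      using t(10) unfolding M1_def by blast
    obtain r where r: "0 < r" "ball x r \<subseteq> \<Omega>"
      using \<Omega> xy(1) open_contains_ball by blast
    have "\<psi>\<^sub>1 (x + h) \<le> ereal (f x + g x \<bullet> h + (h \<bullet> (M1 *v h)) / 2)" if "norm h < min d r" for h
    proof -
      have "x + h \<in> \<Omega>"
        using r(2) that by (auto simp: dist_norm)
      then show ?thesis
        using f d(2)[of h] that by simp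
    qed
    then have "\<exists>d>0. \<forall>h. norm h < d \<longrightarrow> \<psi>\<^sub>1 (x + h) \<le> ereal (f x + g x \<bullet> h + (h \<bullet> (M1 *v h)) / 2)"
      using d(1) r(1) by (intro exI[of _ "min d r"]) auto
    note j1 = subsolution_test_quadratic[OF sub xy(1) M1 f[OF xy(1)] this]
    note j2 = supersolution_test_quadratic[OF super xy(2) M2 t(4,11)]
    have "norm M1 \<le> norm M + norm (\<eta> *\<^sub>R mat 1 :: real^'n^'n) + norm (\<epsilon> *\<^sub>R H)"
      unfolding M1_def by (meson add_mono norm_triangle_ineq norm_triangle_ineq4 order_refl order_trans)
    then have "norm M1 \<le> K + 1 + 1"
      using t(9) \<epsilon> \<eta> by (simp add: H_def)
    then have "norm x + \<bar>f x\<bar> + norm (g x) + norm M1 \<le> 3 * R + K + 2"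
      using X[OF t(1)] by linarith
    moreover have "y \<in> closure \<Omega>"
      using xy(2) closure_subset by blast
    moreover have "M1 + \<epsilon> *\<^sub>R H - (2 * \<eta>) *\<^sub>R mat 1 = M - \<eta> *\<^sub>R mat 1"
      by (simp add: M1_def algebra_simps flip: scaleR_add_left)
    ultimately have "(y, s, q, M - \<eta> *\<^sub>R mat 1) \<in> closure U \<and> 1 < F (y, s, q, M - \<eta> *\<^sub>R mat 1)"
      using strict_gain_atD[OF gain, of x "f x" "g x" M1 y s k q] j1 t(3,5,6,7) M1 unfolding H_def by simp
    then show False
      using j2 by auto
  qed
  note none = this
  obtain A\<^sub>0 where A\<^sub>0: "\<And>A. A\<^sub>0 \<le> A \<Longrightarrow> \<exists>\<epsilon>\<^sub>0>0. \<forall>\<epsilon>. 0 < \<epsilon> \<and> \<epsilon> \<le> \<epsilon>\<^sub>0 \<longrightarrow>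
      \<epsilon> \<le> 1 \<and> \<epsilon> * norm (barrier_hess A b e) \<le> 1 \<and>
      (\<exists>\<eta>>0. \<eta> \<le> 1 \<and> \<eta> * norm (mat 1 :: real^'n^'n) \<le> 1 \<and>
        strict_gain_at \<Omega> F U (3 * R + K + 2) Q (barrier_hess A b e) \<epsilon> \<eta>)"
    using strict_gain_barrier[OF U F F1 F2 F3 F4 e Q, of b "3 * R + K + 2"] by blast
  have "\<exists>\<epsilon>\<^sub>0>0. \<forall>\<epsilon>. 0 < \<epsilon> \<and> \<epsilon> \<le> \<epsilon>\<^sub>0 \<longrightarrow>
      (\<exists>\<eta>>0. \<not> touching X f g \<psi>\<^sub>2 (barrier_hess A b e) Q K \<epsilon> \<eta>)" if A: "A\<^sub>0 \<le> A" for A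
  proof -
    obtain \<epsilon>\<^sub>0 where \<epsilon>\<^sub>0: "0 < \<epsilon>\<^sub>0" "\<And>\<epsilon>. 0 < \<epsilon> \<Longrightarrow> \<epsilon> \<le> \<epsilon>\<^sub>0 \<Longrightarrow>
        \<epsilon> \<le> 1 \<and> \<epsilon> * norm (barrier_hess A b e) \<le> 1 \<and>
        (\<exists>\<eta>>0. \<eta> \<le> 1 \<and> \<eta> * norm (mat 1 :: real^'n^'n) \<le> 1 \<and>
          strict_gain_at \<Omega> F U (3 * R + K + 2) Q (barrier_hess A b e) \<epsilon> \<eta>)"
      using A\<^sub>0[OF A] by blast
    have "\<exists>\<eta>>0. \<not> touching X f g \<psi>\<^sub>2 (barrier_hess A b e) Q K \<epsilon> \<eta>"
      if \<epsilon>: "0 < \<epsilon>" "\<epsilon> \<le> \<epsilon>\<^sub>0" for \<epsilon>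
    proof -
      have h: "\<epsilon> \<le> 1" "\<epsilon> * norm (barrier_hess A b e) \<le> 1"
        using \<epsilon>\<^sub>0(2)[OF \<epsilon>] by auto
      obtain \<eta> where \<eta>: "0 < \<eta>" "\<eta> \<le> 1" "\<eta> * norm (mat 1 :: real^'n^'n) \<le> 1"
          "strict_gain_at \<Omega> F U (3 * R + K + 2) Q (barrier_hess A b e) \<epsilon> \<eta>"
        using \<epsilon>\<^sub>0(2)[OF \<epsilon>] by blast
      then show ?thesis
        using none[OF \<epsilon>(1) h(2) \<eta>(1,3,4)] by blast
    qed
    then show ?thesis
      using \<epsilon>\<^sub>0(1) by blast
  qed
  then show ?thesis
    by blast
qed

text \<open>Now the gain starts at \<open>y\<close>, where \<open>\<psi>\<^sub>1\<close> is tested,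
  and ends at \<open>x\<close>. The starting value and slope are bounded only through their
  closeness to those of \<open>f\<close> at \<open>x\<close>, which costs the additional
  \<open>2 * Q\<close> in the radius.\<close>

lemma no_touching_C11_supersolution:
  fixes F :: "'n::finite jet \<Rightarrow> real"
  assumes U: "openin (top_of_set (jet_space \<Omega>)) U" and F: "continuous_on (closure U) F"
    and F1: "elliptic F U" and F2: "boundary_below_one \<Omega> F U"
    and F3: "locally_strictly_elliptic F U" and F4: "locally_lipschitz_in_jet F U"
    and e: "norm e = 1" and Q: "0 \<le> Q" and \<Omega>: "open \<Omega>"
    and sub: "viscosity_subsolution F U \<Omega> \<psi>\<^sub>1" and super: "viscosity_supersolution F U \<Omega> \<psi>\<^sub>2"
    and f: "\<And>x. x \<in> \<Omega> \<Longrightarrow> \<psi>\<^sub>2 x = ereal (- f x)"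
    and X: "\<And>x. x \<in> X \<Longrightarrow> x \<in> \<Omega> \<and> norm x \<le> R \<and> \<bar>f x\<bar> \<le> R \<and> norm (g x) \<le> R"
  shows "\<exists>A\<^sub>0. \<forall>A\<ge>A\<^sub>0. \<exists>\<epsilon>\<^sub>0>0. \<forall>\<epsilon>. 0 < \<epsilon> \<and> \<epsilon> \<le> \<epsilon>\<^sub>0 \<longrightarrow>
      (\<exists>\<eta>>0. \<not> touching X f g (\<lambda>x. - \<psi>\<^sub>1 x) (barrier_hess A b e) Q K \<epsilon> \<eta>)"
proof -
  have "\<not> touching X f g (\<lambda>x. - \<psi>\<^sub>1 x) (barrier_hess A b e) Q K \<epsilon> \<eta>"
    if \<epsilon>: "0 < \<epsilon>" "\<epsilon> \<le> 1" and \<eta>: "0 < \<eta>" "\<eta> \<le> 1" "\<eta> * norm (mat 1 :: real^'n^'n) \<le> 1"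
    and gain: "strict_gain_at \<Omega> F U (3 * R + 2 * Q + K + 2) Q (barrier_hess A b e) \<epsilon> \<eta>" for A \<epsilon> \<eta>
  proof
    define H where "H = barrier_hess A b e"
    have HS: "H \<in> Sym"
      unfolding H_def barrier_hess_def by (intro Sym_diff Sym_scaleR Sym_outer Sym_mat)
    assume "touching X f g (\<lambda>x. - \<psi>\<^sub>1 x) (barrier_hess A b e) Q K \<epsilon> \<eta>"
    then obtain x y s q M k where t: "x \<in> X" "y \<in> X" "dist x y < \<eta>" "- \<psi>\<^sub>1 y = ereal s"
      "\<bar>s - f x\<bar> \<le> \<epsilon> * Q" "norm k \<le> Q" "norm (q - (g x + \<epsilon> *\<^sub>R k)) < \<eta>" "M \<in> Sym" "norm M \<le> K"
      "\<exists>d>0. \<forall>h. norm h < d \<longrightarrow> f (x + h) \<le> f x + g x \<bullet> h + (h \<bullet> ((M + \<eta> *\<^sub>R mat 1 - \<epsilon> *\<^sub>R H) *v h)) / 2"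
      "\<exists>d>0. \<forall>h. norm h < d \<longrightarrow> ereal (s + q \<bullet> h + (h \<bullet> ((M - \<eta> *\<^sub>R mat 1) *v h)) / 2) \<le> - \<psi>\<^sub>1 (y + h)"
      unfolding touching_def H_def by blast
    \<comment> \<open>The signs are reversed: \<open>M2\<close> belongs to the quadratic above
      \<open>\<psi>\<^sub>1\<close> at \<open>y\<close>, and \<open>M1\<close> to the one below
      \<open>\<psi>\<^sub>2\<close> at \<open>x\<close>.\<close>
    define M1 where "M1 = \<epsilon> *\<^sub>R H - M - \<eta> *\<^sub>R mat 1"
    define M2 where "M2 = \<eta> *\<^sub>R mat 1 - M"
    have xy: "x \<in> \<Omega>" "y \<in> \<Omega>"
      using X t(1,2) by auto
    have M1: "M1 \<in> Sym" and M2: "M2 \<in> Sym"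
      unfolding M1_def M2_def by (intro Sym_diff Sym_scaleR Sym_mat t(8) HS)+
    have M1_eq: "h \<bullet> ((M + \<eta> *\<^sub>R mat 1 - \<epsilon> *\<^sub>R H) *v h) = - (h \<bullet> (M1 *v h))"
      and M2_eq: "h \<bullet> ((M - \<eta> *\<^sub>R mat 1) *v h) = - (h \<bullet> (M2 *v h))" for h
      by (simp_all add: M1_def M2_def matrix_vector_mult_diff_rdistrib matrix_vector_mult_add_rdistrib
          inner_add_right inner_diff_right)
    obtain d where d: "0 < d" "\<And>h. norm h < d \<Longrightarrow> f (x + h) \<le> f x + g x \<bullet> h - (h \<bullet> (M1 *v h)) / 2"
      using t(10) unfolding M1_eq by auto
    obtain r where r: "0 < r" "ball x r \<subseteq> \<Omega>"
      using \<Omega> xy(1) open_contains_ball by blast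
    have "ereal (- f x + (- g x) \<bullet> h + (h \<bullet> (M1 *v h)) / 2) \<le> \<psi>\<^sub>2 (x + h)" if "norm h < min d r" for h
    proof -
      have "x + h \<in> \<Omega>"
        using r(2) that by (auto simp: dist_norm)
      then show ?thesis
        using f d(2)[of h] that by simp
    qed
    then have "\<exists>d>0. \<forall>h. norm h < d \<longrightarrow> ereal (- f x + (- g x) \<bullet> h + (h \<bullet> (M1 *v h)) / 2) \<le> \<psi>\<^sub>2 (x + h)"
      using d(1) r(1) by (intro exI[of _ "min d r"]) auto
    note j2 = supersolution_test_quadratic[OF super xy(1) M1 f[OF xy(1)] this]
    have neg: "\<psi>\<^sub>1 (y + h) \<le> ereal (- s + (- q) \<bullet> h + (h \<bullet> (M2 *v h)) / 2)"
      if "ereal (s + q \<bullet> h + - (h \<bullet> (M2 *v h)) / 2) \<le> - \<psi>\<^sub>1 (y + h)" for h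
      using that by (cases "\<psi>\<^sub>1 (y + h)") auto
    have "\<exists>d>0. \<forall>h. norm h < d \<longrightarrow> \<psi>\<^sub>1 (y + h) \<le> ereal (- s + (- q) \<bullet> h + (h \<bullet> (M2 *v h)) / 2)"
      using t(11) neg unfolding M2_eq by meson
    moreover have "\<psi>\<^sub>1 y = ereal (- s)"
      using t(4) by (cases "\<psi>\<^sub>1 y") auto
    ultimately have j1: "(y, - s, - q, M2) \<in> closure U" "1 \<le> F (y, - s, - q, M2)"
      using subsolution_test_quadratic[OF sub xy(2) M2] by blast+
    have "norm y + \<bar>- s\<bar> + norm (- q) + norm M2 \<le> 3 * R + 2 * Q + K + 2"
    proof -
      have \<epsilon>Q: "\<epsilon> * Q \<le> Q"
        using \<epsilon> Q by (simp add: mult_left_le_one_le)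
      then have 1: "\<bar>s\<bar> \<le> R + Q"
        using X[OF t(1)] t(5) by linarith
      have "norm (\<epsilon> *\<^sub>R k) \<le> \<epsilon> * Q"
        using \<epsilon>(1) t(6) by (simp add: mult_left_mono)
      then have "norm (g x + \<epsilon> *\<^sub>R k) \<le> R + Q"
        using X[OF t(1)] \<epsilon>Q norm_triangle_ineq[of "g x" "\<epsilon> *\<^sub>R k"] by linarith
      then have 2: "norm q \<le> R + Q + 1"
        using norm_triangle_sub[of q "g x + \<epsilon> *\<^sub>R k"] t(7) \<eta>(2) by linarith
      have "norm M2 \<le> 1 + K"
        unfolding M2_def using norm_triangle_ineq4[of "\<eta> *\<^sub>R mat 1" M] t(9) \<eta>(1,3) by simp
      then show ?thesis
        using 1 2 X[OF t(2)] by simp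
    qed
    moreover have "x \<in> closure \<Omega>"
      using xy(1) closure_subset by blast
    moreover have "norm (- g x - (- q + \<epsilon> *\<^sub>R k)) < \<eta>"
      using t(7) by (simp add: algebra_simps)
    moreover have "\<bar>- f x - - s\<bar> \<le> \<epsilon> * Q" "dist y x < \<eta>"
      using t(3,5) by (auto simp: dist_commute)
    moreover have "M2 + \<epsilon> *\<^sub>R H - (2 * \<eta>) *\<^sub>R mat 1 = M1"
      by (simp add: M1_def M2_def algebra_simps flip: scaleR_add_left)
    ultimately have "(x, - f x, - g x, M1) \<in> closure U \<and> 1 < F (x, - f x, - g x, M1)"
      using strict_gain_atD[OF gain, of y "- s" "- q" M2 x "- f x" k "- g x"] j1 t(6) M2 unfolding H_def by simp
    then show False
      using j2 by auto
  qed
  note none = this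
  obtain A\<^sub>0 where A\<^sub>0: "\<And>A. A\<^sub>0 \<le> A \<Longrightarrow> \<exists>\<epsilon>\<^sub>0>0. \<forall>\<epsilon>. 0 < \<epsilon> \<and> \<epsilon> \<le> \<epsilon>\<^sub>0 \<longrightarrow>
      \<epsilon> \<le> 1 \<and> \<epsilon> * norm (barrier_hess A b e) \<le> 1 \<and>
      (\<exists>\<eta>>0. \<eta> \<le> 1 \<and> \<eta> * norm (mat 1 :: real^'n^'n) \<le> 1 \<and>
        strict_gain_at \<Omega> F U (3 * R + 2 * Q + K + 2) Q (barrier_hess A b e) \<epsilon> \<eta>)"
    using strict_gain_barrier[OF U F F1 F2 F3 F4 e Q, of b "3 * R + 2 * Q + K + 2"] by blast
  have "\<exists>\<epsilon>\<^sub>0>0. \<forall>\<epsilon>. 0 < \<epsilon> \<and> \<epsilon> \<le> \<epsilon>\<^sub>0 \<longrightarrow>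
      (\<exists>\<eta>>0. \<not> touching X f g (\<lambda>x. - \<psi>\<^sub>1 x) (barrier_hess A b e) Q K \<epsilon> \<eta>)" if A: "A\<^sub>0 \<le> A" for A
  proof -
    obtain \<epsilon>\<^sub>0 where \<epsilon>\<^sub>0: "0 < \<epsilon>\<^sub>0" "\<And>\<epsilon>. 0 < \<epsilon> \<Longrightarrow> \<epsilon> \<le> \<epsilon>\<^sub>0 \<Longrightarrow>
        \<epsilon> \<le> 1 \<and> \<epsilon> * norm (barrier_hess A b e) \<le> 1 \<and>
        (\<exists>\<eta>>0. \<eta> \<le> 1 \<and> \<eta> * norm (mat 1 :: real^'n^'n) \<le> 1 \<and>
          strict_gain_at \<Omega> F U (3 * R + 2 * Q + K + 2) Q (barrier_hess A b e) \<epsilon> \<eta>)"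
      using A\<^sub>0[OF A] by blast
    have "\<exists>\<eta>>0. \<not> touching X f g (\<lambda>x. - \<psi>\<^sub>1 x) (barrier_hess A b e) Q K \<epsilon> \<eta>"
      if \<epsilon>: "0 < \<epsilon>" "\<epsilon> \<le> \<epsilon>\<^sub>0" for \<epsilon>
    proof -
      have h: "\<epsilon> \<le> 1" "\<epsilon> * norm (barrier_hess A b e) \<le> 1"
        using \<epsilon>\<^sub>0(2)[OF \<epsilon>] by auto
      obtain \<eta> where \<eta>: "0 < \<eta>" "\<eta> \<le> 1" "\<eta> * norm (mat 1 :: real^'n^'n) \<le> 1"
          "strict_gain_at \<Omega> F U (3 * R + 2 * Q + K + 2) Q (barrier_hess A b e) \<epsilon> \<eta>"
        using \<epsilon>\<^sub>0(2)[OF \<epsilon>] by blast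
      then show ?thesis
        using none[OF \<epsilon>(1) h(1) \<eta>] by blast
    qed
    then show ?thesis
      using \<epsilon>\<^sub>0(1) by blast
  qed
  then show ?thesis
    by blast
qed

text \<open>The ball is shrunk until values and gradient of \<open>f\<close> are bounded on it.
  \<open>no_touch\<close> is quantified over the gradient and all bounds because these are found
  only inside the proof.\<close>

lemma hopf_C11:
  fixes f :: "real^'n \<Rightarrow> real" and u :: "real^'n \<Rightarrow> ereal"
  assumes \<Omega>: "open \<Omega>" and e: "norm e = 1" and r0: "0 < r\<^sub>0" and C: "0 \<le> C"
    and inside: "\<And>x. x \<in> ball a r\<^sub>0 \<Longrightarrow> C * (norm (x - a))\<^sup>2 < (x - a) \<bullet> e \<Longrightarrow> x \<in> \<Omega>"
    and f: "C11_on (\<Omega> \<union> {a}) f" and lsc: "lsc_on (\<Omega> \<union> {a}) u"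
    and ua: "u a = ereal (f a)" and fu: "\<And>x. x \<in> \<Omega> \<Longrightarrow> ereal (f x) < u x"
    and no_touch: "\<And>X g R b Q K. (\<And>x. x \<in> X \<Longrightarrow> x \<in> \<Omega> \<and> norm x \<le> R \<and> \<bar>f x\<bar> \<le> R \<and> norm (g x) \<le> R) \<Longrightarrow> 0 \<le> Q \<Longrightarrow>
      \<exists>A\<^sub>0. \<forall>A\<ge>A\<^sub>0. \<exists>\<epsilon>\<^sub>0>0. \<forall>\<epsilon>. 0 < \<epsilon> \<and> \<epsilon> \<le> \<epsilon>\<^sub>0 \<longrightarrow>
        (\<exists>\<eta>>0. \<not> touching X f g u (barrier_hess A b e) Q K \<epsilon> \<eta>)"
  shows "\<exists>\<epsilon>>0. \<exists>t>0. \<forall>s. 0 < s \<and> s \<le> t \<longrightarrow>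
    a + s *\<^sub>R e \<in> \<Omega> \<and> ereal (f (a + s *\<^sub>R e) + \<epsilon> * s) \<le> u (a + s *\<^sub>R e)"
proof -
  define S where "S = \<Omega> \<union> {a}"
  obtain g where g: "\<And>x. x \<in> S \<Longrightarrow> (f has_derivative (\<lambda>h. g x \<bullet> h)) (at x within S)"
    "\<And>x. x \<in> S \<Longrightarrow> \<exists>r>0. \<exists>L. L-lipschitz_on (S \<inter> ball x r) g"
    using f unfolding C11_on_def S_def by blast
  have df: "(f has_derivative (\<lambda>h. g x \<bullet> h)) (at x)" if "x \<in> \<Omega>" for x
  proof -
    have "x \<in> interior S"
      using that \<Omega> by (auto simp: S_def interior_def)
    then show ?thesis
      using g(1)[of x] that at_within_interior[of x S] by (simp add: S_def)
  qed
  have cf: "continuous_on S f"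
    by (rule has_derivative_continuous_on[where f' = "\<lambda>x h. g x \<bullet> h", OF g(1)])
  have aS: "a \<in> S"
    by (simp add: S_def)
  obtain r1 L where r1: "0 < r1" "L-lipschitz_on (S \<inter> ball a r1) g"
    using g(2)[OF aS] by blast
  obtain r2 where r2: "0 < r2" "\<And>x. x \<in> S \<Longrightarrow> dist x a < r2 \<Longrightarrow> dist (f x) (f a) < 1"
    using cf aS zero_less_one unfolding continuous_on_iff by blast
  define r where "r = min r\<^sub>0 (min r1 r2)"
  have r: "0 < r" "r \<le> r\<^sub>0" "r \<le> r1" "r \<le> r2"
    using r0 r1 r2 by (auto simp: r_def)
  have L0: "0 \<le> L"
    using r1(2) lipschitz_on_nonneg by blast
  define R where "R = norm a + r + \<bar>f a\<bar> + 1 + norm (g a) + L * r"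
  have X: "x \<in> \<Omega> \<and> norm x \<le> R \<and> \<bar>f x\<bar> \<le> R \<and> norm (g x) \<le> R" if x: "x \<in> \<Omega> \<inter> ball a r" for x
  proof -
    have xa: "norm (x - a) < r" "dist x a < r2" "x \<in> S \<inter> ball a r1" "a \<in> S \<inter> ball a r1"
      using x r r1(1) by (auto simp: S_def dist_norm norm_minus_commute)
    have "norm x \<le> norm a + r"
      using norm_triangle_sub[of x a] xa(1) by linarith
    moreover have "\<bar>f x\<bar> \<le> \<bar>f a\<bar> + 1"
      using r2(2)[of x] xa(2,3) by (simp add: dist_real_def)
    moreover have "norm (g x) \<le> norm (g a) + L * r"
    proof -
      have "norm (g x - g a) \<le> L * norm (x - a)"
        using lipschitz_onD[OF r1(2) xa(3,4)] by (simp add: dist_norm)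
      also have "\<dots> \<le> L * r"
        using xa(1) L0 by (intro mult_left_mono) auto
      finally show ?thesis
        using norm_triangle_sub[of "g x" "g a"] by linarith
    qed
    moreover have "0 \<le> L * r"
      using L0 r(1) by simp
    moreover note norm_ge_zero[of a] norm_ge_zero[of "g a"] abs_ge_zero[of "f a"] r(1)
    ultimately have "norm x \<le> R" "\<bar>f x\<bar> \<le> R" "norm (g x) \<le> R"
      unfolding R_def by linarith+
    then show ?thesis
      using x by blast
  qed
  define b where "b = 3 * C + 1"
  define Q where "Q = 4 + b * r"
  have "0 \<le> Q"
    using C r(1) by (simp add: Q_def b_def)
  obtain A\<^sub>0 where A\<^sub>0: "\<And>A. A\<^sub>0 \<le> A \<Longrightarrow> \<exists>\<epsilon>\<^sub>0>0. \<forall>\<epsilon>. 0 < \<epsilon> \<and> \<epsilon> \<le> \<epsilon>\<^sub>0 \<longrightarrow>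
      (\<exists>\<eta>>0. \<not> touching (\<Omega> \<inter> ball a r) f g u (barrier_hess A b e) Q (real CARD('n) * (real CARD('n) * (L + 1))) \<epsilon> \<eta>)"
    using no_touch[of "\<Omega> \<inter> ball a r" R g Q b "real CARD('n) * (real CARD('n) * (L + 1))", OF X \<open>0 \<le> Q\<close>] by blast
  show ?thesis
  proof (rule hopf_of_no_touching[OF \<Omega> e r(1) C _ _ df cf[unfolded S_def] _ lsc ua fu _ A\<^sub>0])
    show "L-lipschitz_on (\<Omega> \<inter> ball a r) g"
      by (rule lipschitz_on_subset[OF r1(2)]) (use r(3) in \<open>auto simp: S_def\<close>)
    show "x \<in> \<Omega>" if "x \<in> ball a r" "C * (norm (x - a))\<^sup>2 < (x - a) \<bullet> e" for x
      using inside[of x] that r(2) by simp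
  qed (simp_all add: b_def Q_def)
qed

section \<open>Geometry at the boundary point and conclusion\<close>

lemma differentiable_has_grad:
  assumes "f differentiable (at x)"
  shows "(f has_derivative (\<lambda>h. grad f x \<bullet> h)) (at x)"
proof -
  define D where "D = frechet_derivative f (at x)"
  have D: "(f has_derivative D) (at x)"
    using assms frechet_derivative_works unfolding D_def by blast
  have "D h = adjoint D 1 \<bullet> h" for h
    using adjoint_works[OF has_derivative_linear[OF D], of h 1] by (simp add: inner_commute)
  then have "(f has_derivative (\<lambda>h. adjoint D 1 \<bullet> h)) (at x)"
    using D by (metis (no_types, lifting) ext)
  then show ?thesis
    using grad_eqI by metis
qed

text \<open>By its expansion at \<open>a\<close>, the defining function is at most its linear part
  plus a multiple of the squared distance, so it is negative wherever the linear part is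
  sufficiently negative.\<close>

lemma interior_paraboloid:
  assumes fr: "a \<in> frontier \<Omega>" and nu: "outward_unit_normal \<Omega> a \<nu>"
  obtains r C where "norm \<nu> = 1" "0 < r" "0 \<le> C"
    "\<And>x. x \<in> ball a r \<Longrightarrow> C * (norm (x - a))\<^sup>2 < (x - a) \<bullet> (- \<nu>) \<Longrightarrow> x \<in> \<Omega>"
proof -
  obtain W \<rho> where W: "a \<in> W" "C2_defining_function \<Omega> W \<rho>" and \<nu>: "\<nu> = grad \<rho> a /\<^sub>R norm (grad \<rho> a)"
    using nu unfolding outward_unit_normal_def by blast
  define G where "G = norm (grad \<rho> a)"
  have G: "0 < G"
    using W by (simp add: C2_defining_function_def G_def)
  have \<rho>: "open W" "\<rho> a = 0" "\<And>y. y \<in> W \<Longrightarrow> \<rho> y < 0 \<Longrightarrow> y \<in> \<Omega>"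
    using W fr unfolding C2_defining_function_def by blast+
  have d: "(\<rho> has_derivative (\<lambda>h. grad \<rho> x \<bullet> h)) (at x)" if "x \<in> W" for x
    using W(2) that differentiable_has_grad unfolding C2_defining_function_def C2_on_def by blast
  obtain B where B: "(grad \<rho> has_derivative B) (at a)"
    using W unfolding C2_defining_function_def C2_on_def differentiable_def by blast
  obtain r1 where r1: "0 < r1" "ball a r1 \<subseteq> W"
    using \<rho>(1) W(1) open_contains_ball by blast
  obtain r2 where r2: "0 < r2" "\<And>h. norm h < r2 \<Longrightarrow>
      \<bar>\<rho> (a + h) - \<rho> a - grad \<rho> a \<bullet> h - (h \<bullet> B h) / 2\<bar> \<le> 1 * (norm h)\<^sup>2"
    using second_order_expansion[OF r1(1) _ B zero_less_one, of \<rho>] d r1(2) by blast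
  obtain k where k: "0 \<le> k" "\<And>h. norm (B h) \<le> norm h * k"
    using bounded_linear.nonneg_bounded[OF has_derivative_bounded_linear[OF B]] by blast
  \<comment> \<open>The quadratic form contributes at most \<open>k / 2\<close> and the remainder 1;
    dividing by \<open>G\<close> passes from the gradient to the unit normal.\<close>
  define C where "C = (1 + k) / G"
  show ?thesis
  proof (rule that[of "min r1 r2" C])
    show "norm \<nu> = 1"
      using G by (simp add: \<nu> G_def)
    show "0 < min r1 r2" "0 \<le> C"
      using r1(1) r2(1) k(1) G by (auto simp: C_def)
    fix x
    assume x: "x \<in> ball a (min r1 r2)" and lt: "C * (norm (x - a))\<^sup>2 < (x - a) \<bullet> (- \<nu>)"
    define h where "h = x - a"
    have h: "norm h < r2" "x \<in> W" "x = a + h"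
      using x r1(2) by (auto simp: h_def dist_norm norm_minus_commute)
    have "h \<bullet> B h \<le> norm h * norm (B h)"
      by (rule norm_cauchy_schwarz)
    also have "\<dots> \<le> norm h * (norm h * k)"
      using k(2) by (intro mult_left_mono) auto
    finally have "h \<bullet> B h \<le> k * (norm h)\<^sup>2"
      by (simp add: power2_eq_square mult_ac)
    moreover have "\<rho> x \<le> grad \<rho> a \<bullet> h + (h \<bullet> B h) / 2 + (norm h)\<^sup>2"
      using r2(2)[OF h(1)] \<rho>(2) h(3) by (simp add: abs_le_iff)
    moreover have "0 \<le> k * (norm h)\<^sup>2"
      using k(1) by simp
    moreover have "(1 + k) * (norm h)\<^sup>2 < - (grad \<rho> a \<bullet> h)"
    proof -
      have "(x - a) \<bullet> (- \<nu>) = - (grad \<rho> a \<bullet> h) / G"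
        by (simp add: \<nu> G_def h_def inner_commute divide_inverse)
      moreover have "C * (norm (x - a))\<^sup>2 = ((1 + k) * (norm h)\<^sup>2) / G"
        by (simp add: C_def h_def)
      ultimately have "((1 + k) * (norm h)\<^sup>2) / G < (- (grad \<rho> a \<bullet> h)) / G"
        using lt by (simp only:)
      then show ?thesis
        using G unfolding divide_less_cancel by blast
    qed
    ultimately have "\<rho> x < 0"
      by (simp add: distrib_right)
    then show "x \<in> \<Omega>"
      using \<rho>(3) h(2) by blast
  qed
qed

lemma C11_on_uminus:
  assumes "C11_on S f"
  shows "C11_on S (\<lambda>x. - f x)"
proof -
  obtain g where g: "\<And>x. x \<in> S \<Longrightarrow> (f has_derivative (\<lambda>h. g x \<bullet> h)) (at x within S)"
    "\<And>x. x \<in> S \<Longrightarrow> \<exists>r>0. \<exists>L. L-lipschitz_on (S \<inter> ball x r) g"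
    using assms unfolding C11_on_def by blast
  have "((\<lambda>x. - f x) has_derivative (\<lambda>h. (- g x) \<bullet> h)) (at x within S)" if "x \<in> S" for x
    using has_derivative_minus[OF g(1)[OF that]] by simp
  moreover have "L-lipschitz_on T (\<lambda>x. - g x)" if "L-lipschitz_on T g" for L T
    using that by (simp add: lipschitz_on_def dist_norm norm_minus_commute)
  ultimately show ?thesis
    unfolding C11_on_def using g(2) by (intro exI[of _ "\<lambda>x. - g x"]) blast
qed

lemma lsc_on_uminus:
  assumes "usc_on S f"
  shows "lsc_on S (\<lambda>x. - f x)"
  using assms unfolding usc_on_def lsc_on_def by (simp add: ereal_Liminf_uminus)

lemma Liminf_quotient_pos:
  fixes q :: "real \<Rightarrow> ereal"
  assumes "0 < \<epsilon>" "0 < t" and le: "\<And>s. 0 < s \<Longrightarrow> s \<le> t \<Longrightarrow> ereal (\<epsilon> * s) \<le> q s"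
  shows "0 < Liminf (at_right 0) (\<lambda>s. q s / ereal s)"
proof -
  have "\<forall>\<^sub>F s in at_right 0. ereal \<epsilon> \<le> q s / ereal s"
    unfolding eventually_at_right_field
  proof (intro exI[of _ t] conjI allI impI)
    fix s
    assume s: "0 < s" "s < t"
    then have "ereal (\<epsilon> * s) / ereal s \<le> q s / ereal s"
      using le[of s] by (intro ereal_divide_right_mono) auto
    then show "ereal \<epsilon> \<le> q s / ereal s"
      using s(1) by simp
  qed (rule assms(2))
  then have "ereal \<epsilon> \<le> Liminf (at_right 0) (\<lambda>s. q s / ereal s)"
    by (rule Liminf_bounded)
  then show ?thesis
    using assms(1) by (metis ereal_less(2) less_le_trans)
qed

theorem theorem2p4:
  fixes \<Omega> :: "(real^'n) set"
    and x\<^sub>h \<nu> :: "real^'n"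
    and U :: "'n jet set"
    and F :: "'n jet \<Rightarrow> real"
    and \<psi>\<^sub>1 \<psi>\<^sub>2 :: "real^'n \<Rightarrow> ereal"
  assumes "open \<Omega>"
    and "x\<^sub>h \<in> frontier \<Omega>"
    and "C2_boundary_near \<Omega> x\<^sub>h"
    and "outward_unit_normal \<Omega> x\<^sub>h \<nu>"
    and "U \<noteq> {}"
    and "openin (top_of_set (jet_space \<Omega>)) U"
    and "continuous_on (closure U) F"
    and "elliptic F U"
    and "boundary_below_one \<Omega> F U"
    and "locally_strictly_elliptic F U"
    and "locally_lipschitz_in_jet F U"
    and "usc_on (\<Omega> \<union> {x\<^sub>h}) \<psi>\<^sub>1" and "\<forall>x \<in> \<Omega> \<union> {x\<^sub>h}. \<psi>\<^sub>1 x \<noteq> \<infinity>"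
    and "lsc_on (\<Omega> \<union> {x\<^sub>h}) \<psi>\<^sub>2" and "\<forall>x \<in> \<Omega> \<union> {x\<^sub>h}. \<psi>\<^sub>2 x \<noteq> -\<infinity>"
    and "viscosity_subsolution F U \<Omega> \<psi>\<^sub>1"
    and "viscosity_supersolution F U \<Omega> \<psi>\<^sub>2"
    and "\<forall>x\<in>\<Omega>. \<psi>\<^sub>1 x < \<psi>\<^sub>2 x"
    and "\<psi>\<^sub>1 x\<^sub>h = \<psi>\<^sub>2 x\<^sub>h"
    and "ereal_C11_on (\<Omega> \<union> {x\<^sub>h}) \<psi>\<^sub>1 \<or> ereal_C11_on (\<Omega> \<union> {x\<^sub>h}) \<psi>\<^sub>2"
  shows "Liminf (at_right 0)
           (\<lambda>s::real. (\<psi>\<^sub>2 (x\<^sub>h - s *\<^sub>R \<nu>) - \<psi>\<^sub>1 (x\<^sub>h - s *\<^sub>R \<nu>)) / ereal s) > 0"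
proof -
  note conds = assms(6-11)
  obtain r C where geo: "norm \<nu> = 1" "0 < r" "0 \<le> C"
    "\<And>x. x \<in> ball x\<^sub>h r \<Longrightarrow> C * (norm (x - x\<^sub>h))\<^sup>2 < (x - x\<^sub>h) \<bullet> (- \<nu>) \<Longrightarrow> x \<in> \<Omega>"
    using interior_paraboloid[OF assms(2,4)] by blast
  have e: "norm (- \<nu>) = 1"
    using geo(1) by simp
  show ?thesis
    using assms(20)
  proof
    assume "ereal_C11_on (\<Omega> \<union> {x\<^sub>h}) \<psi>\<^sub>1"
    then obtain f where f: "C11_on (\<Omega> \<union> {x\<^sub>h}) f" "\<And>x. x \<in> \<Omega> \<union> {x\<^sub>h} \<Longrightarrow> \<psi>\<^sub>1 x = ereal (f x)"
      unfolding ereal_C11_on_def by blast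
    have "\<exists>\<epsilon>>0. \<exists>t>0. \<forall>s. 0 < s \<and> s \<le> t \<longrightarrow> x\<^sub>h + s *\<^sub>R (- \<nu>) \<in> \<Omega> \<and>
        ereal (f (x\<^sub>h + s *\<^sub>R (- \<nu>)) + \<epsilon> * s) \<le> \<psi>\<^sub>2 (x\<^sub>h + s *\<^sub>R (- \<nu>))"
    proof (rule hopf_C11[OF assms(1) e geo(2,3) _ f(1) assms(14)])
      show "x \<in> \<Omega>" if "x \<in> ball x\<^sub>h r" "C * (norm (x - x\<^sub>h))\<^sup>2 < (x - x\<^sub>h) \<bullet> (- \<nu>)" for x
        using geo(4) that .
      show "\<psi>\<^sub>2 x\<^sub>h = ereal (f x\<^sub>h)" "\<And>x. x \<in> \<Omega> \<Longrightarrow> ereal (f x) < \<psi>\<^sub>2 x"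
        using assms(18,19) f(2) by auto
      fix X g R b Q K
      assume X: "\<And>x. x \<in> X \<Longrightarrow> x \<in> \<Omega> \<and> norm x \<le> R \<and> \<bar>f x\<bar> \<le> R \<and> norm (g x :: real^'n) \<le> R"
        and Q: "0 \<le> (Q :: real)"
      have "\<psi>\<^sub>1 x = ereal (f x)" if "x \<in> \<Omega>" for x
        using f(2) that by simp
      then show "\<exists>A\<^sub>0. \<forall>A\<ge>A\<^sub>0. \<exists>\<epsilon>\<^sub>0>0. \<forall>\<epsilon>. 0 < \<epsilon> \<and> \<epsilon> \<le> \<epsilon>\<^sub>0 \<longrightarrow>
          (\<exists>\<eta>>0. \<not> touching X f g \<psi>\<^sub>2 (barrier_hess A b (- \<nu>)) Q K \<epsilon> \<eta>)"
        by (rule no_touching_C11_subsolution[OF conds e Q assms(1,16,17) _ X])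
    qed
    then obtain \<epsilon> t where \<epsilon>t: "0 < \<epsilon>" "0 < t" "\<And>s. 0 < s \<Longrightarrow> s \<le> t \<Longrightarrow> x\<^sub>h + s *\<^sub>R (- \<nu>) \<in> \<Omega> \<and>
        ereal (f (x\<^sub>h + s *\<^sub>R (- \<nu>)) + \<epsilon> * s) \<le> \<psi>\<^sub>2 (x\<^sub>h + s *\<^sub>R (- \<nu>))"
      by blast
    \<comment> \<open>\<open>\<psi>\<^sub>2 x\<close> may be infinite, but
      \<open>\<psi>\<^sub>1 x\<close> is the real number \<open>f x\<close>, so the extended
      subtraction is harmless.\<close>
    have "ereal (\<epsilon> * s) \<le> \<psi>\<^sub>2 x - \<psi>\<^sub>1 x" if "x \<in> \<Omega>" "ereal (f x + \<epsilon> * s) \<le> \<psi>\<^sub>2 x" for x s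
      using that f(2)[of x] by (cases "\<psi>\<^sub>2 x") auto
    then have "ereal (\<epsilon> * s) \<le> \<psi>\<^sub>2 (x\<^sub>h - s *\<^sub>R \<nu>) - \<psi>\<^sub>1 (x\<^sub>h - s *\<^sub>R \<nu>)" if "0 < s" "s \<le> t" for s
      using \<epsilon>t(3)[OF that] by simp
    then show ?thesis
      by (rule Liminf_quotient_pos[OF \<epsilon>t(1,2)])
  next
    assume "ereal_C11_on (\<Omega> \<union> {x\<^sub>h}) \<psi>\<^sub>2"
    then obtain f where f: "C11_on (\<Omega> \<union> {x\<^sub>h}) f" "\<And>x. x \<in> \<Omega> \<union> {x\<^sub>h} \<Longrightarrow> \<psi>\<^sub>2 x = ereal (f x)"
      unfolding ereal_C11_on_def by blast
    have "\<exists>\<epsilon>>0. \<exists>t>0. \<forall>s. 0 < s \<and> s \<le> t \<longrightarrow> x\<^sub>h + s *\<^sub>R (- \<nu>) \<in> \<Omega> \<and>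
        ereal (- f (x\<^sub>h + s *\<^sub>R (- \<nu>)) + \<epsilon> * s) \<le> - \<psi>\<^sub>1 (x\<^sub>h + s *\<^sub>R (- \<nu>))"
    proof (rule hopf_C11[OF assms(1) e geo(2,3) _ C11_on_uminus[OF f(1)] lsc_on_uminus[OF assms(12)]])
      show "x \<in> \<Omega>" if "x \<in> ball x\<^sub>h r" "C * (norm (x - x\<^sub>h))\<^sup>2 < (x - x\<^sub>h) \<bullet> (- \<nu>)" for x
        using geo(4) that .
      show "- \<psi>\<^sub>1 x\<^sub>h = ereal (- f x\<^sub>h)"
        using assms(19) f(2) by simp
      show "ereal (- f x) < - \<psi>\<^sub>1 x" if "x \<in> \<Omega>" for x
        using assms(18) f(2)[of x] that by (cases "\<psi>\<^sub>1 x") auto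
      fix X g R b Q K
      assume X: "\<And>x. x \<in> X \<Longrightarrow> x \<in> \<Omega> \<and> norm x \<le> R \<and> \<bar>- f x\<bar> \<le> R \<and> norm (g x :: real^'n) \<le> R"
        and Q: "0 \<le> (Q :: real)"
      have "\<psi>\<^sub>2 x = ereal (- (- f x))" if "x \<in> \<Omega>" for x
        using f(2) that by simp
      then show "\<exists>A\<^sub>0. \<forall>A\<ge>A\<^sub>0. \<exists>\<epsilon>\<^sub>0>0. \<forall>\<epsilon>. 0 < \<epsilon> \<and> \<epsilon> \<le> \<epsilon>\<^sub>0 \<longrightarrow>
          (\<exists>\<eta>>0. \<not> touching X (\<lambda>x. - f x) g (\<lambda>x. - \<psi>\<^sub>1 x) (barrier_hess A b (- \<nu>)) Q K \<epsilon> \<eta>)"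
        by (rule no_touching_C11_supersolution[OF conds e Q assms(1,16,17) _ X])
    qed
    then obtain \<epsilon> t where \<epsilon>t: "0 < \<epsilon>" "0 < t" "\<And>s. 0 < s \<Longrightarrow> s \<le> t \<Longrightarrow> x\<^sub>h + s *\<^sub>R (- \<nu>) \<in> \<Omega> \<and>
        ereal (- f (x\<^sub>h + s *\<^sub>R (- \<nu>)) + \<epsilon> * s) \<le> - \<psi>\<^sub>1 (x\<^sub>h + s *\<^sub>R (- \<nu>))"
      by blast
    have "ereal (\<epsilon> * s) \<le> \<psi>\<^sub>2 x - \<psi>\<^sub>1 x" if "x \<in> \<Omega>" "ereal (- f x + \<epsilon> * s) \<le> - \<psi>\<^sub>1 x" for x s
      using that f(2)[of x] by (cases "\<psi>\<^sub>1 x") auto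
    then have "ereal (\<epsilon> * s) \<le> \<psi>\<^sub>2 (x\<^sub>h - s *\<^sub>R \<nu>) - \<psi>\<^sub>1 (x\<^sub>h - s *\<^sub>R \<nu>)" if "0 < s" "s \<le> t" for s
      using \<epsilon>t(3)[OF that] by simp
    then show ?thesis
      by (rule Liminf_quotient_pos[OF \<epsilon>t(1,2)])
  qed
qed

end
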